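(* Let $\theta_1,\theta_2>0$. If $u\in L(\Omega)$ satisfies $\mathcal{E}_{p}^{\theta_1,\theta_2}(u)<\infty$ for some $p>P(\theta_1,\theta_2)$, then $u\in S(\Omega)$.
   Context: Setting: $n_1,n_2\ge 1$, $n=n_1+n_2$, $\mathbf{R}^n=X_1\oplus X_2$ with $X_1\perp X_2$ and $\dim X_l=n_l$; each $x\in\mathbf{R}^n$ is written $x=x_1+x_2$ with $x_l\in X_l$. For $l=1,2$, $\Omega_l\subset X_l$ is a non-empty bounded connected open subset of $X_l$, and $\Omega:=\Omega_1+\Omega_2\subset\mathbf{R}^n$. $L(U)$ denotes the space of real-valued Lebesgue-measurable functions on $U$. The set $S(\Omega)$ consists of all $u\in L(\Omega)$ such that for $l=1$ or $l=2$ there is $u_l\in L(\Omega_l)$ with $u(x)=u_l(x_l)$ for almost every $x\in\Omega$. Kernel: $\rho\in L^1(\mathbf{R}^n,[0,\infty))$ is a fixed radial function with $\int\rho=1$ and $\operatorname{supp}\rho\subset B_1$; $\rho_\varepsilon(z):=\varepsilon^{-n}\rho(z/\varepsilon)$. Energies: for $\varepsilon>0$, $\Omega_l^\varepsilon:=\bigcap_{z_l\in X_l,\,|z_l|<\varepsilon}(\Omega_l-z_l)$ and $\Omega^\varepsilon:=\Omega_1^\varepsilon+\Omega_2^\varepsilon$. For $p,\theta_1,\theta_2>0$ and $u\in L(\Omega)$, $$\mathcal{E}_{\varepsilon,p}^{\theta_1,\theta_2}(u):=\int_{\mathbf{R}^n}\rho_\varepsilon(z)\int_{\Omega^\varepsilon}\frac{|u(x+z_1)-u(x)|^{\theta_1}\,|u(x+z_2)-u(x)|^{\theta_2}}{|z|^p}\,dx\,dz,\qquad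 \mathcal{E}_p^{\theta_1,\theta_2}(u):=\liminf_{\varepsilon\downarrow 0}\mathcal{E}_{\varepsilon,p}^{\theta_1,\theta_2}(u).$$ Exponent: with $\theta:=\theta_1+\theta_2$, $P(\theta_1,\theta_2):=2$ if $\theta\le 1$; $P(\theta_1,\theta_2):=1+\theta$ if $\theta\ge 1$ and $\min(\theta_1,\theta_2)\le 1$; $P(\theta_1,\theta_2):=\min(\theta_1,\theta_2)+\theta$ if $\theta_1,\theta_2>1$. *)

theory Defs
  imports "HOL-Analysis.Analysis"
begin

definition orthogonal_decomposition :: "'a::euclidean_space set \<Rightarrow> 'a set \<Rightarrow> bool" where
  "orthogonal_decomposition X1 X2 \<longleftrightarrow>
     subspace X1 \<and> subspace X2 \<and> 1 \<le> dim X1 \<and> 1 \<le> dim X2 \<and>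
     (\<forall>x\<in>X1. \<forall>y\<in>X2. orthogonal x y) \<and> X1 + X2 = UNIV"

text \<open>The summand \<open>x\<^sub>1 \<in> X\<close> of \<open>x = x\<^sub>1 + x\<^sub>2\<close> with \<open>x\<^sub>2 \<in> Y\<close>.\<close>

definition component_along :: "'a::euclidean_space set \<Rightarrow> 'a set \<Rightarrow> 'a \<Rightarrow> 'a" where
  "component_along X Y x = (THE y. y \<in> X \<and> x - y \<in> Y)"

lemma component_along_props:
  assumes "orthogonal_decomposition X1 X2"
  shows "component_along X1 X2 x \<in> X1" "component_along X2 X1 x \<in> X2"
    and "x = component_along X1 X2 x + component_along X2 X1 x"
proof -
  have s: "subspace X1" "subspace X2" and orth: "\<And>x y. x \<in> X1 \<Longrightarrow> y \<in> X2 \<Longrightarrow> x \<bullet> y = 0"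
    and sum: "X1 + X2 = UNIV"
    using assms by (auto simp: orthogonal_decomposition_def orthogonal_def)
  obtain a b where ab: "a \<in> X1" "b \<in> X2" "x = a + b"
    using sum by (metis UNIV_I set_plus_elim)
  have uniq: "y = 0" if "y \<in> X1" "y \<in> X2" for y
    using orth[OF that] by simp
  have "component_along X1 X2 x = a"
    unfolding component_along_def
  proof (rule the_equality)
    fix y assume y: "y \<in> X1 \<and> x - y \<in> X2"
    have "y - a \<in> X1" using y ab s(1) by (simp add: subspace_diff)
    moreover have "b - (x - y) \<in> X2" using y ab(2) s(2) by (blast intro: subspace_diff)
    moreover have "b - (x - y) = y - a" using ab(3) by simp
    ultimately show "y = a" using uniq[of "y - a"] by (metis eq_iff_diff_eq_0)
  qed (use ab in simp)
  moreover have "component_along X2 X1 x = b"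
    unfolding component_along_def
  proof (rule the_equality)
    fix y assume y: "y \<in> X2 \<and> x - y \<in> X1"
    have "y - b \<in> X2" using y ab s(2) by (simp add: subspace_diff)
    moreover have "a - (x - y) \<in> X1" using y ab(1) s(1) by (blast intro: subspace_diff)
    moreover have "a - (x - y) = y - b" using ab(3) by simp
    ultimately show "y = b" using uniq[of "y - b"] by (metis eq_iff_diff_eq_0)
  qed (use ab in simp)
  ultimately show "component_along X1 X2 x \<in> X1" "component_along X2 X1 x \<in> X2"
    "x = component_along X1 X2 x + component_along X2 X1 x"
    using ab by auto
qed

definition orthonormal_basis_of :: "'a::euclidean_space set \<Rightarrow> 'a set \<Rightarrow> bool" where
  "orthonormal_basis_of X B \<longleftrightarrow>
     B \<subseteq> X \<and> pairwise orthogonal B \<and> (\<forall>b\<in>B. norm b = 1) \<and> span B = X"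

lemma orthonormal_basis_of_exists:
  assumes "subspace X"
  shows "\<exists>B. orthonormal_basis_of X B"
  using orthonormal_basis_subspace[OF assms] unfolding orthonormal_basis_of_def by metis

text \<open>
  Lebesgue measure on a linear subspace, following the construction of \<^const>\<open>lborel\<close>, with an
  orthonormal basis of the subspace in place of \<^const>\<open>Basis\<close>. By invariance of Lebesgue measure
  under isometries it does not depend on the chosen basis.
\<close>

definition subspace_lebesgue :: "'a::euclidean_space set \<Rightarrow> 'a measure" where
  "subspace_lebesgue X =
     (let B = (SOME B. orthonormal_basis_of X B)
      in completion (distr (\<Pi>\<^sub>M b\<in>B. lborel) (restrict_space borel X) (\<lambda>f. \<Sum>b\<in>B. f b *\<^sub>R b)))"

lemma coordinates_measurable:
  assumes "orthonormal_basis_of X B"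
  shows "(\<lambda>f. \<Sum>b\<in>B. f b *\<^sub>R b) \<in> (\<Pi>\<^sub>M b\<in>B. lborel) \<rightarrow>\<^sub>M restrict_space borel X"
proof (rule measurable_restrict_space2)
  show "(\<lambda>f. \<Sum>b\<in>B. f b *\<^sub>R b) \<in> space (\<Pi>\<^sub>M b\<in>B. lborel) \<rightarrow> X"
  proof
    fix f :: "'a \<Rightarrow> real"
    have "(\<Sum>b\<in>B. f b *\<^sub>R b) \<in> span B"
      by (intro span_sum span_scale span_base)
    then show "(\<Sum>b\<in>B. f b *\<^sub>R b) \<in> X"
      using assms by (simp add: orthonormal_basis_of_def)
  qed
  show "(\<lambda>f. \<Sum>b\<in>B. f b *\<^sub>R b) \<in> (\<Pi>\<^sub>M b\<in>B. lborel) \<rightarrow>\<^sub>M borel"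
    by measurable
qed

lemma space_subspace_lebesgue [simp]: "space (subspace_lebesgue X) = X"
  by (simp add: subspace_lebesgue_def Let_def space_restrict_space)

text \<open>
  The class of functions depending on only one of the two variables, almost everywhere on
  \<open>\<Omega> = \<Omega>\<^sub>1 + \<Omega>\<^sub>2\<close>.
\<close>

definition one_variable_functions ::
    "'a::euclidean_space set \<Rightarrow> 'a set \<Rightarrow> 'a set \<Rightarrow> 'a set \<Rightarrow> ('a \<Rightarrow> real) set" where
  "one_variable_functions X1 X2 \<Omega>1 \<Omega>2 =
     {u \<in> borel_measurable (lebesgue_on (\<Omega>1 + \<Omega>2)).
        (\<exists>u1 \<in> borel_measurable (restrict_space (subspace_lebesgue X1) \<Omega>1).
           AE x in lebesgue_on (\<Omega>1 + \<Omega>2). u x = u1 (component_along X1 X2 x)) \<or>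
        (\<exists>u2 \<in> borel_measurable (restrict_space (subspace_lebesgue X2) \<Omega>2).
           AE x in lebesgue_on (\<Omega>1 + \<Omega>2). u x = u2 (component_along X2 X1 x))}"

text \<open>
  The support condition uses the closed unit ball, so kernels supported in the open unit ball are
  covered as well.
\<close>

definition radial_kernel :: "('a::euclidean_space \<Rightarrow> real) \<Rightarrow> bool" where
  "radial_kernel \<rho> \<longleftrightarrow>
     integrable lebesgue \<rho> \<and> (\<forall>z. 0 \<le> \<rho> z) \<and>
     (\<forall>y z. norm y = norm z \<longrightarrow> \<rho> y = \<rho> z) \<and>
     (LINT z|lebesgue. \<rho> z) = 1 \<and>
     closure {z. \<rho> z \<noteq> 0} \<subseteq> cball 0 1"

definition rescaled_kernel :: "('a::euclidean_space \<Rightarrow> real) \<Rightarrow> real \<Rightarrow> 'a \<Rightarrow> real" where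
  "rescaled_kernel \<rho> \<epsilon> z = \<rho> (z /\<^sub>R \<epsilon>) / \<epsilon> ^ DIM('a)"

definition inner_domain :: "'a::euclidean_space set \<Rightarrow> 'a set \<Rightarrow> real \<Rightarrow> 'a set" where
  "inner_domain X \<Omega> \<epsilon> = (\<Inter>z\<in>{z\<in>X. norm z < \<epsilon>}. (\<lambda>x. x - z) ` \<Omega>)"

text \<open>
  The integrals take values in \<open>[0, \<infinity>]\<close>. The value of the quotient at \<open>z = 0\<close> and the values
  of \<open>u\<close> outside \<open>\<Omega>\<^sub>1 + \<Omega>\<^sub>2\<close> are irrelevant: they only matter for \<open>z\<close> in a null set or where
  the kernel vanishes.
\<close>

definition energy_eps ::
    "'a::euclidean_space set \<Rightarrow> 'a set \<Rightarrow> 'a set \<Rightarrow> 'a set \<Rightarrow> ('a \<Rightarrow> real) \<Rightarrow>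
     real \<Rightarrow> real \<Rightarrow> real \<Rightarrow> real \<Rightarrow> ('a \<Rightarrow> real) \<Rightarrow> ennreal" where
  "energy_eps X1 X2 \<Omega>1 \<Omega>2 \<rho> \<theta>1 \<theta>2 p \<epsilon> u =
     (\<integral>\<^sup>+ z. ennreal (rescaled_kernel \<rho> \<epsilon> z) *
        (\<integral>\<^sup>+ x \<in> inner_domain X1 \<Omega>1 \<epsilon> + inner_domain X2 \<Omega>2 \<epsilon>.
           ennreal (\<bar>u (x + component_along X1 X2 z) - u x\<bar> powr \<theta>1 *
                    \<bar>u (x + component_along X2 X1 z) - u x\<bar> powr \<theta>2 / norm z powr p)
         \<partial>lebesgue) \<partial>lebesgue)"

definition energy ::
    "'a::euclidean_space set \<Rightarrow> 'a set \<Rightarrow> 'a set \<Rightarrow> 'a set \<Rightarrow> ('a \<Rightarrow> real) \<Rightarrow>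
     real \<Rightarrow> real \<Rightarrow> real \<Rightarrow> ('a \<Rightarrow> real) \<Rightarrow> ennreal" where
  "energy X1 X2 \<Omega>1 \<Omega>2 \<rho> \<theta>1 \<theta>2 p u =
     Liminf (at_right 0) (\<lambda>\<epsilon>. energy_eps X1 X2 \<Omega>1 \<Omega>2 \<rho> \<theta>1 \<theta>2 p \<epsilon> u)"

definition critical_exponent :: "real \<Rightarrow> real \<Rightarrow> real" where
  "critical_exponent \<theta>1 \<theta>2 =
     (if \<theta>1 + \<theta>2 \<le> 1 then 2
      else if min \<theta>1 \<theta>2 \<le> 1 then 1 + (\<theta>1 + \<theta>2)
      else min \<theta>1 \<theta>2 + (\<theta>1 + \<theta>2))"

end

theory Submission
  imports Defs
begin

text \<open>
  The energy controls increments of \<open>u\<close> at small scales \<open>z\<close>; the conclusion concerns increments at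
  a fixed scale \<open>h\<close>. The passage between the two is a combinatorial estimate on a square grid with
  \<open>m * m\<close> cells (\<open>min_increment_powr_le\<close>): for \<open>\<theta> = \<theta>1 + \<theta>2\<close>, the \<open>\<theta>\<close>-th power of the smaller of the two
  increments along the sides of the grid is at most a constant times \<open>m powr (P - 2)\<close>, with \<open>P\<close> the
  critical exponent, times the sum over all cells and corners of the products of the increments with
  powers \<open>\<theta>1\<close> and \<open>\<theta>2\<close>. If one exponent, say \<open>\<theta>1\<close>, is at most 1, this is seen from the level sets.
  A level that separates the corner value from the values at the ends of both sides must, in some
  horizontal strip of the grid, cease to separate the two rows that bound the strip, and the levels
  that are lost in a strip have measure at most a multiple of the power \<open>1 / \<theta>\<close> of its energy
  (\<open>emeasure_strip_levels_le\<close>). Summation over the \<open>m\<close> strips costs \<open>m powr (\<theta> - 1)\<close> if \<open>\<theta> \<ge> 1\<close> and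
  nothing otherwise. If both exponents exceed 1, the Hoelder inequality reduces to the case in which
  the smaller one is 1.
  
  Integrating over the base point of the grid with step \<open>z\<close> and \<open>m\<close> about \<open>norm h / norm z\<close>
  turns the factor into \<open>m powr P\<close>, which is of lower order than the weight \<open>norm z powr - p\<close> in the
  energy because \<open>p > P\<close>. The radial kernel charges a cone around \<open>h\<close> with a fixed mass and is
  invariant under the reflections that exchange the corners of a cell. Hence, along a sequence of
  scales with bounded energy, one obtains in the limit that for every small displacement \<open>h\<close> with
  components \<open>h1\<close> and \<open>h2\<close>, almost everywhere locally, \<open>u (x + h1) = u x\<close> or \<open>u (x + h2) = u x\<close>
  (\<open>simultaneous_increments_vanish\<close>).
  
  This alternative depends on \<open>x\<close> and \<open>h\<close>. A Fubini argument makes it uniform on small cells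
  (\<open>local_dichotomy\<close>), and connectedness of the two factors makes it uniform on the domain
  (\<open>global_dichotomy\<close>). Independence of one variable near every point finally yields a Borel function
  of the other variable that represents \<open>u\<close> (\<open>function_of_P_component\<close>).
\<close>

section \<open>Power sums\<close>

lemma powr_sum_le_sum_powr:
  fixes f :: "'i \<Rightarrow> real"
  assumes "finite I" "\<And>i. i \<in> I \<Longrightarrow> 0 \<le> f i" "0 < q" "q \<le> 1"
  shows "(\<Sum>i\<in>I. f i) powr q \<le> (\<Sum>i\<in>I. f i powr q)"
proof (cases "(\<Sum>i\<in>I. f i) = 0")
  case True
  then show ?thesis by (simp add: sum_nonneg)
next
  case False
  define s where "s = (\<Sum>i\<in>I. f i)"
  have s: "s > 0"
    using False assms(2) unfolding s_def by (metis order_less_le sum_nonneg)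
  have "f i / s \<le> (f i / s) powr q" if "i \<in> I" for i
  proof -
    have "f i \<le> s" unfolding s_def using assms(1,2) that by (intro member_le_sum) auto
    then have "f i / s \<le> 1" "0 \<le> f i / s" using s assms(2) that by auto
    then show ?thesis
      using assms(3,4) powr_mono'[of q 1 "f i / s"] by (simp only: powr_one' abs_of_nonneg)
  qed
  then have "(\<Sum>i\<in>I. f i / s) \<le> (\<Sum>i\<in>I. (f i / s) powr q)"
    by (rule sum_mono)
  moreover have "(\<Sum>i\<in>I. f i / s) = 1"
    using s by (simp add: s_def sum_divide_distrib[symmetric])
  moreover have "(\<Sum>i\<in>I. (f i / s) powr q) = (\<Sum>i\<in>I. f i powr q) / s powr q"
    using s assms(2) by (simp add: powr_divide sum_divide_distrib)
  ultimately have "1 \<le> (\<Sum>i\<in>I. f i powr q) / s powr q" by simp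
  then show ?thesis
    using s by (simp add: s_def field_simps)
qed

lemma powr_sum_le_card_powr:
  fixes f :: "'i \<Rightarrow> real"
  assumes "finite I" "\<And>i. i \<in> I \<Longrightarrow> 0 \<le> f i" "1 \<le> q"
  shows "(\<Sum>i\<in>I. f i) powr q \<le> real (card I) powr (q - 1) * (\<Sum>i\<in>I. f i powr q)"
proof -
  define J where "J = {i \<in> I. 0 < f i}"
  have J: "finite J" "J \<subseteq> I" and cardJ: "real (card J) \<le> real (card I)"
    using assms(1) by (auto simp: J_def intro: card_mono)
  have z: "f i = 0" if "i \<in> I - J" for i
    using assms(2)[of i] that by (force simp: J_def)
  have eq: "(\<Sum>i\<in>I. f i) = (\<Sum>i\<in>J. f i)" "(\<Sum>i\<in>I. f i powr q) = (\<Sum>i\<in>J. f i powr q)"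
    using z assms(1) J by (auto intro!: sum.mono_neutral_right)
  show ?thesis
  proof (cases "J = {}")
    case True
    then show ?thesis unfolding eq by simp
  next
    case False
    define N where "N = real (card J)"
    have N: "N > 0" using False J by (simp add: N_def card_gt_0_iff)
    have pos: "0 \<le> (\<Sum>i\<in>J. f i)" by (auto simp: J_def intro!: sum_nonneg)
    have "(\<Sum>i\<in>J. (1 / N) *\<^sub>R f i) powr q \<le> (\<Sum>i\<in>J. (1 / N) * (f i powr q))"
    proof (rule convex_on_sum[OF J(1) False, where C = "{0<..}"])
      show "convex_on {0<..} (\<lambda>x. x powr q)"
        using assms(3) by (rule powr_convex)
    qed (use N in \<open>auto simp: N_def J_def\<close>)
    then have "((\<Sum>i\<in>J. f i) / N) powr q \<le> (\<Sum>i\<in>J. f i powr q) / N"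
      by (simp add: sum_divide_distrib)
    then have "(\<Sum>i\<in>J. f i) powr q / N powr q \<le> (\<Sum>i\<in>J. f i powr q) / N"
      using N pos by (simp add: powr_divide)
    then have "(\<Sum>i\<in>J. f i) powr q \<le> (N powr q / N) * (\<Sum>i\<in>J. f i powr q)"
      using N by (simp add: field_simps)
    also have "N powr q / N = N powr (q - 1)"
      using N by (simp add: powr_diff)
    also have "\<dots> * (\<Sum>i\<in>J. f i powr q) \<le> real (card I) powr (q - 1) * (\<Sum>i\<in>J. f i powr q)"
      using N cardJ assms(3) unfolding N_def
      by (intro mult_right_mono powr_mono2 sum_nonneg) auto
    finally show ?thesis unfolding eq .
  qed
qed

lemma powr_add_le_convex:
  fixes x y :: real
  assumes "0 \<le> x" "0 \<le> y" "1 \<le> q"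
  shows "(x + y) powr q \<le> 2 powr (q - 1) * (x powr q + y powr q)"
  using powr_sum_le_card_powr[of "UNIV :: bool set" "\<lambda>c. if c then y else x" q] assms
  by (simp add: UNIV_bool)

lemma powr_add_le_concave:
  fixes x y :: real
  assumes "0 \<le> x" "0 \<le> y" "0 < q" "q \<le> 1"
  shows "(x + y) powr q \<le> x powr q + y powr q"
  using powr_sum_le_sum_powr[of "UNIV :: bool set" "\<lambda>c. if c then y else x" q] assms
  by (simp add: UNIV_bool)

section \<open>Increments on a square grid\<close>

lemma bool_chain_change:
  fixes f :: "nat \<Rightarrow> bool"
  assumes "f 0 \<noteq> f n"
  shows "\<exists>i<n. f i \<noteq> f (Suc i)"
  using assms by (induction n) (auto simp: less_Suc_eq)

text \<open>
  Two adjacent rows of a grid carry values \<open>v i\<close> and \<open>w i\<close> for \<open>i \<le> m\<close>. A level belongs to the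
  following set if it separates \<open>v 0\<close> from \<open>w 0\<close>, but this separation does not persist unchanged
  all along the strip between the rows.
\<close>

definition strip_levels :: "nat \<Rightarrow> (nat \<Rightarrow> real) \<Rightarrow> (nat \<Rightarrow> real) \<Rightarrow> real set" where
  "strip_levels m v w = {t. (v 0 > t) \<noteq> (w 0 > t) \<and>
     (\<exists>i\<le>m. (v i > t) \<noteq> (v 0 > t) \<or> (w i > t) \<noteq> (w 0 > t))}"

lemma strip_levels_measurable [measurable]: "strip_levels m v w \<in> sets borel"
proof -
  have *: "Measurable.pred borel (\<lambda>t::real. (v 0 > t) \<noteq> (w 0 > t) \<and>
     (\<exists>i\<in>{..m}. (v i > t) \<noteq> (v 0 > t) \<or> (w i > t) \<noteq> (w 0 > t)))"
    by measurable
  then show ?thesis unfolding strip_levels_def by (simp add: pred_def Bex_def)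
qed

lemma dist_le_sum_increments:
  fixes v :: "nat \<Rightarrow> real"
  assumes "i \<le> q"
  shows "\<bar>v i - v 0\<bar> \<le> (\<Sum>k<q. \<bar>v (Suc k) - v k\<bar>)"
proof -
  have "\<bar>v i - v 0\<bar> \<le> (\<Sum>k<i. \<bar>v (Suc k) - v k\<bar>)"
    by (induction i) auto
  also have "\<dots> \<le> (\<Sum>k<q. \<bar>v (Suc k) - v k\<bar>)"
    using assms by (intro sum_mono2) auto
  finally show ?thesis .
qed

text \<open>
  The energy of a strip: over its cells, the sum of the products of a horizontal increment (power
  \<open>\<alpha>\<close>) and a vertical increment (power \<open>\<beta>\<close>), taken over the four corners of the cell.
\<close>

definition strip_energy :: "real \<Rightarrow> real \<Rightarrow> nat \<Rightarrow> (nat \<Rightarrow> real) \<Rightarrow> (nat \<Rightarrow> real) \<Rightarrow> real" where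
  "strip_energy \<alpha> \<beta> m v w =
     (\<Sum>i<m. (\<bar>v (Suc i) - v i\<bar> powr \<alpha> + \<bar>w (Suc i) - w i\<bar> powr \<alpha>) *
             (\<bar>w i - v i\<bar> powr \<beta> + \<bar>w (Suc i) - v (Suc i)\<bar> powr \<beta>))"

lemma strip_energy_nonneg: "0 \<le> strip_energy \<alpha> \<beta> m v w"
  unfolding strip_energy_def by (intro sum_nonneg mult_nonneg_nonneg add_nonneg_nonneg) auto

text \<open>
  Follow the strip only as long as the vertical increment stays at least half of its initial value
  \<open>b\<close>. Up to that point the energy is at least \<open>(b / 2) powr \<beta>\<close> times a sum of \<open>\<alpha>\<close>-th powers of
  horizontal increments, hence (as \<open>\<alpha> \<le> 1\<close>) at least \<open>(b / 2) powr \<beta>\<close> times the \<open>\<alpha>\<close>-th power of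
  the total horizontal variation \<open>Sv + Sw\<close>. If the whole strip is followed, then only levels that
  are within the variation of \<open>v 0\<close> or \<open>w 0\<close> can cease to separate. Otherwise the variation is at
  least \<open>b / 2\<close>.
\<close>

lemma emeasure_strip_levels_le:
  assumes "0 < \<alpha>" "\<alpha> \<le> 1" "0 < \<beta>"
  shows "emeasure lborel (strip_levels m v w)
           \<le> ennreal (2 * strip_energy \<alpha> \<beta> m v w powr (1 / (\<alpha> + \<beta>)))"
proof -
  define b where "b = \<bar>w 0 - v 0\<bar>"
  \<comment> \<open>the first index at which the vertical increment has dropped below half of its initial value, or \<open>m\<close> if there is none\<close>
  define q where "q = (if \<exists>i<m. \<bar>w i - v i\<bar> < b / 2 then LEAST i. i < m \<and> \<bar>w i - v i\<bar> < b / 2 else m)"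
  have qm: "q \<le> m" and qlt: "q < m \<Longrightarrow> \<bar>w q - v q\<bar> < b / 2"
    and qge: "\<And>i. i < q \<Longrightarrow> \<bar>w i - v i\<bar> \<ge> b / 2"
  proof -
    show "q \<le> m" unfolding q_def
      by (auto intro: order.trans[OF less_imp_le] dest: LeastI)
         (smt (verit, del_insts) LeastI_ex less_imp_le)
    show "\<bar>w q - v q\<bar> < b / 2" if "q < m"
      using that LeastI_ex[of "\<lambda>i. i < m \<and> \<bar>w i - v i\<bar> < b / 2"] unfolding q_def
      by (auto split: if_splits)
    show "\<bar>w i - v i\<bar> \<ge> b / 2" if "i < q" for i
    proof (cases "\<exists>i<m. \<bar>w i - v i\<bar> < b / 2")
      case True
      then have "i < (LEAST i. i < m \<and> \<bar>w i - v i\<bar> < b / 2)" using that by (simp add: q_def)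
      from not_less_Least[OF this] \<open>i < q\<close> \<open>q \<le> m\<close> show ?thesis by auto
    next
      case False
      then have "q = m" unfolding q_def by (simp only: if_False)
      with False that show ?thesis by auto
    qed
  qed
  define Sv where "Sv = (\<Sum>k<q. \<bar>v (Suc k) - v k\<bar>)"
  define Sw where "Sw = (\<Sum>k<q. \<bar>w (Suc k) - w k\<bar>)"
  have S0: "0 \<le> Sv" "0 \<le> Sw" unfolding Sv_def Sw_def by (auto intro: sum_nonneg)
  have b0: "0 \<le> b" by (simp add: b_def)
  define \<mu> where "\<mu> = min (b / 2) (Sv + Sw)"
  have \<mu>0: "0 \<le> \<mu>" using S0 b0 by (simp add: \<mu>_def)
  have \<mu>_le: "\<mu> \<le> b / 2" "\<mu> \<le> Sv + Sw" unfolding \<mu>_def by (rule min.cobounded1, rule min.cobounded2)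
  have sub_b: "strip_levels m v w \<subseteq> {min (v 0) (w 0)..max (v 0) (w 0)}"
    unfolding strip_levels_def by auto
  have le_b: "emeasure lborel (strip_levels m v w) \<le> ennreal b"
    using emeasure_mono[OF sub_b, of lborel] by (auto simp: b_def max_def min_def abs_if split: if_splits)
  have upper: "emeasure lborel (strip_levels m v w) \<le> ennreal (2 * \<mu>)"
  proof (cases "b / 2 \<le> Sv + Sw")
    case True
    then show ?thesis using le_b by (simp add: \<mu>_def min_absorb1)
  next
    case False
    have "q = m"
    proof (rule ccontr)
      assume "q \<noteq> m"
      then have "\<bar>w q - v q\<bar> < b / 2" using qm qlt by simp
      moreover have "\<bar>v q - v 0\<bar> \<le> Sv" "\<bar>w q - w 0\<bar> \<le> Sw"
        unfolding Sv_def Sw_def by (auto intro: dist_le_sum_increments)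
      moreover have "\<bar>w 0 - v 0\<bar> \<le> \<bar>w q - v q\<bar> + \<bar>v q - v 0\<bar> + \<bar>w q - w 0\<bar>" by arith
      ultimately show False using False unfolding b_def by argo
    qed
    have "strip_levels m v w \<subseteq> {v 0 - Sv..v 0 + Sv} \<union> {w 0 - Sw..w 0 + Sw}"
    proof
      fix t assume "t \<in> strip_levels m v w"
      then obtain i where "i \<le> m" and d: "(v i > t) \<noteq> (v 0 > t) \<or> (w i > t) \<noteq> (w 0 > t)"
        unfolding strip_levels_def by auto
      then have "\<bar>v i - v 0\<bar> \<le> Sv" "\<bar>w i - w 0\<bar> \<le> Sw"
        unfolding Sv_def Sw_def \<open>q = m\<close> by (auto intro: dist_le_sum_increments)
      with d show "t \<in> {v 0 - Sv..v 0 + Sv} \<union> {w 0 - Sw..w 0 + Sw}" by auto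
    qed
    then have "emeasure lborel (strip_levels m v w)
        \<le> emeasure lborel ({v 0 - Sv..v 0 + Sv} \<union> {w 0 - Sw..w 0 + Sw})"
      by (rule emeasure_mono) auto
    also have "\<dots> \<le> emeasure lborel {v 0 - Sv..v 0 + Sv} + emeasure lborel {w 0 - Sw..w 0 + Sw}"
      by (rule emeasure_subadditive) auto
    also have "\<dots> = ennreal (2 * (Sv + Sw))"
      using S0 by (simp add: ennreal_plus[symmetric] del: ennreal_plus)
    finally show ?thesis using False by (simp add: \<mu>_def min_absorb2)
  qed
  define R where "R = strip_energy \<alpha> \<beta> m v w"
  have "\<mu> powr (\<alpha> + \<beta>) \<le> R"
  proof -
    have "\<mu> powr (\<alpha> + \<beta>) = \<mu> powr \<alpha> * \<mu> powr \<beta>" by (simp add: powr_add)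
    also have "\<dots> \<le> (Sv + Sw) powr \<alpha> * (b / 2) powr \<beta>"
      using \<mu>0 \<mu>_le assms by (intro mult_mono powr_mono2) auto
    also have "(Sv + Sw) powr \<alpha> \<le> (\<Sum>k<q. \<bar>v (Suc k) - v k\<bar> powr \<alpha> + \<bar>w (Suc k) - w k\<bar> powr \<alpha>)"
    proof -
      have "Sv + Sw = (\<Sum>k<q. \<bar>v (Suc k) - v k\<bar> + \<bar>w (Suc k) - w k\<bar>)"
        by (simp add: Sv_def Sw_def sum.distrib)
      also have "\<dots> powr \<alpha> \<le> (\<Sum>k<q. (\<bar>v (Suc k) - v k\<bar> + \<bar>w (Suc k) - w k\<bar>) powr \<alpha>)"
        using assms by (intro powr_sum_le_sum_powr) auto
      also have "\<dots> \<le> (\<Sum>k<q. \<bar>v (Suc k) - v k\<bar> powr \<alpha> + \<bar>w (Suc k) - w k\<bar> powr \<alpha>)"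
      proof (rule sum_mono)
        fix k
        show "(\<bar>v (Suc k) - v k\<bar> + \<bar>w (Suc k) - w k\<bar>) powr \<alpha>
            \<le> \<bar>v (Suc k) - v k\<bar> powr \<alpha> + \<bar>w (Suc k) - w k\<bar> powr \<alpha>"
          using assms by (intro powr_add_le_concave) auto
      qed
      finally show ?thesis .
    qed
    also have "(\<Sum>k<q. \<bar>v (Suc k) - v k\<bar> powr \<alpha> + \<bar>w (Suc k) - w k\<bar> powr \<alpha>) * (b / 2) powr \<beta>
        = (\<Sum>k<q. (\<bar>v (Suc k) - v k\<bar> powr \<alpha> + \<bar>w (Suc k) - w k\<bar> powr \<alpha>) * (b / 2) powr \<beta>)"
      by (rule sum_distrib_right)
    also have "\<dots> \<le> (\<Sum>k<q. (\<bar>v (Suc k) - v k\<bar> powr \<alpha> + \<bar>w (Suc k) - w k\<bar> powr \<alpha>) *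
       (\<bar>w k - v k\<bar> powr \<beta> + \<bar>w (Suc k) - v (Suc k)\<bar> powr \<beta>))"
    proof (intro sum_mono mult_left_mono)
      fix k assume "k \<in> {..<q}"
      then have "(b / 2) powr \<beta> \<le> \<bar>w k - v k\<bar> powr \<beta>"
        using qge[of k] b0 assms by (intro powr_mono2) auto
      then show "(b / 2) powr \<beta> \<le> \<bar>w k - v k\<bar> powr \<beta> + \<bar>w (Suc k) - v (Suc k)\<bar> powr \<beta>"
        by (smt (verit) powr_ge_zero)
    qed simp
    also have "\<dots> \<le> R"
      unfolding R_def strip_energy_def using qm by (intro sum_mono2) auto
    finally show ?thesis by (simp add: mult_right_mono)
  qed
  then have "(\<mu> powr (\<alpha> + \<beta>)) powr (1 / (\<alpha> + \<beta>)) \<le> R powr (1 / (\<alpha> + \<beta>))"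
    using assms by (intro powr_mono2) auto
  then have "\<mu> \<le> R powr (1 / (\<alpha> + \<beta>))"
    using assms \<mu>0 by (simp add: powr_powr)
  then have "ennreal (2 * \<mu>) \<le> ennreal (2 * R powr (1 / (\<alpha> + \<beta>)))"
    by (intro ennreal_leI) simp
  with upper show ?thesis unfolding R_def by (rule order.trans)
qed

text \<open>
  A grid function \<open>U\<close> is read as \<open>U i j\<close> with horizontal index \<open>i\<close> and vertical index \<open>j\<close>;
  the strip with number \<open>j\<close> lies between the rows \<open>j\<close> and \<open>j + 1\<close>.
\<close>

definition row_energy :: "real \<Rightarrow> real \<Rightarrow> nat \<Rightarrow> (nat \<Rightarrow> nat \<Rightarrow> real) \<Rightarrow> nat \<Rightarrow> real" where
  "row_energy \<alpha> \<beta> m U j = strip_energy \<alpha> \<beta> m (\<lambda>i. U i j) (\<lambda>i. U i (Suc j))"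

lemma strip_energy_rev:
  "strip_energy \<alpha> \<beta> m (\<lambda>i. v (m - i)) (\<lambda>i. w (m - i)) = strip_energy \<alpha> \<beta> m v w"
  unfolding strip_energy_def
proof (rule sum.reindex_bij_witness[where i = "\<lambda>i. m - Suc i" and j = "\<lambda>i. m - Suc i"], goal_cases)
  case (5 a)
  then have "m - a = Suc (m - Suc a)" by auto
  then show ?case by (simp add: abs_minus_commute add.commute)
qed auto

lemma row_energy_nonneg: "0 \<le> row_energy \<alpha> \<beta> m U j"
  by (simp add: row_energy_def strip_energy_nonneg)

lemma row_energy_rev_left: "row_energy \<alpha> \<beta> m (\<lambda>i. U (m - i)) j = row_energy \<alpha> \<beta> m U j"
  unfolding row_energy_def
  using strip_energy_rev[of \<alpha> \<beta> m "\<lambda>i. U i j" "\<lambda>i. U i (Suc j)"] by simp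

lemma strip_energy_swap: "strip_energy \<alpha> \<beta> m v w = strip_energy \<alpha> \<beta> m w v"
  unfolding strip_energy_def by (intro sum.cong) (auto simp: abs_minus_commute add.commute)

lemma sum_row_energy_rev_right:
  "(\<Sum>j<m. row_energy \<alpha> \<beta> m (\<lambda>i j. U i (m - j)) j powr q) = (\<Sum>j<m. row_energy \<alpha> \<beta> m U j powr q)"
proof (rule sum.reindex_bij_witness[where i = "\<lambda>i. m - Suc i" and j = "\<lambda>i. m - Suc i"], goal_cases)
  case (5 a)
  then have "m - a = Suc (m - Suc a)" by auto
  then show ?case unfolding row_energy_def by (simp add: strip_energy_swap)
qed auto

text \<open>
  A level that separates \<open>U 0 0\<close> from both \<open>U m 0\<close> and \<open>U 0 m\<close> fails to propagate along some
  strip, from left to right or from right to left. Indeed, if it propagated along all strips, then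
  the first vertical jump in column 0 would reach column \<open>m\<close>; as the level separates \<open>U 0 0\<close> from
  \<open>U m 0\<close>, column \<open>m\<close> then has a jump below it, which propagates back to an earlier jump in
  column 0.
\<close>

lemma corner_level_in_strip:
  assumes "(U 0 0 > t) \<noteq> (U m 0 > t)" "(U 0 0 > t) \<noteq> (U 0 m > t)"
  shows "\<exists>j<m. t \<in> strip_levels m (\<lambda>i. U i j) (\<lambda>i. U i (Suc j))
             \<union> strip_levels m (\<lambda>i. U (m - i) j) (\<lambda>i. U (m - i) (Suc j))"
proof (rule ccontr)
  assume neg: "\<not> ?thesis"
  define V where "V i j \<longleftrightarrow> U i j > t" for i j
  have pos: "V i j = V 0 j \<and> V i (Suc j) = V 0 (Suc j)"
    if "j < m" "V 0 j \<noteq> V 0 (Suc j)" "i \<le> m" for i j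
    using neg that unfolding strip_levels_def V_def by blast
  have rev: "V 0 j = V m j \<and> V 0 (Suc j) = V m (Suc j)"
    if "j < m" "V m j \<noteq> V m (Suc j)" for j
  proof -
    have "t \<notin> strip_levels m (\<lambda>i. U (m - i) j) (\<lambda>i. U (m - i) (Suc j))"
      using neg that by blast
    then show ?thesis using that(2) unfolding strip_levels_def V_def
      by (auto dest!: spec[of _ m])
  qed
  have ex: "\<exists>j. V 0 j \<noteq> V 0 0" and le: "(LEAST j. V 0 j \<noteq> V 0 0) \<le> m"
    using assms(2) by (auto simp: V_def intro!: exI[of _ m] Least_le)
  define J where "J = (LEAST j. V 0 j \<noteq> V 0 0)"
  have J: "V 0 J \<noteq> V 0 0" and Jmin: "\<And>j. j < J \<Longrightarrow> V 0 j = V 0 0"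
    unfolding J_def using LeastI_ex[OF ex] by (auto dest: not_less_Least)
  obtain K where K: "J = Suc K" using J by (cases J) auto
  have "K < m" using le K by (simp add: J_def)
  have "V m K = V 0 K" using pos[of K m] J K Jmin[of K] \<open>K < m\<close> by auto
  then have "V m 0 \<noteq> V m K" using Jmin[of K] K assms(1) by (auto simp: V_def)
  then obtain l where l: "l < K" "V m l \<noteq> V m (Suc l)" using bool_chain_change[of "V m" K] by auto
  with rev[of l] \<open>K < m\<close> have "V 0 l \<noteq> V 0 (Suc l)" by auto
  with Jmin[of l] Jmin[of "Suc l"] l K show False by auto
qed

text \<open>
  If the two increments have the same sign, the levels that separate \<open>U 0 0\<close> from both other
  values form an interval whose length is the smaller increment.
\<close>

lemma min_increment_le_same_sign:
  assumes "0 < \<alpha>" "\<alpha> \<le> 1" "0 < \<beta>" and sgn: "(U m 0 - U 0 0) * (U 0 m - U 0 0) > 0"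
  shows "min \<bar>U m 0 - U 0 0\<bar> \<bar>U 0 m - U 0 0\<bar>
           \<le> 4 * (\<Sum>j<m. row_energy \<alpha> \<beta> m U j powr (1 / (\<alpha> + \<beta>)))"
proof -
  define E where "E j = row_energy \<alpha> \<beta> m U j powr (1 / (\<alpha> + \<beta>))" for j
  define T where "T j = strip_levels m (\<lambda>i. U i j) (\<lambda>i. U i (Suc j))
             \<union> strip_levels m (\<lambda>i. U (m - i) j) (\<lambda>i. U (m - i) (Suc j))" for j
  define \<mu> where "\<mu> = min \<bar>U m 0 - U 0 0\<bar> \<bar>U 0 m - U 0 0\<bar>"
  have Tm: "T j \<in> sets lborel" for j unfolding T_def by simp
  have TE: "emeasure lborel (T j) \<le> ennreal (4 * E j)" for j
  proof -
    have "emeasure lborel (T j) \<le> emeasure lborel (strip_levels m (\<lambda>i. U i j) (\<lambda>i. U i (Suc j)))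
       + emeasure lborel (strip_levels m (\<lambda>i. U (m - i) j) (\<lambda>i. U (m - i) (Suc j)))"
      unfolding T_def by (rule emeasure_subadditive) auto
    also have "\<dots> \<le> ennreal (2 * E j) + ennreal (2 * E j)"
    proof (rule add_mono)
      show "emeasure lborel (strip_levels m (\<lambda>i. U i j) (\<lambda>i. U i (Suc j))) \<le> ennreal (2 * E j)"
        unfolding E_def row_energy_def by (rule emeasure_strip_levels_le[OF assms(1-3)])
      show "emeasure lborel (strip_levels m (\<lambda>i. U (m - i) j) (\<lambda>i. U (m - i) (Suc j))) \<le> ennreal (2 * E j)"
        unfolding E_def row_energy_def
        using emeasure_strip_levels_le[OF assms(1-3), of m "\<lambda>i. U (m - i) j" "\<lambda>i. U (m - i) (Suc j)"]
        by (simp add: strip_energy_rev[of \<alpha> \<beta> m "\<lambda>i. U i j" "\<lambda>i. U i (Suc j)"])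
    qed
    also have "\<dots> = ennreal (4 * E j)"
      by (subst ennreal_plus[symmetric]) (auto simp: E_def)
    finally show ?thesis .
  qed
  \<comment> \<open>the levels that separate \<open>U 0 0\<close> from both other corner values\<close>
  define I where "I = (if U m 0 > U 0 0 then {U 0 0..<U 0 0 + \<mu>} else {U 0 0 - \<mu>..<U 0 0})"
  have "I \<subseteq> (\<Union>j\<in>{..<m}. T j)"
  proof
    fix t assume "t \<in> I"
    then have "(U 0 0 > t) \<noteq> (U m 0 > t)" "(U 0 0 > t) \<noteq> (U 0 m > t)"
      using sgn unfolding I_def \<mu>_def by (auto simp: zero_less_mult_iff split: if_splits)
    from corner_level_in_strip[OF this] show "t \<in> (\<Union>j\<in>{..<m}. T j)"
      unfolding T_def by blast
  qed
  then have "emeasure lborel I \<le> emeasure lborel (\<Union>j\<in>{..<m}. T j)"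
    using Tm by (intro emeasure_mono) auto
  also have "\<dots> \<le> (\<Sum>j<m. emeasure lborel (T j))"
    using Tm by (intro emeasure_subadditive_finite) auto
  also have "\<dots> \<le> (\<Sum>j<m. ennreal (4 * E j))"
    by (intro sum_mono TE)
  also have "\<dots> = ennreal (4 * (\<Sum>j<m. E j))"
    by (subst sum_ennreal) (auto simp: E_def sum_distrib_left)
  finally have "ennreal \<mu> \<le> ennreal (4 * (\<Sum>j<m. E j))"
    by (simp add: I_def \<mu>_def split: if_splits)
  then show ?thesis
    unfolding \<mu>_def[symmetric] E_def[symmetric]
    by (subst (asm) ennreal_le_iff) (auto intro!: sum_nonneg simp: E_def)
qed

text \<open>
  For increments of opposite signs, one of the neighbouring corners of the square has increments
  of the same sign and of comparable size, and the estimate is applied to the grid seen from there.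
\<close>

lemma min_increment_le:
  assumes "0 < \<alpha>" "\<alpha> \<le> 1" "0 < \<beta>"
  shows "min \<bar>U m 0 - U 0 0\<bar> \<bar>U 0 m - U 0 0\<bar>
           \<le> 8 * (\<Sum>j<m. row_energy \<alpha> \<beta> m U j powr (1 / (\<alpha> + \<beta>)))"
proof -
  define s where "s = 4 * (\<Sum>j<m. row_energy \<alpha> \<beta> m U j powr (1 / (\<alpha> + \<beta>)))"
  have s0: "0 \<le> s" unfolding s_def by (auto intro!: sum_nonneg)
  have 00: "(U m 0 - U 0 0) * (U 0 m - U 0 0) > 0 \<Longrightarrow> min \<bar>U m 0 - U 0 0\<bar> \<bar>U 0 m - U 0 0\<bar> \<le> s"
    unfolding s_def by (rule min_increment_le_same_sign[OF assms])
  have 10: "(U 0 0 - U m 0) * (U m m - U m 0) > 0 \<Longrightarrow> min \<bar>U 0 0 - U m 0\<bar> \<bar>U m m - U m 0\<bar> \<le> s"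
    using min_increment_le_same_sign[OF assms, of "\<lambda>i. U (m - i)" m]
    by (simp add: s_def row_energy_rev_left)
  have 01: "(U m m - U 0 m) * (U 0 0 - U 0 m) > 0 \<Longrightarrow> min \<bar>U m m - U 0 m\<bar> \<bar>U 0 0 - U 0 m\<bar> \<le> s"
    using min_increment_le_same_sign[OF assms, of "\<lambda>i j. U i (m - j)" m]
    by (simp add: s_def sum_row_energy_rev_right)
  show ?thesis
  proof -
    define a b a' b' where "a = U m 0 - U 0 0" and "b = U 0 m - U 0 0"
      and "a' = U m m - U 0 m" and "b' = U m m - U m 0"
    have c: "a' - a = b' - b" by (simp add: a_def b_def a'_def b'_def)
    have h1: "a * b > 0 \<Longrightarrow> min \<bar>a\<bar> \<bar>b\<bar> \<le> s"
      using 00 by (simp add: a_def b_def)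
    have h2: "(-a) * b' > 0 \<Longrightarrow> min \<bar>a\<bar> \<bar>b'\<bar> \<le> s"
      using 10 by (simp add: a_def b'_def abs_minus_commute)
    have h3: "a' * (-b) > 0 \<Longrightarrow> min \<bar>a'\<bar> \<bar>b\<bar> \<le> s"
      using 01 by (simp add: a'_def b_def abs_minus_commute)
    have "min \<bar>a\<bar> \<bar>b\<bar> \<le> 2 * s"
    proof -
      consider "a * b > 0" | "a = 0 \<or> b = 0" | "a < 0" "b > 0" | "a > 0" "b < 0"
        by (smt (verit) zero_less_mult_iff)
      then show ?thesis
      proof cases
        case 1 then show ?thesis using h1 s0 by simp
      next
        case 2 then show ?thesis using s0 by auto
      next
        case 3
        show ?thesis
        proof (cases "a' \<le> a / 2")
          case True
          with 3 have "a' * (-b) > 0" by (auto simp: mult_less_0_iff)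
          from h3[OF this] True 3 show ?thesis by (simp add: min_def split: if_splits)
        next
          case False
          with c 3 have "b' > b" by linarith
          with 3 have "(-a) * b' > 0" by (auto simp: mult_less_0_iff)
          from h2[OF this] \<open>b' > b\<close> 3 s0 show ?thesis by (simp add: min_def split: if_splits)
        qed
      next
        case 4
        show ?thesis
        proof (cases "a' \<ge> a / 2")
          case True
          with 4 have "a' * (-b) > 0" by (auto simp: mult_less_0_iff)
          from h3[OF this] True 4 show ?thesis by (simp add: min_def split: if_splits)
        next
          case False
          with c 4 have "b' < b" by linarith
          with 4 have "(-a) * b' > 0" by (auto simp: mult_less_0_iff)
          from h2[OF this] \<open>b' < b\<close> 4 s0 show ?thesis by (simp add: min_def split: if_splits)
        qed
      qed
    qed
    then show ?thesis by (simp add: a_def b_def s_def)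
  qed
qed

text \<open>
  The sum of the energies of the \<open>m\<close> strips of the grid, written out as a sum over its cells.
\<close>

definition grid_energy :: "real \<Rightarrow> real \<Rightarrow> nat \<Rightarrow> (nat \<Rightarrow> nat \<Rightarrow> real) \<Rightarrow> real" where
  "grid_energy \<alpha> \<beta> m U =
     (\<Sum>j<m. \<Sum>i<m.
        (\<bar>U (Suc i) j - U i j\<bar> powr \<alpha> + \<bar>U (Suc i) (Suc j) - U i (Suc j)\<bar> powr \<alpha>) *
        (\<bar>U i (Suc j) - U i j\<bar> powr \<beta> + \<bar>U (Suc i) (Suc j) - U (Suc i) j\<bar> powr \<beta>))"

lemma grid_energy_rows: "grid_energy \<alpha> \<beta> m U = (\<Sum>j<m. row_energy \<alpha> \<beta> m U j)"
  by (simp add: grid_energy_def row_energy_def strip_energy_def)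

lemma grid_energy_transpose: "grid_energy \<alpha> \<beta> m (\<lambda>i j. U j i) = grid_energy \<beta> \<alpha> m U"
  unfolding grid_energy_def by (subst sum.swap) (simp only: mult.commute)

lemma min_increment_powr_le_small_exponent:
  assumes "0 < \<alpha>" "\<alpha> \<le> 1" "0 < \<beta>"
  shows "min \<bar>U m 0 - U 0 0\<bar> \<bar>U 0 m - U 0 0\<bar> powr (\<alpha> + \<beta>)
     \<le> 8 powr (\<alpha> + \<beta>) * (real m powr max (\<alpha> + \<beta> - 1) 0 * grid_energy \<alpha> \<beta> m U)"
proof (cases "m = 0")
  case True
  then show ?thesis by (simp add: grid_energy_def)
next
  case False
  define \<theta> where "\<theta> = \<alpha> + \<beta>"
  have \<theta>: "0 < \<theta>" using assms by (simp add: \<theta>_def)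
  define E where "E j = row_energy \<alpha> \<beta> m U j" for j
  have E0: "0 \<le> E j" for j by (simp add: E_def row_energy_nonneg)
  have "min \<bar>U m 0 - U 0 0\<bar> \<bar>U 0 m - U 0 0\<bar> powr \<theta> \<le> (8 * (\<Sum>j<m. E j powr (1 / \<theta>))) powr \<theta>"
    unfolding E_def \<theta>_def using \<theta>
    by (intro powr_mono2 min_increment_le assms) (auto simp: \<theta>_def)
  also have "\<dots> = 8 powr \<theta> * (\<Sum>j<m. E j powr (1 / \<theta>)) powr \<theta>"
    by (rule powr_mult)
  also have "(\<Sum>j<m. E j powr (1 / \<theta>)) powr \<theta>
      \<le> real m powr max (\<theta> - 1) 0 * (\<Sum>j<m. (E j powr (1 / \<theta>)) powr \<theta>)"
  proof (cases "\<theta> \<le> 1")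
    case True
    then show ?thesis
      using powr_sum_le_sum_powr[of "{..<m}" "\<lambda>j. E j powr (1 / \<theta>)" \<theta>] \<theta> \<open>m \<noteq> 0\<close> by (simp add: max_def)
  next
    case False
    then show ?thesis
      using powr_sum_le_card_powr[of "{..<m}" "\<lambda>j. E j powr (1 / \<theta>)" \<theta>] by simp
  qed
  also have "(\<Sum>j<m. (E j powr (1 / \<theta>)) powr \<theta>) = grid_energy \<alpha> \<beta> m U"
    using \<theta> E0 by (simp add: powr_powr grid_energy_rows E_def)
  finally show ?thesis by (simp add: \<theta>_def mult_left_mono)
qed

text \<open>
  If \<open>\<alpha> > 1\<close>, the Hoelder inequality reduces the exponents \<open>(\<alpha>, \<beta>)\<close> to \<open>(1, \<beta> / \<alpha>)\<close>. Its cost,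
  the factor \<open>(m * m) powr (\<alpha> - 1)\<close> for the number of cells, accounts for the third case in the
  definition of the critical exponent.
\<close>

lemma min_increment_powr_le_ordered:
  assumes "0 < \<alpha>" "\<alpha> \<le> \<beta>"
  shows "\<exists>C\<ge>0. \<forall>m U. min \<bar>U m 0 - U 0 0\<bar> \<bar>U 0 m - U 0 0\<bar> powr (\<alpha> + \<beta>)
     \<le> C * (real m powr (critical_exponent \<alpha> \<beta> - 2) * grid_energy \<alpha> \<beta> m U)"
proof (cases "\<alpha> \<le> 1")
  case True
  then have "critical_exponent \<alpha> \<beta> - 2 = max (\<alpha> + \<beta> - 1) 0"
    using assms by (auto simp: critical_exponent_def)
  then have "min \<bar>U m 0 - U 0 0\<bar> \<bar>U 0 m - U 0 0\<bar> powr (\<alpha> + \<beta>) \<le> 8 powr (\<alpha> + \<beta>) *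
      (real m powr (critical_exponent \<alpha> \<beta> - 2) * grid_energy \<alpha> \<beta> m U)" for m U
    using min_increment_powr_le_small_exponent[OF assms(1) True, of \<beta> U m] assms by simp
  then show ?thesis by (intro exI[of _ "8 powr (\<alpha> + \<beta>)"] conjI allI) auto
next
  case False
  define \<gamma> where "\<gamma> = \<beta> / \<alpha>"
  have \<gamma>: "0 < \<gamma>" "\<gamma> * \<alpha> = \<beta>" "1 + \<gamma> - 1 = \<gamma>" "max \<gamma> 0 = \<gamma>" "(1 + \<gamma>) * \<alpha> = \<alpha> + \<beta>"
    using assms False by (auto simp: \<gamma>_def field_simps)
  have crit: "critical_exponent \<alpha> \<beta> - 2 = \<beta> + 2 * (\<alpha> - 1)"
    using False assms by (simp add: critical_exponent_def)
  define C where "C = 8 powr (\<alpha> + \<beta>) * (2 powr (\<alpha> - 1) * 2 powr (\<alpha> - 1))"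
  have main: "min \<bar>U m 0 - U 0 0\<bar> \<bar>U 0 m - U 0 0\<bar> powr (\<alpha> + \<beta>)
     \<le> C * (real m powr (critical_exponent \<alpha> \<beta> - 2) * grid_energy \<alpha> \<beta> m U)" for m U
  proof (cases "m = 0")
    case True
    then show ?thesis by (simp add: grid_energy_def)
  next
    case m: False
    define e where "e c = (\<lambda>(j, i).
        (\<bar>U (Suc i) j - U i j\<bar> powr fst c + \<bar>U (Suc i) (Suc j) - U i (Suc j)\<bar> powr fst c) *
        (\<bar>U i (Suc j) - U i j\<bar> powr snd c + \<bar>U (Suc i) (Suc j) - U (Suc i) j\<bar> powr snd c))" for c
    have ge: "grid_energy a b m U = sum (e (a, b)) ({..<m} \<times> {..<m})" for a b
      by (simp add: grid_energy_def e_def sum.cartesian_product)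
    have e0: "0 \<le> e c x" for c x by (auto simp: e_def split: prod.split)
    have eH: "e (1, \<gamma>) x powr \<alpha> \<le> 2 powr (\<alpha> - 1) * 2 powr (\<alpha> - 1) * e (\<alpha>, \<beta>) x" for x
    proof -
      obtain j i where x: "x = (j, i)" by (cases x)
      define a a' b b' where "a = \<bar>U (Suc i) j - U i j\<bar>" "a' = \<bar>U (Suc i) (Suc j) - U i (Suc j)\<bar>"
        "b = \<bar>U i (Suc j) - U i j\<bar>" "b' = \<bar>U (Suc i) (Suc j) - U (Suc i) j\<bar>"
      note d = this
      have 0: "0 \<le> a" "0 \<le> a'" "0 \<le> b" "0 \<le> b'" by (auto simp: d)
      have "e (1, \<gamma>) x powr \<alpha> = (a + a') powr \<alpha> * (b powr \<gamma> + b' powr \<gamma>) powr \<alpha>"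
        by (simp add: e_def x d powr_mult)
      also have "\<dots> \<le> (2 powr (\<alpha> - 1) * (a powr \<alpha> + a' powr \<alpha>)) *
          (2 powr (\<alpha> - 1) * ((b powr \<gamma>) powr \<alpha> + (b' powr \<gamma>) powr \<alpha>))"
        using False 0 by (intro mult_mono powr_add_le_convex) auto
      also have "\<dots> = 2 powr (\<alpha> - 1) * 2 powr (\<alpha> - 1) * e (\<alpha>, \<beta>) x"
        by (simp add: e_def x d powr_powr \<gamma>)
      finally show ?thesis .
    qed
    define \<mu> where "\<mu> = min \<bar>U m 0 - U 0 0\<bar> \<bar>U 0 m - U 0 0\<bar>"
    have "\<mu> powr (1 + \<gamma>) \<le> 8 powr (1 + \<gamma>) * (real m powr \<gamma> * grid_energy 1 \<gamma> m U)"
      using min_increment_powr_le_small_exponent[of 1 \<gamma> U m] \<gamma> by (simp add: \<mu>_def)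
    then have "(\<mu> powr (1 + \<gamma>)) powr \<alpha> \<le> (8 powr (1 + \<gamma>) * (real m powr \<gamma> * grid_energy 1 \<gamma> m U)) powr \<alpha>"
      using assms by (intro powr_mono2) auto
    then have "\<mu> powr (\<alpha> + \<beta>) \<le> 8 powr (\<alpha> + \<beta>) * (real m powr \<beta> * grid_energy 1 \<gamma> m U powr \<alpha>)"
      by (simp add: powr_mult powr_powr \<gamma>)
    also have "grid_energy 1 \<gamma> m U powr \<alpha>
        \<le> real (card ({..<m} \<times> {..<m})) powr (\<alpha> - 1) * (\<Sum>x\<in>{..<m} \<times> {..<m}. e (1, \<gamma>) x powr \<alpha>)"
      unfolding ge using False e0 by (intro powr_sum_le_card_powr) auto
    also have "\<dots> \<le> real (card ({..<m} \<times> {..<m})) powr (\<alpha> - 1) *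
        (\<Sum>x\<in>{..<m} \<times> {..<m}. 2 powr (\<alpha> - 1) * 2 powr (\<alpha> - 1) * e (\<alpha>, \<beta>) x)"
      by (intro mult_left_mono sum_mono eH) auto
    also have "\<dots> = real m powr (2 * (\<alpha> - 1)) * (2 powr (\<alpha> - 1) * 2 powr (\<alpha> - 1) * grid_energy \<alpha> \<beta> m U)"
    proof -
      have "real (card ({..<m} \<times> {..<m})) = real m powr 2" using m by (simp add: power2_eq_square)
      then show ?thesis by (simp only: powr_powr ge sum_distrib_left)
    qed
    finally have "\<mu> powr (\<alpha> + \<beta>) \<le> 8 powr (\<alpha> + \<beta>) * (real m powr \<beta> *
       (real m powr (2 * (\<alpha> - 1)) * (2 powr (\<alpha> - 1) * 2 powr (\<alpha> - 1) * grid_energy \<alpha> \<beta> m U)))"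
      by (simp add: mult_left_mono)
    also have "\<dots> = C * (real m powr (critical_exponent \<alpha> \<beta> - 2) * grid_energy \<alpha> \<beta> m U)"
      by (simp only: C_def crit powr_add[of "real m" \<beta>] mult_ac)
    finally show ?thesis unfolding \<mu>_def .
  qed
  show ?thesis by (intro exI[of _ C] conjI allI main) (simp add: C_def)
qed

proposition min_increment_powr_le:
  assumes "0 < \<alpha>" "0 < \<beta>"
  shows "\<exists>C\<ge>0. \<forall>m U. min \<bar>U m 0 - U 0 0\<bar> \<bar>U 0 m - U 0 0\<bar> powr (\<alpha> + \<beta>)
     \<le> C * (real m powr (critical_exponent \<alpha> \<beta> - 2) * grid_energy \<alpha> \<beta> m U)"
proof (cases "\<alpha> \<le> \<beta>")
  case True
  then show ?thesis using min_increment_powr_le_ordered assms by blast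
next
  case False
  then obtain C where C: "C \<ge> 0" "\<And>m U. min \<bar>U m 0 - U 0 0\<bar> \<bar>U 0 m - U 0 0\<bar> powr (\<beta> + \<alpha>)
     \<le> C * (real m powr (critical_exponent \<beta> \<alpha> - 2) * grid_energy \<beta> \<alpha> m U)"
    using min_increment_powr_le_ordered[of \<beta> \<alpha>] assms by auto
  have "critical_exponent \<beta> \<alpha> = critical_exponent \<alpha> \<beta>"
    by (simp add: critical_exponent_def add.commute min.commute)
  then have "min \<bar>U m 0 - U 0 0\<bar> \<bar>U 0 m - U 0 0\<bar> powr (\<alpha> + \<beta>)
     \<le> C * (real m powr (critical_exponent \<alpha> \<beta> - 2) * grid_energy \<alpha> \<beta> m U)" for m U
    using C(2)[of "\<lambda>i j. U j i" m]
    by (simp only: grid_energy_transpose[of \<beta> \<alpha> m U] add.commute[of \<beta> \<alpha>] min.commute[of "\<bar>U 0 m - U 0 0\<bar>"])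
  with C(1) show ?thesis by blast
qed

section \<open>Symmetries and almost everywhere statements for Lebesgue measure\<close>

lemma nn_integral_lborel_translate:
  fixes a :: "'a::euclidean_space"
  assumes [measurable]: "f \<in> borel_measurable borel"
  shows "(\<integral>\<^sup>+x. f (a + x) \<partial>lborel) = (\<integral>\<^sup>+x. f x \<partial>lborel)"
  using nn_integral_distr[of "(+) a" lborel borel f] by (simp add: lborel_distr_plus)

lemma AE_lborel_translate:
  fixes a :: "'a::euclidean_space"
  assumes "AE x in lborel. Q x"
  shows "AE x in lborel. Q (a + x)"
proof -
  have "AE x in distr lborel borel ((+) a). Q x" using assms unfolding lborel_distr_plus .
  then show ?thesis by (rule AE_distrD[rotated]) simp
qed

lemma emeasure_lborel_translate:
  fixes a :: "'a::euclidean_space"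
  assumes "S \<in> sets borel"
  shows "emeasure lborel {x. a + x \<in> S} = emeasure lborel S"
  using emeasure_distr[of "(+) a" lborel borel S] assms
  by (simp add: lborel_distr_plus vimage_def)

lemma nn_integral_lborel_uminus:
  fixes f :: "'a::euclidean_space \<Rightarrow> ennreal"
  assumes [measurable]: "f \<in> borel_measurable borel"
  shows "(\<integral>\<^sup>+x. f (- x) \<partial>lborel) = (\<integral>\<^sup>+x. f x \<partial>lborel)"
proof -
  have "lborel = distr lborel borel (\<lambda>x::'a. - x)"
    using lborel_affine[of "-1" "0::'a"] by (simp add: density_1)
  then have "(\<integral>\<^sup>+x. f x \<partial>lborel) = (\<integral>\<^sup>+x. f x \<partial>distr lborel borel (\<lambda>x::'a. - x))"
    by simp
  also have "\<dots> = (\<integral>\<^sup>+x. f (- x) \<partial>lborel)"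
    by (rule nn_integral_distr) auto
  finally show ?thesis ..
qed

text \<open>
  Lebesgue measure is invariant under linear isometries. The image measure \<open>\<nu>\<close> is translation
  invariant, and computing \<open>\<integral>\<integral> g x * f (x + y)\<close> in both orders of integration shows that it is
  proportional to Lebesgue measure; the unit ball fixes the constant.
\<close>

lemma distr_lborel_orthogonal:
  fixes \<sigma> :: "'a::euclidean_space \<Rightarrow> 'a"
  assumes \<sigma>: "orthogonal_transformation \<sigma>"
  shows "distr lborel borel \<sigma> = lborel"
proof -
  have lin: "linear \<sigma>" using \<sigma> by (rule orthogonal_transformation_linear)
  then have cont: "continuous_on UNIV \<sigma>" by (simp add: linear_continuous_on linear_linear)
  then have [measurable]: "\<sigma> \<in> borel_measurable borel" by (rule borel_measurable_continuous_onI)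
  define \<nu> where "\<nu> = distr lborel borel \<sigma>"
  have [simp, measurable_cong]: "sets \<nu> = sets borel" and [simp]: "space \<nu> = UNIV"
    by (auto simp: \<nu>_def)
  have norm: "norm (\<sigma> x) = norm x" for x using \<sigma> by (rule orthogonal_transformation_norm)
  have surj: "surj \<sigma>" using \<sigma> by (rule orthogonal_transformation_surj)
  have \<nu>_cball: "emeasure \<nu> (cball 0 r) = emeasure lborel (cball (0::'a) r)" for r
  proof -
    have "\<sigma> -` cball 0 r = cball 0 r" by (auto simp: norm)
    then show ?thesis by (simp add: \<nu>_def emeasure_distr)
  qed
  interpret \<nu>: sigma_finite_measure \<nu>
  proof
    show "\<exists>A. countable A \<and> A \<subseteq> sets \<nu> \<and> \<Union> A = space \<nu> \<and> (\<forall>a\<in>A. emeasure \<nu> a \<noteq> \<infinity>)"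
    proof (intro exI[of _ "range (\<lambda>n::nat. cball 0 (real n))"] conjI ballI)
      show "\<Union> (range (\<lambda>n::nat. cball (0::'a) (real n))) = space \<nu>"
        by (auto simp: real_arch_simple)
      fix a assume "a \<in> range (\<lambda>n::nat. cball (0::'a) (real n))"
      then show "emeasure \<nu> a \<noteq> \<infinity>"
        using emeasure_lborel_cball_finite[of "0::'a"] by (auto simp: \<nu>_cball less_top[symmetric])
    qed auto
  qed
  interpret pair_sigma_finite \<nu> "lborel :: 'a measure" ..
  have \<nu>_translate: "(\<integral>\<^sup>+y. f (a + y) \<partial>\<nu>) = (\<integral>\<^sup>+y. f y \<partial>\<nu>)"
    if [measurable]: "f \<in> borel_measurable borel" for f :: "'a \<Rightarrow> ennreal" and a
  proof -
    obtain b where "a = \<sigma> b" using surj by (metis surjD)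
    then have "(\<integral>\<^sup>+y. f (a + y) \<partial>\<nu>) = (\<integral>\<^sup>+y. f (\<sigma> (b + y)) \<partial>lborel)"
      by (simp add: \<nu>_def nn_integral_distr linear_add[OF lin])
    also have "\<dots> = (\<integral>\<^sup>+y. f (\<sigma> y) \<partial>lborel)"
      by (rule nn_integral_lborel_translate[of "\<lambda>y. f (\<sigma> y)"]) simp
    finally show ?thesis by (simp add: \<nu>_def nn_integral_distr)
  qed
  have \<nu>_uminus: "(\<integral>\<^sup>+y. f (- y) \<partial>\<nu>) = (\<integral>\<^sup>+y. f y \<partial>\<nu>)"
    if [measurable]: "f \<in> borel_measurable borel" for f :: "'a \<Rightarrow> ennreal"
    using nn_integral_lborel_uminus[of "\<lambda>y. f (\<sigma> y)"]
    by (simp add: \<nu>_def nn_integral_distr linear_neg[OF lin])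
  let ?B = "cball (0::'a) 1"
  have "\<nu> = lborel"
  proof (rule measure_eqI)
    fix S assume "S \<in> sets \<nu>"
    then have [measurable]: "S \<in> sets borel" by simp
    define g :: "'a \<Rightarrow> ennreal" where "g = indicator ?B"
    define f :: "'a \<Rightarrow> ennreal" where "f = indicator S"
    have [measurable]: "g \<in> borel_measurable borel" "f \<in> borel_measurable borel"
      by (simp_all add: g_def f_def borel_measurable_indicator)
    have "emeasure lborel ?B * emeasure \<nu> S = (\<integral>\<^sup>+x. g x * (\<integral>\<^sup>+y. f y \<partial>\<nu>) \<partial>lborel)"
    proof -
      have "(\<integral>\<^sup>+x. g x * (\<integral>\<^sup>+y. f y \<partial>\<nu>) \<partial>lborel) = (\<integral>\<^sup>+x. g x \<partial>lborel) * (\<integral>\<^sup>+y. f y \<partial>\<nu>)"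
        by (rule nn_integral_multc) simp
      then show ?thesis by (simp add: g_def f_def)
    qed
    also have "\<dots> = (\<integral>\<^sup>+x. (\<integral>\<^sup>+y. g x * f (x + y) \<partial>\<nu>) \<partial>lborel)"
      by (simp add: nn_integral_cmult \<nu>_translate)
    also have "\<dots> = (\<integral>\<^sup>+y. (\<integral>\<^sup>+x. g x * f (x + y) \<partial>lborel) \<partial>\<nu>)"
      by (rule Fubini') simp
    also have "\<dots> = (\<integral>\<^sup>+y. (\<integral>\<^sup>+x. g (x - y) * f x \<partial>lborel) \<partial>\<nu>)"
    proof (rule nn_integral_cong)
      fix y :: 'a
      show "(\<integral>\<^sup>+x. g x * f (x + y) \<partial>lborel) = (\<integral>\<^sup>+x. g (x - y) * f x \<partial>lborel)"
        using nn_integral_lborel_translate[of "\<lambda>x. g (x - y) * f x" y] by (simp add: add.commute)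
    qed
    also have "\<dots> = (\<integral>\<^sup>+x. (\<integral>\<^sup>+y. g (x - y) * f x \<partial>\<nu>) \<partial>lborel)"
      by (rule Fubini'[symmetric]) simp
    also have "\<dots> = (\<integral>\<^sup>+x. (\<integral>\<^sup>+y. g y \<partial>\<nu>) * f x \<partial>lborel)"
    proof (rule nn_integral_cong)
      fix x :: 'a
      have "(\<integral>\<^sup>+y. g (x - y) \<partial>\<nu>) = (\<integral>\<^sup>+y. g (x + y) \<partial>\<nu>)"
        using \<nu>_uminus[of "\<lambda>y. g (x + y)"] by simp
      also have "\<dots> = (\<integral>\<^sup>+y. g y \<partial>\<nu>)" by (rule \<nu>_translate) simp
      finally show "(\<integral>\<^sup>+y. g (x - y) * f x \<partial>\<nu>) = (\<integral>\<^sup>+y. g y \<partial>\<nu>) * f x"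
        by (simp add: nn_integral_multc)
    qed
    also have "\<dots> = emeasure lborel ?B * emeasure lborel S"
      by (simp add: g_def f_def nn_integral_cmult \<nu>_cball)
    finally have "emeasure lborel ?B * emeasure \<nu> S = emeasure lborel ?B * emeasure lborel S" .
    moreover have "emeasure lborel ?B \<noteq> 0" "emeasure lborel ?B \<noteq> top"
    proof -
      have "0 < emeasure lborel (ball (0::'a) 1)"
        using emeasure_lborel_ball_finite open_not_negligible[of "ball (0::'a) 1"]
        by (auto simp: negligible_iff_null_sets null_sets_def zero_less_iff_neq_zero)
      also have "\<dots> \<le> emeasure lborel ?B" by (rule emeasure_mono) auto
      finally show "emeasure lborel ?B \<noteq> 0" by simp
      show "emeasure lborel ?B \<noteq> top"
        using emeasure_lborel_cball_finite[of "0::'a" 1] by (simp add: less_top[symmetric])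
    qed
    ultimately show "emeasure \<nu> S = emeasure lborel S"
      by (simp add: ennreal_mult_cancel_left)
  qed simp
  then show ?thesis by (simp add: \<nu>_def)
qed

lemma nn_integral_lborel_orthogonal:
  fixes \<sigma> :: "'a::euclidean_space \<Rightarrow> 'a"
  assumes "orthogonal_transformation \<sigma>" "f \<in> borel_measurable borel"
  shows "(\<integral>\<^sup>+x. f (\<sigma> x) \<partial>lborel) = (\<integral>\<^sup>+x. f x \<partial>lborel)"
proof -
  have "\<sigma> \<in> borel_measurable borel"
    using assms(1) by (simp add: borel_measurable_continuous_onI linear_continuous_on linear_linear
        orthogonal_transformation_linear)
  then show ?thesis
    using nn_integral_distr[of \<sigma> lborel borel f] assms by (simp add: distr_lborel_orthogonal)
qed

text \<open>
  A property that holds, for each fixed difference \<open>h = y - x\<close>, for almost all \<open>x\<close>, holds for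
  almost all pairs.
\<close>

lemma AE_lborel_shear:
  fixes P :: "'a::euclidean_space \<Rightarrow> 'a \<Rightarrow> bool"
  assumes [measurable]: "Measurable.pred (borel \<Otimes>\<^sub>M borel) (\<lambda>z. P (fst z) (snd z))"
    and ae: "\<And>h. AE x in lborel. P x (x + h)"
  shows "AE x in lborel. AE y in lborel. P x y"
proof -
  have "AE h in lborel. AE x in lborel. P x (x + h)" using ae by simp
  moreover have "{z \<in> space (lborel \<Otimes>\<^sub>M lborel). P (fst z) (fst z + snd z)} \<in> sets (lborel \<Otimes>\<^sub>M lborel)"
  proof -
    have "(\<lambda>z::'a \<times> 'a. (fst z, fst z + snd z)) \<in> borel \<Otimes>\<^sub>M borel \<rightarrow>\<^sub>M borel \<Otimes>\<^sub>M borel"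
      by measurable
    from measurable_compose[OF this assms(1)] show ?thesis
      by (simp add: pred_def space_pair_measure sets_pair_measure_cong[OF sets_lborel sets_lborel])
  qed
  ultimately have "AE x in lborel. AE h in lborel. P x (x + h)"
    using lborel_pair.AE_commute[of "\<lambda>x h. P x (x + h)"] by blast
  then show ?thesis
  proof (rule eventually_mono)
    fix x assume "AE h in lborel. P x (x + h)"
    from AE_lborel_translate[OF this, of "- x"] show "AE y in lborel. P x y" by simp
  qed
qed

text \<open>
  Otherwise, by Fubini, almost no pair would lie in the product of the two sets.
\<close>

lemma ex_translate_meets:
  fixes A B :: "'a::euclidean_space set"
  assumes [measurable]: "A \<in> sets borel" "B \<in> sets borel"
    and A: "\<not> (AE x in lborel. x \<notin> A)" and B: "\<not> (AE x in lborel. x \<notin> B)"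
  obtains h where "\<not> (AE x in lborel. \<not> (x \<in> A \<and> x + h \<in> B))"
proof (rule ccontr)
  assume "\<not> thesis"
  then have "\<And>h. AE x in lborel. \<not> (x \<in> A \<and> x + h \<in> B)" using that by blast
  then have "AE x in lborel. AE y in lborel. \<not> (x \<in> A \<and> y \<in> B)"
    by (intro AE_lborel_shear) auto
  then have "AE x in lborel. x \<notin> A"
    using B by (elim eventually_mono) auto
  with A show False by contradiction
qed

lemma AE_lborel_local:
  fixes S :: "'a::euclidean_space set"
  assumes "\<And>c. c \<in> S \<Longrightarrow> \<exists>T. open T \<and> c \<in> T \<and> (AE x in lborel. x \<in> T \<longrightarrow> Q x)"
  shows "AE x in lborel. x \<in> S \<longrightarrow> Q x"
proof -
  define F where "F = {T. open T \<and> (AE x in lborel. x \<in> T \<longrightarrow> Q x)}"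
  obtain F' where F': "F' \<subseteq> F" "countable F'" "\<Union>F' = \<Union>F"
    using Lindelof[of F] by (auto simp: F_def)
  have "AE x in lborel. \<forall>T\<in>F'. x \<in> T \<longrightarrow> Q x"
    using F' by (subst AE_ball_countable) (auto simp: F_def)
  moreover have "S \<subseteq> \<Union>F'" unfolding F'(3) using assms by (auto simp: F_def)
  ultimately show ?thesis by (elim eventually_mono) blast
qed

text \<open>
  Translation of a measurable function is continuous with respect to convergence in measure on
  bounded sets: on a large ball the function is, up to a set of small measure, uniformly close to a
  continuous function.
\<close>

lemma translation_continuous_in_measure:
  fixes f :: "'a::euclidean_space \<Rightarrow> real"
  assumes [measurable]: "f \<in> borel_measurable borel" "D \<in> sets borel"
    and D: "bounded D" and \<eta>: "0 < \<eta>" and \<kappa>: "0 < \<kappa>"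
  obtains \<delta> where "0 < \<delta>"
    "\<And>k. norm (k - h) < \<delta> \<Longrightarrow> emeasure lborel {x \<in> D. \<bar>f (x + k) - f (x + h)\<bar> > \<eta>} \<le> ennreal \<kappa>"
proof -
  obtain R where R: "\<And>x. x \<in> D \<Longrightarrow> norm x \<le> R" using D by (auto simp: bounded_iff)
  define B where "B = cball (0::'a) (R + norm h + 1)"
  have [measurable]: "B \<in> sets borel" by (simp add: B_def)
  have "f measurable_on UNIV"
    by (rule lebesgue_measurable_imp_measurable_on_real) (auto simp: measurable_completion)
  then obtain N g where N: "negligible N" and g: "\<And>n. continuous_on UNIV (g n)"
    and lim: "\<And>x. x \<notin> N \<Longrightarrow> (\<lambda>n. g n x) \<longlonglongrightarrow> f x"
    by (auto simp: measurable_on_def)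
  have [measurable]: "g n \<in> borel_measurable borel" for n
    using g by (rule borel_measurable_continuous_onI)
  \<comment> \<open>the points at which some approximant from \<open>g n\<close> onwards is not yet close to \<open>f\<close>\<close>
  define A where "A n = (\<Union>k\<in>{n..}. {x \<in> B. \<bar>g k x - f x\<bar> > \<eta> / 3})" for n
  have A_sets[measurable]: "A n \<in> sets borel" for n unfolding A_def by measurable
  have AB: "A n \<subseteq> B" for n by (auto simp: A_def)
  have fin: "emeasure lborel (A n) \<noteq> \<infinity>" for n
    using emeasure_mono[OF AB, of lborel n] emeasure_lborel_cball_finite[of "0::'a" "R + norm h + 1"]
    by (auto simp: B_def top_unique)
  have "(\<Inter>n. A n) \<subseteq> N"
  proof
    fix x assume x: "x \<in> (\<Inter>n. A n)"
    show "x \<in> N"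
    proof (rule ccontr)
      assume "x \<notin> N"
      from lim[OF this] have "eventually (\<lambda>n. dist (g n x) (f x) < \<eta> / 3) sequentially"
        by (rule tendstoD) (use \<eta> in simp)
      then obtain n where "\<And>k. n \<le> k \<Longrightarrow> dist (g k x) (f x) < \<eta> / 3" by (auto simp: eventually_sequentially)
      then have "x \<notin> A n" by (force simp: A_def dist_real_def)
      with x show False by blast
    qed
  qed
  then have "negligible (\<Inter>n. A n)" using N negligible_subset by blast
  then have "emeasure lborel (\<Inter>n. A n) = 0"
    using null_sets_completion_iff[of "\<Inter>n. A n" lborel]
    by (auto simp: negligible_iff_null_sets null_sets_def)
  moreover have "(\<lambda>n. emeasure lborel (A n)) \<longlonglongrightarrow> emeasure lborel (\<Inter>n. A n)"
    using fin by (intro Lim_emeasure_decseq) (force simp: A_def decseq_def)+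
  ultimately have "(\<lambda>n. emeasure lborel (A n)) \<longlonglongrightarrow> 0" by simp
  then have "eventually (\<lambda>n. emeasure lborel (A n) < ennreal (\<kappa> / 2)) sequentially"
    by (rule order_tendstoD) (use \<kappa> in simp)
  then obtain n where n: "emeasure lborel (A n) < ennreal (\<kappa> / 2)"
    by (auto simp: eventually_sequentially)
  have "uniformly_continuous_on B (g n)"
    by (rule compact_uniformly_continuous) (auto simp: B_def intro: continuous_on_subset[OF g])
  then obtain d where d: "d > 0"
    "\<And>x y. x \<in> B \<Longrightarrow> y \<in> B \<Longrightarrow> dist y x < d \<Longrightarrow> dist (g n y) (g n x) < \<eta> / 3"
    unfolding uniformly_continuous_on_def using \<eta> by (metis zero_less_divide_iff zero_less_numeral)
  show thesis
  proof (rule that[of "min d 1"])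
    fix k assume k: "norm (k - h) < min d 1"
    have "{x \<in> D. \<bar>f (x + k) - f (x + h)\<bar> > \<eta>} \<subseteq> {x. k + x \<in> A n} \<union> {x. h + x \<in> A n}"
    proof
      fix x assume x: "x \<in> {x \<in> D. \<bar>f (x + k) - f (x + h)\<bar> > \<eta>}"
      have nk: "norm k \<le> norm h + 1" using k norm_triangle_sub[of k h] by auto
      have B: "k + x \<in> B" "h + x \<in> B"
        using R[of x] x nk norm_triangle_ineq[of k x] norm_triangle_ineq[of h x] by (auto simp: B_def)
      then have "dist (g n (k + x)) (g n (h + x)) < \<eta> / 3"
        using k by (intro d) (auto simp: dist_norm)
      then have "\<bar>g n (k + x) - f (k + x)\<bar> > \<eta> / 3 \<or> \<bar>g n (h + x) - f (h + x)\<bar> > \<eta> / 3"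
        using x unfolding dist_real_def add.commute[of x] mem_Collect_eq by argo
      with B show "x \<in> {x. k + x \<in> A n} \<union> {x. h + x \<in> A n}" by (auto simp: A_def)
    qed
    then have "emeasure lborel {x \<in> D. \<bar>f (x + k) - f (x + h)\<bar> > \<eta>}
        \<le> emeasure lborel ({x. k + x \<in> A n} \<union> {x. h + x \<in> A n})"
      by (rule emeasure_mono) simp
    also have "\<dots> \<le> emeasure lborel {x. k + x \<in> A n} + emeasure lborel {x. h + x \<in> A n}"
      by (rule emeasure_subadditive) auto
    also have "\<dots> \<le> ennreal (\<kappa> / 2) + ennreal (\<kappa> / 2)"
      using n by (intro add_mono) (auto simp: emeasure_lborel_translate)
    also have "\<dots> = ennreal \<kappa>" using \<kappa> by (subst ennreal_plus[symmetric]) auto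
    finally show "emeasure lborel {x \<in> D. \<bar>f (x + k) - f (x + h)\<bar> > \<eta>} \<le> ennreal \<kappa>" .
  qed (use d in simp)
qed

lemma AE_lborel_orthogonal:
  fixes \<sigma> :: "'a::euclidean_space \<Rightarrow> 'a"
  assumes "orthogonal_transformation \<sigma>" "AE x in lborel. R x"
  shows "AE x in lborel. R (\<sigma> x)"
proof -
  have "\<sigma> \<in> borel_measurable borel"
    using assms(1) by (simp add: borel_measurable_continuous_onI linear_continuous_on linear_linear
        orthogonal_transformation_linear)
  then have "\<sigma> \<in> lborel \<rightarrow>\<^sub>M borel" by simp
  moreover have "AE x in distr lborel borel \<sigma>. R x"
    using assms(2) unfolding distr_lborel_orthogonal[OF assms(1)] .
  ultimately show ?thesis by (rule AE_distrD)
qed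

lemma nn_integral_lborel_scale:
  fixes f :: "'a::euclidean_space \<Rightarrow> ennreal"
  assumes [measurable]: "f \<in> borel_measurable borel" and "0 < \<epsilon>"
  shows "(\<integral>\<^sup>+z. f (z /\<^sub>R \<epsilon>) * ennreal (1 / \<epsilon> ^ DIM('a)) \<partial>lborel) = (\<integral>\<^sup>+z. f z \<partial>lborel)"
proof -
  have eq: "lborel = density (distr lborel borel (\<lambda>x::'a. 0 + \<epsilon> *\<^sub>R x)) (\<lambda>_. ennreal (\<bar>\<epsilon>\<bar> ^ DIM('a)))"
    using lborel_affine[of \<epsilon> "0::'a"] assms(2) by simp
  have "(\<integral>\<^sup>+z. f (z /\<^sub>R \<epsilon>) * ennreal (1 / \<epsilon> ^ DIM('a)) \<partial>lborel) =
     (\<integral>\<^sup>+z. f (z /\<^sub>R \<epsilon>) * ennreal (1 / \<epsilon> ^ DIM('a))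
        \<partial>density (distr lborel borel (\<lambda>x::'a. 0 + \<epsilon> *\<^sub>R x)) (\<lambda>_. ennreal (\<bar>\<epsilon>\<bar> ^ DIM('a))))"
    using eq by simp
  also have "\<dots> = (\<integral>\<^sup>+z. ennreal (\<epsilon> ^ DIM('a)) * (f z * ennreal (1 / \<epsilon> ^ DIM('a))) \<partial>lborel)"
    using assms(2) by (simp add: nn_integral_density nn_integral_distr)
  also have "\<dots> = (\<integral>\<^sup>+z. f z \<partial>lborel)"
  proof (rule nn_integral_cong)
    fix z
    have "ennreal (\<epsilon> ^ DIM('a)) * (f z * ennreal (1 / \<epsilon> ^ DIM('a)))
        = f z * (ennreal (\<epsilon> ^ DIM('a)) * ennreal (1 / \<epsilon> ^ DIM('a)))" by (simp only: mult_ac)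
    also have "ennreal (\<epsilon> ^ DIM('a)) * ennreal (1 / \<epsilon> ^ DIM('a)) = 1"
      using assms(2) by (subst ennreal_mult[symmetric]) auto
    finally show "ennreal (\<epsilon> ^ DIM('a)) * (f z * ennreal (1 / \<epsilon> ^ DIM('a))) = f z" by simp
  qed
  finally show ?thesis .
qed

lemma AE_lborel_scale:
  fixes R :: "'a::euclidean_space \<Rightarrow> bool"
  assumes "AE z in lborel. R z" "0 < \<epsilon>"
  shows "AE z in lborel. R (z /\<^sub>R \<epsilon>)"
proof -
  obtain N where N: "{z. \<not> R z} \<subseteq> N" "N \<in> null_sets lborel"
    using assms(1) by (auto elim!: AE_E simp: null_sets_def)
  have [measurable]: "N \<in> sets borel" using N by auto
  have "(\<integral>\<^sup>+z. indicator N (z /\<^sub>R \<epsilon>) * ennreal (1 / \<epsilon> ^ DIM('a)) \<partial>lborel) = 0"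
    using N nn_integral_lborel_scale[of "indicator N :: 'a \<Rightarrow> ennreal" \<epsilon>] assms(2) by auto
  then have "AE z in lborel. indicator N (z /\<^sub>R \<epsilon>) * ennreal (1 / \<epsilon> ^ DIM('a)) = 0"
    by (subst (asm) nn_integral_0_iff_AE) auto
  then show ?thesis
    using N(1) assms(2) by (elim eventually_mono) (auto simp: indicator_def split: if_splits)
qed

section \<open>Increments in two orthogonal directions\<close>

text \<open>
  \<open>P\<close> and \<open>Q\<close> are the orthogonal projections onto two complementary orthogonal subspaces, namely
  \<open>range P\<close> and \<open>range Q\<close>. The axioms are symmetric in \<open>P\<close> and \<open>Q\<close>, so that every result can be
  used with the two exchanged.
\<close>

locale orthogonal_projections =
  fixes P Q :: "'a::euclidean_space \<Rightarrow> 'a"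
  assumes linear_P: "linear P" and linear_Q: "linear Q"
    and P_plus_Q: "P x + Q x = x" and P_idem: "P (P x) = P x"
    and orth: "P x \<bullet> Q y = 0"
begin

lemma Q_P [simp]: "Q (P x) = 0"
  using P_plus_Q[of "P x"] P_idem[of x] by simp

lemma P_Q [simp]: "P (Q x) = 0"
proof -
  have "P (Q x) = P (x - P x)" using P_plus_Q[of x] by (metis add_diff_cancel_left')
  then show ?thesis by (simp add: linear_diff[OF linear_P] P_idem)
qed

lemma Q_idem: "Q (Q x) = Q x"
  using P_plus_Q[of "Q x"] by simp

lemma swap: "orthogonal_projections Q P"
proof (rule orthogonal_projections.intro)
  show "Q x + P x = x" for x using P_plus_Q[of x] by (simp add: add.commute)
  show "Q x \<bullet> P y = 0" for x y using orth[of y x] by (simp add: inner_commute)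
qed (fact linear_P linear_Q Q_idem)+

lemmas P_simps [simp] = linear_add[OF linear_P] linear_diff[OF linear_P] linear_neg[OF linear_P]
  linear_scale[OF linear_P] linear_0[OF linear_P] P_idem
lemmas Q_simps [simp] = linear_add[OF linear_Q] linear_diff[OF linear_Q] linear_neg[OF linear_Q]
  linear_scale[OF linear_Q] linear_0[OF linear_Q] Q_idem

lemma continuous_P: "continuous_on S P" and continuous_Q: "continuous_on S Q"
  using linear_P linear_Q by (auto simp: linear_continuous_on linear_linear)

lemma measurable_P [measurable]: "P \<in> borel_measurable borel"
  and measurable_Q [measurable]: "Q \<in> borel_measurable borel"
  by (auto intro: borel_measurable_continuous_onI continuous_P continuous_Q)

lemma norm_decompose: "norm x ^ 2 = norm (P x) ^ 2 + norm (Q x) ^ 2"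
proof -
  have "norm x ^ 2 = (P x + Q x) \<bullet> (P x + Q x)" by (simp add: P_plus_Q power2_norm_eq_inner)
  also have "\<dots> = norm (P x) ^ 2 + norm (Q x) ^ 2"
    using orth[of x x] by (simp add: inner_add_left inner_add_right inner_commute power2_norm_eq_inner)
  finally show ?thesis .
qed

lemma norm_P_le: "norm (P x) \<le> norm x" and norm_Q_le: "norm (Q x) \<le> norm x"
  using norm_decompose[of x] by (auto intro: power2_le_imp_le)

lemma norm_le_P_Q: "norm x \<le> norm (P x) + norm (Q x)"
  using norm_triangle_ineq[of "P x" "Q x"] by (simp add: P_plus_Q)

lemma orthogonal_reflection: "orthogonal_transformation (\<lambda>x. P x - Q x)"
  unfolding orthogonal_transformation
proof (intro conjI allI)
  show "linear (\<lambda>x. P x - Q x)" using linear_P linear_Q by (rule linear_compose_sub)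
  fix x
  have "norm (P x - Q x) ^ 2 = norm x ^ 2"
    using norm_decompose[of "P x - Q x"] norm_decompose[of x] by simp
  then show "norm (P x - Q x) = norm x"
    by (rule power2_eq_imp_eq) simp_all
qed

lemma orthogonal_reflection': "orthogonal_transformation (\<lambda>x. Q x - P x)"
  using orthogonal_projections.orthogonal_reflection[OF swap] .

text \<open>
  The product of a ball in \<open>range P\<close> and a ball in \<open>range Q\<close>, of the same radius.
\<close>

definition cell :: "'a \<Rightarrow> real \<Rightarrow> 'a set" where
  "cell c r = {x. norm (P (x - c)) < r \<and> norm (Q (x - c)) < r}"

lemma open_cell: "open (cell c r)"
  unfolding cell_def
  by (intro open_Collect_conj open_Collect_less continuous_intros
       continuous_on_compose2[OF continuous_P] continuous_on_compose2[OF continuous_Q]) auto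

lemma cell_borel [measurable]: "cell c r \<in> sets borel"
  using open_cell by (rule borel_open)

lemma centre_in_cell: "0 < r \<Longrightarrow> c \<in> cell c r"
  by (simp add: cell_def)

lemma cell_subset_ball: "cell c r \<subseteq> ball c (2 * r)"
proof
  fix x assume "x \<in> cell c r"
  then have "norm (x - c) < 2 * r" using norm_le_P_Q[of "x - c"] unfolding cell_def by auto
  then show "x \<in> ball c (2 * r)" by (simp add: dist_norm norm_minus_commute)
qed

lemma ball_subset_cell: "ball c r \<subseteq> cell c r"
proof
  fix x assume "x \<in> ball c r"
  then have "norm (x - c) < r" by (simp add: dist_norm norm_minus_commute)
  then show "x \<in> cell c r"
    using norm_P_le[of "x - c"] norm_Q_le[of "x - c"] unfolding cell_def by auto
qed

lemma bounded_cell: "bounded (cell c r)"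
  by (rule bounded_subset[OF bounded_ball cell_subset_ball])

lemma emeasure_cell_finite: "emeasure lborel (cell c r) < \<infinity>"
  using bounded_cell by (rule emeasure_bounded_finite)

lemma cell_swap: "orthogonal_projections.cell Q P c r = cell c r"
  unfolding orthogonal_projections.cell_def[OF swap] cell_def by (simp only: conj_commute)

lemma cell_mono: "r \<le> s \<Longrightarrow> cell c r \<subseteq> cell c s"
  unfolding cell_def by auto

lemma cell_translate:
  assumes "x \<in> cell c r" "norm (P a) \<le> s" "norm (Q a) \<le> s"
  shows "x + a \<in> cell c (r + s)"
proof -
  have eq: "P (x + a - c) = P (x - c) + P a" "Q (x + a - c) = Q (x - c) + Q a"
    by (simp_all add: algebra_simps)
  show ?thesis
    using assms norm_triangle_ineq[of "P (x - c)" "P a"] norm_triangle_ineq[of "Q (x - c)" "Q a"]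
    unfolding cell_def mem_Collect_eq eq by linarith
qed

text \<open>
  The numerator of the energy density at \<open>x\<close> for the displacement \<open>z\<close>, and its integral over \<open>D\<close>.
\<close>

definition corner_product :: "real \<Rightarrow> real \<Rightarrow> ('a \<Rightarrow> real) \<Rightarrow> 'a \<Rightarrow> 'a \<Rightarrow> real" where
  "corner_product \<alpha> \<beta> u z x = \<bar>u (x + P z) - u x\<bar> powr \<alpha> * \<bar>u (x + Q z) - u x\<bar> powr \<beta>"

lemma corner_product_nonneg [simp]: "0 \<le> corner_product \<alpha> \<beta> u z x"
  by (simp add: corner_product_def)

definition cell_energy :: "real \<Rightarrow> real \<Rightarrow> ('a \<Rightarrow> real) \<Rightarrow> 'a set \<Rightarrow> 'a \<Rightarrow> ennreal" where
  "cell_energy \<alpha> \<beta> u D z = (\<integral>\<^sup>+x\<in>D. ennreal (corner_product \<alpha> \<beta> u z x) \<partial>lborel)"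

lemma corner_product_measurable [measurable]:
  assumes [measurable]: "u \<in> borel_measurable borel"
  shows "(\<lambda>w. corner_product \<alpha> \<beta> u (fst w) (snd w)) \<in> borel_measurable (borel \<Otimes>\<^sub>M borel)"
  unfolding corner_product_def by measurable

lemma corner_product_measurable1 [measurable]:
  assumes [measurable]: "u \<in> borel_measurable borel"
  shows "corner_product \<alpha> \<beta> u z \<in> borel_measurable borel"
  unfolding corner_product_def by measurable

lemma cell_energy_measurable [measurable]:
  assumes [measurable]: "u \<in> borel_measurable borel" "D \<in> sets borel"
  shows "cell_energy \<alpha> \<beta> u D \<in> borel_measurable borel"
proof -
  have "(\<lambda>w. ennreal (corner_product \<alpha> \<beta> u (fst w) (snd w)) * indicator D (snd w))
      \<in> borel_measurable (borel \<Otimes>\<^sub>M lborel)"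
    using sets_pair_measure_cong[OF refl sets_lborel] by (simp cong: measurable_cong_sets) measurable
  from lborel.borel_measurable_nn_integral_fst[OF this] show ?thesis
    unfolding cell_energy_def[abs_def] by simp
qed

lemma nn_integral_cell_translate_le:
  assumes [measurable]: "f \<in> borel_measurable borel"
    and "norm (P a) \<le> r" "norm (Q a) \<le> r"
  shows "(\<integral>\<^sup>+x\<in>cell c r. f (x + a) \<partial>lborel) \<le> (\<integral>\<^sup>+x\<in>cell c (2 * r). f x \<partial>lborel)"
proof -
  have "(\<integral>\<^sup>+x\<in>cell c r. f (x + a) \<partial>lborel) \<le> (\<integral>\<^sup>+x. f (a + x) * indicator (cell c (2 * r)) (a + x) \<partial>lborel)"
  proof (rule nn_integral_mono)
    fix x
    show "f (x + a) * indicator (cell c r) x \<le> f (a + x) * indicator (cell c (2 * r)) (a + x)"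
      using cell_translate[OF _ assms(2,3), of x c r] by (auto simp: add.commute indicator_def)
  qed
  also have "\<dots> = (\<integral>\<^sup>+x\<in>cell c (2 * r). f x \<partial>lborel)"
    by (rule nn_integral_lborel_translate[of "\<lambda>x. f x * indicator (cell c (2 * r)) x"]) simp
  finally show ?thesis .
qed

text \<open>
  On the grid \<open>x + i *\<^sub>R P z + j *\<^sub>R Q z\<close> each of the four corners of a cell contributes a corner
  product, for \<open>z\<close> or one of its reflections \<open>Q z - P z\<close>, \<open>P z - Q z\<close>, \<open>- z\<close>.
\<close>

lemma grid_energy_corner_products:
  "grid_energy \<alpha> \<beta> m (\<lambda>i j. u (x + (real i *\<^sub>R P z + real j *\<^sub>R Q z))) =
   (\<Sum>j<m. \<Sum>i<m.
      corner_product \<alpha> \<beta> u z (x + (real i *\<^sub>R P z + real j *\<^sub>R Q z)) +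
      corner_product \<alpha> \<beta> u (Q z - P z) (x + (real (Suc i) *\<^sub>R P z + real j *\<^sub>R Q z)) +
      corner_product \<alpha> \<beta> u (P z - Q z) (x + (real i *\<^sub>R P z + real (Suc j) *\<^sub>R Q z)) +
      corner_product \<alpha> \<beta> u (- z) (x + (real (Suc i) *\<^sub>R P z + real (Suc j) *\<^sub>R Q z)))"
  unfolding grid_energy_def
  by (intro sum.cong) (simp_all add: corner_product_def algebra_simps abs_minus_commute)

text \<open>
  The grid estimate, integrated over the base point. The grid points stay in the cell of twice the
  radius, and the \<open>m * m\<close> cells raise the power of \<open>m\<close> from \<open>critical_exponent \<alpha> \<beta> - 2\<close> to
  \<open>critical_exponent \<alpha> \<beta>\<close>.
\<close>

proposition min_increment_integral_le:
  assumes "0 < \<alpha>" "0 < \<beta>"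
  shows "\<exists>C\<ge>0. \<forall>u c r z m. u \<in> borel_measurable borel \<longrightarrow> real m * norm z \<le> r \<longrightarrow>
    (\<integral>\<^sup>+x\<in>cell c r. ennreal (min \<bar>u (x + real m *\<^sub>R P z) - u x\<bar> \<bar>u (x + real m *\<^sub>R Q z) - u x\<bar> powr (\<alpha> + \<beta>)) \<partial>lborel)
    \<le> ennreal (C * real m powr critical_exponent \<alpha> \<beta>) *
        (cell_energy \<alpha> \<beta> u (cell c (2 * r)) z + cell_energy \<alpha> \<beta> u (cell c (2 * r)) (Q z - P z) +
         cell_energy \<alpha> \<beta> u (cell c (2 * r)) (P z - Q z) + cell_energy \<alpha> \<beta> u (cell c (2 * r)) (- z))"
proof -
  obtain C where C: "C \<ge> 0" and bound: "\<And>U m. min \<bar>U m 0 - U 0 0\<bar> \<bar>U 0 m - U 0 0\<bar> powr (\<alpha> + \<beta>)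
     \<le> C * (real m powr (critical_exponent \<alpha> \<beta> - 2) * grid_energy \<alpha> \<beta> m U)"
    using min_increment_powr_le[OF assms] by blast
  show ?thesis
  proof (intro exI[of _ C] conjI allI impI C)
    fix u :: "'a \<Rightarrow> real" and c :: 'a and r :: real and z :: 'a and m :: nat
    assume u[measurable]: "u \<in> borel_measurable borel" and mz: "real m * norm z \<le> r"
    define a where "a i j = real i *\<^sub>R P z + real j *\<^sub>R Q z" for i j :: nat
    define G where "G = cell_energy \<alpha> \<beta> u (cell c (2 * r))"
    define K where "K = C * real m powr (critical_exponent \<alpha> \<beta> - 2)"
    have K: "0 \<le> K" using C by (simp add: K_def)
    define e where "e i j x =
      ennreal (corner_product \<alpha> \<beta> u z (x + a i j)) +
      ennreal (corner_product \<alpha> \<beta> u (Q z - P z) (x + a (Suc i) j)) +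
      ennreal (corner_product \<alpha> \<beta> u (P z - Q z) (x + a i (Suc j))) +
      ennreal (corner_product \<alpha> \<beta> u (- z) (x + a (Suc i) (Suc j)))" for i j x
    have [measurable]: "e i j \<in> borel_measurable borel" for i j
      unfolding e_def[abs_def] by measurable
    have le: "ennreal (min \<bar>u (x + real m *\<^sub>R P z) - u x\<bar> \<bar>u (x + real m *\<^sub>R Q z) - u x\<bar> powr (\<alpha> + \<beta>))
        \<le> ennreal K * (\<Sum>j<m. \<Sum>i<m. e i j x)" for x
    proof -
      have "min \<bar>u (x + real m *\<^sub>R P z) - u x\<bar> \<bar>u (x + real m *\<^sub>R Q z) - u x\<bar> powr (\<alpha> + \<beta>)
          \<le> K * grid_energy \<alpha> \<beta> m (\<lambda>i j. u (x + a i j))"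
        using bound[of "\<lambda>i j. u (x + a i j)" m] by (simp add: a_def K_def mult.assoc)
      then have "ennreal (min \<bar>u (x + real m *\<^sub>R P z) - u x\<bar> \<bar>u (x + real m *\<^sub>R Q z) - u x\<bar> powr (\<alpha> + \<beta>))
          \<le> ennreal (K * grid_energy \<alpha> \<beta> m (\<lambda>i j. u (x + a i j)))" by (rule ennreal_leI)
      also have "\<dots> = ennreal K * ennreal (grid_energy \<alpha> \<beta> m (\<lambda>i j. u (x + a i j)))"
        using K by (rule ennreal_mult')
      also have "ennreal (grid_energy \<alpha> \<beta> m (\<lambda>i j. u (x + a i j))) = (\<Sum>j<m. \<Sum>i<m. e i j x)"
        unfolding a_def e_def grid_energy_corner_products
        by (simp add: sum_nonneg flip: sum_ennreal)
      finally show ?thesis .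
    qed
    have shift: "(\<integral>\<^sup>+x\<in>cell c r. ennreal (corner_product \<alpha> \<beta> u w (x + a i j)) \<partial>lborel) \<le> G w"
      if "i \<le> m" "j \<le> m" for i j w
      unfolding G_def cell_energy_def
    proof (rule nn_integral_cell_translate_le)
      have "real i * norm z \<le> r" "real j * norm z \<le> r"
        using that mz by (meson mult_right_mono norm_ge_zero of_nat_le_iff order.trans)+
      moreover have "real i * norm (P z) \<le> real i * norm z" "real j * norm (Q z) \<le> real j * norm z"
        by (auto intro: mult_left_mono norm_P_le norm_Q_le)
      ultimately show "norm (P (a i j)) \<le> r" "norm (Q (a i j)) \<le> r"
        by (auto simp: a_def)
    qed simp
    have eG: "(\<integral>\<^sup>+x\<in>cell c r. e i j x \<partial>lborel) \<le> G z + G (Q z - P z) + G (P z - Q z) + G (- z)"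
      if "i < m" "j < m" for i j
    proof -
      have "(\<integral>\<^sup>+x\<in>cell c r. e i j x \<partial>lborel) =
        (\<integral>\<^sup>+x\<in>cell c r. ennreal (corner_product \<alpha> \<beta> u z (x + a i j)) \<partial>lborel) +
        (\<integral>\<^sup>+x\<in>cell c r. ennreal (corner_product \<alpha> \<beta> u (Q z - P z) (x + a (Suc i) j)) \<partial>lborel) +
        (\<integral>\<^sup>+x\<in>cell c r. ennreal (corner_product \<alpha> \<beta> u (P z - Q z) (x + a i (Suc j))) \<partial>lborel) +
        (\<integral>\<^sup>+x\<in>cell c r. ennreal (corner_product \<alpha> \<beta> u (- z) (x + a (Suc i) (Suc j))) \<partial>lborel)"
        unfolding e_def distrib_right by (simp add: nn_integral_add)
      then show ?thesis using that by (auto intro!: add_mono shift)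
    qed
    have "(\<integral>\<^sup>+x\<in>cell c r. ennreal (min \<bar>u (x + real m *\<^sub>R P z) - u x\<bar> \<bar>u (x + real m *\<^sub>R Q z) - u x\<bar> powr (\<alpha> + \<beta>)) \<partial>lborel)
      \<le> (\<integral>\<^sup>+x. ennreal K * (\<Sum>j<m. \<Sum>i<m. e i j x * indicator (cell c r) x) \<partial>lborel)"
    proof (rule nn_integral_mono)
      fix x
      show "ennreal (min \<bar>u (x + real m *\<^sub>R P z) - u x\<bar> \<bar>u (x + real m *\<^sub>R Q z) - u x\<bar> powr (\<alpha> + \<beta>)) * indicator (cell c r) x
        \<le> ennreal K * (\<Sum>j<m. \<Sum>i<m. e i j x * indicator (cell c r) x)"
        using le[of x] by (auto simp: indicator_def)
    qed
    also have "\<dots> = ennreal K * (\<Sum>j<m. \<Sum>i<m. (\<integral>\<^sup>+x\<in>cell c r. e i j x \<partial>lborel))"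
    proof -
      have "(\<integral>\<^sup>+x. (\<Sum>j<m. \<Sum>i<m. e i j x * indicator (cell c r) x) \<partial>lborel)
        = (\<Sum>j<m. \<integral>\<^sup>+x. (\<Sum>i<m. e i j x * indicator (cell c r) x) \<partial>lborel)"
        by (rule nn_integral_sum) measurable
      also have "\<dots> = (\<Sum>j<m. \<Sum>i<m. (\<integral>\<^sup>+x\<in>cell c r. e i j x \<partial>lborel))"
        by (rule sum.cong[OF refl], rule nn_integral_sum) measurable
      finally have eq: "(\<integral>\<^sup>+x. (\<Sum>j<m. \<Sum>i<m. e i j x * indicator (cell c r) x) \<partial>lborel)
        = (\<Sum>j<m. \<Sum>i<m. (\<integral>\<^sup>+x\<in>cell c r. e i j x \<partial>lborel))" .
      have "(\<lambda>x. \<Sum>j<m. \<Sum>i<m. e i j x * indicator (cell c r) x) \<in> borel_measurable lborel"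
        by measurable
      from nn_integral_cmult[OF this, of "ennreal K"] show ?thesis by (simp only: eq)
    qed
    also have "\<dots> \<le> ennreal K * (\<Sum>j<m. \<Sum>i<m. G z + G (Q z - P z) + G (P z - Q z) + G (- z))"
      by (intro mult_left_mono sum_mono eG) auto
    also have "\<dots> = ennreal (K * (real m * real m)) * (G z + G (Q z - P z) + G (P z - Q z) + G (- z))"
      using K by (simp add: ennreal_mult mult.assoc ennreal_of_nat_eq_real_of_nat)
    also have "K * (real m * real m) = C * real m powr critical_exponent \<alpha> \<beta>"
    proof (cases "m = 0")
      case False
      then have "real m * real m = real m powr 2" by (simp add: power2_eq_square)
      then show ?thesis by (simp add: K_def mult.assoc powr_add[symmetric] del: powr_numeral)
    qed simp
    finally show "(\<integral>\<^sup>+x\<in>cell c r. ennreal (min \<bar>u (x + real m *\<^sub>R P z) - u x\<bar> \<bar>u (x + real m *\<^sub>R Q z) - u x\<bar> powr (\<alpha> + \<beta>)) \<partial>lborel)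
      \<le> ennreal (C * real m powr critical_exponent \<alpha> \<beta>) *
        (cell_energy \<alpha> \<beta> u (cell c (2 * r)) z + cell_energy \<alpha> \<beta> u (cell c (2 * r)) (Q z - P z) +
         cell_energy \<alpha> \<beta> u (cell c (2 * r)) (P z - Q z) + cell_energy \<alpha> \<beta> u (cell c (2 * r)) (- z))"
      unfolding G_def .
  qed
qed

end

section \<open>Finite energy excludes simultaneous increments\<close>

text \<open>
  The vectors whose direction differs from that of \<open>h\<close> by less than \<open>\<delta>\<close>.
\<close>

definition direction_cone :: "'a::euclidean_space \<Rightarrow> real \<Rightarrow> 'a set" where
  "direction_cone h \<delta> = {z. z \<noteq> 0 \<and> norm (z /\<^sub>R norm z - h /\<^sub>R norm h) < \<delta>}"

lemma open_direction_cone: "open (direction_cone h \<delta>)"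
proof -
  have "open ({z. z \<noteq> 0} \<inter> {z. norm (z /\<^sub>R norm z - h /\<^sub>R norm h) < \<delta>})" (is "open (?A \<inter> _)")
  proof -
    have "open ?A" by (simp add: open_Collect_neq)
    moreover have "continuous_on ?A (\<lambda>z. norm (z /\<^sub>R norm z - h /\<^sub>R norm h))"
      by (intro continuous_intros) auto
    ultimately have "open (?A \<inter> (\<lambda>z. norm (z /\<^sub>R norm z - h /\<^sub>R norm h)) -` {..<\<delta>})"
      by (intro continuous_open_preimage) auto
    then show ?thesis by (simp add: vimage_def)
  qed
  then show ?thesis by (simp add: direction_cone_def Collect_conj_eq)
qed

lemma direction_cone_borel [measurable]: "direction_cone h \<delta> \<in> sets borel"
  using open_direction_cone by (rule borel_open)

lemma direction_cone_scale: "0 < \<epsilon> \<Longrightarrow> z /\<^sub>R \<epsilon> \<in> direction_cone h \<delta> \<longleftrightarrow> z \<in> direction_cone h \<delta>"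
proof -
  assume \<epsilon>: "0 < \<epsilon>"
  then have "inverse (norm (z /\<^sub>R \<epsilon>)) * inverse \<epsilon> = inverse (norm z)" by (simp add: field_simps)
  then have "(z /\<^sub>R \<epsilon>) /\<^sub>R norm (z /\<^sub>R \<epsilon>) = z /\<^sub>R norm z" by (simp only: scaleR_scaleR)
  then show ?thesis using \<epsilon> by (simp add: direction_cone_def del: norm_scaleR scaleR_scaleR)
qed

text \<open>
  A nonzero kernel that is invariant under isometries charges every cone, because the isometric
  images of one cone cover the space up to the origin.
\<close>

lemma direction_cone_not_null:
  fixes \<rho> :: "real ^ 'n \<Rightarrow> real"
  assumes inv: "\<And>\<sigma>. orthogonal_transformation \<sigma> \<Longrightarrow> AE z in lborel. \<rho> (\<sigma> z) = \<rho> z"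
    and \<rho>: "\<not> (AE z in lborel. \<rho> z = 0)" and h: "h \<noteq> 0" and \<delta>: "0 < \<delta>"
  shows "\<not> (AE z in lborel. z \<in> direction_cone h \<delta> \<longrightarrow> \<rho> z = 0)"
proof
  assume null: "AE z in lborel. z \<in> direction_cone h \<delta> \<longrightarrow> \<rho> z = 0"
  have "AE z in lborel. z \<in> - {0} \<longrightarrow> \<rho> z = 0"
  proof (rule AE_lborel_local)
    fix \<omega> :: "real ^ 'n" assume "\<omega> \<in> - {0}"
    then have "norm (\<omega> /\<^sub>R norm \<omega>) = norm (h /\<^sub>R norm h)" using h by simp
    then obtain \<sigma> where \<sigma>: "orthogonal_transformation \<sigma>" "\<sigma> (\<omega> /\<^sub>R norm \<omega>) = h /\<^sub>R norm h"
      by (rule orthogonal_transformation_exists)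
    have lin: "linear \<sigma>" using \<sigma>(1) by (rule orthogonal_transformation_linear)
    define T where "T = \<sigma> -` direction_cone h \<delta>"
    have "open T" unfolding T_def
      using lin by (intro open_vimage open_direction_cone) (simp add: linear_continuous_on linear_linear)
    moreover have "\<omega> \<in> T"
    proof -
      have n: "norm (\<sigma> \<omega>) = norm \<omega>" using \<sigma>(1) by (rule orthogonal_transformation_norm)
      then have "\<sigma> \<omega> \<noteq> 0" using \<open>\<omega> \<in> - {0}\<close> by auto
      moreover have "\<sigma> \<omega> /\<^sub>R norm (\<sigma> \<omega>) = h /\<^sub>R norm h"
        using \<sigma>(2) by (simp add: n linear_scale[OF lin])
      ultimately show ?thesis using \<delta> by (simp add: T_def direction_cone_def)
    qed
    moreover have "AE z in lborel. z \<in> T \<longrightarrow> \<rho> z = 0"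
      using AE_lborel_orthogonal[OF \<sigma>(1) null] inv[OF \<sigma>(1)]
      by eventually_elim (auto simp: T_def)
    ultimately show "\<exists>T. open T \<and> \<omega> \<in> T \<and> (AE z in lborel. z \<in> T \<longrightarrow> \<rho> z = 0)" by blast
  qed
  moreover have "AE z in lborel. z \<noteq> (0 :: real ^ 'n)" by (rule AE_lborel_singleton)
  ultimately have "AE z in lborel. \<rho> z = 0" by eventually_elim auto
  with \<rho> show False by contradiction
qed

lemma critical_exponent_pos: "0 < \<alpha> \<Longrightarrow> 0 < \<beta> \<Longrightarrow> 0 < critical_exponent \<alpha> \<beta>"
  by (auto simp: critical_exponent_def min_def)

context orthogonal_projections
begin

text \<open>
  If both increments for the displacement \<open>h\<close> are nonzero on a set of positive measure, then this
  persists quantitatively for all displacements near \<open>h\<close>.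
\<close>

lemma min_increment_integral_lower_bound:
  assumes u[measurable]: "u \<in> borel_measurable borel" and \<theta>: "0 < \<theta>"
    and neg: "\<not> (AE x in lborel. x \<in> cell c r \<longrightarrow> u (x + P h) = u x \<or> u (x + Q h) = u x)"
  obtains c0 \<delta> where "0 < c0" "0 < \<delta>"
    "\<And>k. norm (k - h) < \<delta> \<Longrightarrow>
       ennreal c0 \<le> (\<integral>\<^sup>+x\<in>cell c r. ennreal (min \<bar>u (x + P k) - u x\<bar> \<bar>u (x + Q k) - u x\<bar> powr \<theta>) \<partial>lborel)"
proof -
  define S where "S \<eta> k = {x \<in> cell c r. \<bar>u (x + P k) - u x\<bar> > \<eta> \<and> \<bar>u (x + Q k) - u x\<bar> > \<eta>}" for \<eta> k
  have [measurable]: "S \<eta> k \<in> sets borel" for \<eta> k unfolding S_def by measurable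
  have "\<exists>n. emeasure lborel (S (2 / real (Suc n)) h) \<noteq> 0"
  proof (rule ccontr)
    assume "\<not> ?thesis"
    then have "AE x in lborel. x \<notin> S (2 / real (Suc n)) h" for n
      by (intro AE_not_in) (auto simp: null_sets_def)
    then have "AE x in lborel. \<forall>n. x \<notin> S (2 / real (Suc n)) h" by (simp add: AE_all_countable)
    then have "AE x in lborel. x \<in> cell c r \<longrightarrow> u (x + P h) = u x \<or> u (x + Q h) = u x"
    proof eventually_elim
      case (elim x)
      show ?case
      proof (rule impI, rule ccontr)
        assume x: "x \<in> cell c r" and ne: "\<not> (u (x + P h) = u x \<or> u (x + Q h) = u x)"
        define t where "t = min \<bar>u (x + P h) - u x\<bar> \<bar>u (x + Q h) - u x\<bar>"
        have "t > 0" using ne by (simp add: t_def)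
        then obtain n where "inverse (real (Suc n)) < t / 2"
          using reals_Archimedean[of "t / 2"] by auto
        then have "2 / real (Suc n) < t" by (simp add: field_simps)
        then have "x \<in> S (2 / real (Suc n)) h" using x by (simp add: S_def t_def)
        with elim show False by blast
      qed
    qed
    with neg show False by contradiction
  qed
  then obtain n where n: "emeasure lborel (S (2 / real (Suc n)) h) \<noteq> 0" ..
  define \<eta> where "\<eta> = 1 / real (Suc n)"
  have \<eta>: "0 < \<eta>" "emeasure lborel (S (2 * \<eta>) h) \<noteq> 0"
    using n by (simp_all add: \<eta>_def)
  define \<kappa> where "\<kappa> = measure lborel (S (2 * \<eta>) h)"
  have "emeasure lborel (S (2 * \<eta>) h) < \<infinity>"
    using emeasure_mono[of "S (2 * \<eta>) h" "cell c r" lborel] emeasure_cell_finite[of c r]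
    by (auto simp: S_def intro: le_less_trans)
  then have \<kappa>: "emeasure lborel (S (2 * \<eta>) h) = ennreal \<kappa>"
    by (simp add: \<kappa>_def emeasure_eq_ennreal_measure less_top[symmetric])
  with \<eta> have \<kappa>0: "0 < \<kappa>" by (metis ennreal_0 less_eq_real_def measure_nonneg \<kappa>_def)
  then have \<kappa>4: "0 < \<kappa> / 4" by simp
  define Bad where "Bad R k = {x \<in> cell c r. \<bar>u (x + R k) - u (x + R h)\<bar> > \<eta>}" for R k
  obtain dP where dP: "0 < dP" "\<And>k. norm (k - P h) < dP \<Longrightarrow>
      emeasure lborel {x \<in> cell c r. \<bar>u (x + k) - u (x + P h)\<bar> > \<eta>} \<le> ennreal (\<kappa> / 4)"
    by (rule translation_continuous_in_measure[OF u cell_borel bounded_cell \<eta>(1) \<kappa>4]) (rule that)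
  obtain dQ where dQ: "0 < dQ" "\<And>k. norm (k - Q h) < dQ \<Longrightarrow>
      emeasure lborel {x \<in> cell c r. \<bar>u (x + k) - u (x + Q h)\<bar> > \<eta>} \<le> ennreal (\<kappa> / 4)"
    by (rule translation_continuous_in_measure[OF u cell_borel bounded_cell \<eta>(1) \<kappa>4]) (rule that)
  show thesis
  proof (rule that)
    show "0 < \<eta> powr \<theta> * (\<kappa> / 2)" using \<eta> \<kappa>0 by simp
    show "0 < min dP dQ" using dP dQ by simp
    fix k assume k: "norm (k - h) < min dP dQ"
    have BP: "emeasure lborel (Bad P k) \<le> ennreal (\<kappa> / 4)"
      unfolding Bad_def using k norm_P_le[of "k - h"] by (intro dP) auto
    have BQ: "emeasure lborel (Bad Q k) \<le> ennreal (\<kappa> / 4)"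
      unfolding Bad_def using k norm_Q_le[of "k - h"] by (intro dQ) auto
    have [measurable]: "Bad P k \<in> sets borel" "Bad Q k \<in> sets borel"
      unfolding Bad_def by measurable
    have "S (2 * \<eta>) h \<subseteq> S \<eta> k \<union> (Bad P k \<union> Bad Q k)"
      unfolding S_def Bad_def by auto
    then have "ennreal \<kappa> \<le> emeasure lborel (S \<eta> k \<union> (Bad P k \<union> Bad Q k))"
      unfolding \<kappa>[symmetric] by (rule emeasure_mono) simp
    also have "\<dots> \<le> emeasure lborel (S \<eta> k) + (emeasure lborel (Bad P k) + emeasure lborel (Bad Q k))"
      by (intro order.trans[OF emeasure_subadditive] add_left_mono emeasure_subadditive) auto
    also have "\<dots> \<le> emeasure lborel (S \<eta> k) + (ennreal (\<kappa> / 4) + ennreal (\<kappa> / 4))"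
      by (intro add_left_mono add_mono BP BQ)
    also have "ennreal (\<kappa> / 4) + ennreal (\<kappa> / 4) = ennreal (\<kappa> / 2)"
      using \<kappa>0 by (subst ennreal_plus[symmetric]) auto
    finally have "ennreal \<kappa> - ennreal (\<kappa> / 2) \<le> emeasure lborel (S \<eta> k)"
      by (simp add: ennreal_minus_le_iff add.commute)
    moreover have "ennreal \<kappa> - ennreal (\<kappa> / 2) = ennreal (\<kappa> / 2)"
      using \<kappa>0 by (subst ennreal_minus) auto
    ultimately have S: "ennreal (\<kappa> / 2) \<le> emeasure lborel (S \<eta> k)" by simp
    have "ennreal (\<eta> powr \<theta> * (\<kappa> / 2)) = ennreal (\<eta> powr \<theta>) * ennreal (\<kappa> / 2)"
      by (rule ennreal_mult') simp
    also have "\<dots> \<le> ennreal (\<eta> powr \<theta>) * emeasure lborel (S \<eta> k)"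
      by (rule mult_left_mono[OF S]) simp
    also have "\<dots> = (\<integral>\<^sup>+x. ennreal (\<eta> powr \<theta>) * indicator (S \<eta> k) x \<partial>lborel)"
      by (simp add: nn_integral_cmult_indicator)
    also have "\<dots> \<le> (\<integral>\<^sup>+x\<in>cell c r. ennreal (min \<bar>u (x + P k) - u x\<bar> \<bar>u (x + Q k) - u x\<bar> powr \<theta>) \<partial>lborel)"
      using \<eta>(1) \<theta>
      by (intro nn_integral_mono) (auto simp: S_def indicator_def intro!: ennreal_leI powr_mono2)
    finally show "ennreal (\<eta> powr \<theta> * (\<kappa> / 2)) \<le>
      (\<integral>\<^sup>+x\<in>cell c r. ennreal (min \<bar>u (x + P k) - u x\<bar> \<bar>u (x + Q k) - u x\<bar> powr \<theta>) \<partial>lborel)" .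
  qed
qed

text \<open>
  The inner integral of the energy, restricted to \<open>D\<close>.
\<close>

definition weighted_energy :: "real \<Rightarrow> real \<Rightarrow> real \<Rightarrow> ('a \<Rightarrow> real) \<Rightarrow> 'a set \<Rightarrow> 'a \<Rightarrow> ennreal" where
  "weighted_energy \<alpha> \<beta> p u D z =
     (\<integral>\<^sup>+x\<in>D. ennreal (corner_product \<alpha> \<beta> u z x / norm z powr p) \<partial>lborel)"

lemma weighted_energy_eq:
  assumes [measurable]: "u \<in> borel_measurable borel" "D \<in> sets borel"
  shows "weighted_energy \<alpha> \<beta> p u D z = ennreal (1 / norm z powr p) * cell_energy \<alpha> \<beta> u D z"
proof -
  have "weighted_energy \<alpha> \<beta> p u D z =
      (\<integral>\<^sup>+x. ennreal (1 / norm z powr p) * (ennreal (corner_product \<alpha> \<beta> u z x) * indicator D x) \<partial>lborel)"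
    unfolding weighted_energy_def
    by (intro nn_integral_cong) (simp add: ennreal_mult[symmetric] mult.assoc[symmetric])
  then show ?thesis unfolding cell_energy_def by (simp add: nn_integral_cmult)
qed

lemma weighted_energy_measurable [measurable]:
  assumes [measurable]: "u \<in> borel_measurable borel" "D \<in> sets borel"
  shows "weighted_energy \<alpha> \<beta> p u D \<in> borel_measurable borel"
  unfolding weighted_energy_eq[OF assms, abs_def] by measurable

lemma cell_energy_eq_weighted:
  assumes "u \<in> borel_measurable borel" "D \<in> sets borel" "z \<noteq> 0"
  shows "cell_energy \<alpha> \<beta> u D z = ennreal (norm z powr p) * weighted_energy \<alpha> \<beta> p u D z"
  using assms(3) unfolding weighted_energy_eq[OF assms(1,2)] mult.assoc[symmetric]
  by (subst ennreal_mult[symmetric]) auto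

lemma kernel_integral_reflect:
  assumes [measurable]: "\<rho> \<in> borel_measurable borel" "J \<in> borel_measurable borel"
    and \<sigma>: "orthogonal_transformation \<sigma>" and inv: "AE z in lborel. \<rho> (\<sigma> z) = \<rho> z" and \<epsilon>: "0 < \<epsilon>"
  shows "(\<integral>\<^sup>+z. ennreal (rescaled_kernel \<rho> \<epsilon> z) * J (\<sigma> z) \<partial>lborel)
       = (\<integral>\<^sup>+z. ennreal (rescaled_kernel \<rho> \<epsilon> z) * J z \<partial>lborel)"
proof -
  have [measurable]: "rescaled_kernel \<rho> \<epsilon> \<in> borel_measurable borel"
    unfolding rescaled_kernel_def[abs_def] by measurable
  have ae: "AE z in lborel. rescaled_kernel \<rho> \<epsilon> (\<sigma> z) = rescaled_kernel \<rho> \<epsilon> z"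
    using AE_lborel_scale[OF inv \<epsilon>]
    by eventually_elim
      (simp add: rescaled_kernel_def linear_scale[OF orthogonal_transformation_linear[OF \<sigma>]])
  have "(\<integral>\<^sup>+z. ennreal (rescaled_kernel \<rho> \<epsilon> z) * J (\<sigma> z) \<partial>lborel)
      = (\<integral>\<^sup>+z. ennreal (rescaled_kernel \<rho> \<epsilon> (\<sigma> z)) * J (\<sigma> z) \<partial>lborel)"
    by (rule nn_integral_cong_AE) (use ae in \<open>eventually_elim, simp\<close>)
  also have "\<dots> = (\<integral>\<^sup>+z. ennreal (rescaled_kernel \<rho> \<epsilon> z) * J z \<partial>lborel)"
    by (rule nn_integral_lborel_orthogonal[OF \<sigma>]) measurable
  finally show ?thesis .
qed

text \<open>
  For small \<open>z\<close> in direction of \<open>h\<close>, the multiple \<open>m *\<^sub>R z\<close> with \<open>m = \<lfloor>norm h / norm z\<rfloor>\<close> is close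
  to \<open>h\<close>, so the grid estimate with step \<open>z\<close> bounds the energy of \<open>z\<close> from below. Since
  \<open>m \<le> norm h / norm z\<close>, the factor \<open>m powr critical_exponent \<alpha> \<beta>\<close> is absorbed by the weight
  \<open>norm z powr - p\<close>, and a positive power of \<open>\<epsilon>\<close> is left over.
\<close>

lemma weighted_energy_lower_bound:
  assumes \<alpha>: "0 < \<alpha>" and \<beta>: "0 < \<beta>" and p: "p > critical_exponent \<alpha> \<beta>"
    and u[measurable]: "u \<in> borel_measurable borel" and h: "h \<noteq> 0" "norm h < r"
    and neg: "\<not> (AE x in lborel. x \<in> cell c r \<longrightarrow> u (x + P h) = u x \<or> u (x + Q h) = u x)"
  obtains c0 B \<delta> \<epsilon>0 where "0 < c0" "0 \<le> B" "0 < \<delta>" "0 < \<epsilon>0"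
    "\<And>z \<epsilon>. z \<in> direction_cone h \<delta> \<Longrightarrow> norm z \<le> \<epsilon> \<Longrightarrow> \<epsilon> < \<epsilon>0 \<Longrightarrow>
      ennreal c0 \<le> ennreal (B * \<epsilon> powr (p - critical_exponent \<alpha> \<beta>)) *
        (weighted_energy \<alpha> \<beta> p u (cell c (2 * r)) z + weighted_energy \<alpha> \<beta> p u (cell c (2 * r)) (Q z - P z) +
         weighted_energy \<alpha> \<beta> p u (cell c (2 * r)) (P z - Q z) + weighted_energy \<alpha> \<beta> p u (cell c (2 * r)) (- z))"
proof -
  define q where "q = critical_exponent \<alpha> \<beta>"
  have q: "0 < q" "q < p" using critical_exponent_pos[OF \<alpha> \<beta>] p by (auto simp: q_def)
  obtain C where C: "C \<ge> 0" and upper: "\<And>z m. real m * norm z \<le> r \<Longrightarrow>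
    (\<integral>\<^sup>+x\<in>cell c r. ennreal (min \<bar>u (x + real m *\<^sub>R P z) - u x\<bar> \<bar>u (x + real m *\<^sub>R Q z) - u x\<bar> powr (\<alpha> + \<beta>)) \<partial>lborel)
    \<le> ennreal (C * real m powr q) *
        (cell_energy \<alpha> \<beta> u (cell c (2 * r)) z + cell_energy \<alpha> \<beta> u (cell c (2 * r)) (Q z - P z) +
         cell_energy \<alpha> \<beta> u (cell c (2 * r)) (P z - Q z) + cell_energy \<alpha> \<beta> u (cell c (2 * r)) (- z))"
  proof -
    obtain C where "C \<ge> 0" and "\<forall>u c r z m. u \<in> borel_measurable borel \<longrightarrow> real m * norm z \<le> r \<longrightarrow>
      (\<integral>\<^sup>+x\<in>cell c r. ennreal (min \<bar>u (x + real m *\<^sub>R P z) - u x\<bar> \<bar>u (x + real m *\<^sub>R Q z) - u x\<bar> powr (\<alpha> + \<beta>)) \<partial>lborel)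
      \<le> ennreal (C * real m powr critical_exponent \<alpha> \<beta>) *
        (cell_energy \<alpha> \<beta> u (cell c (2 * r)) z + cell_energy \<alpha> \<beta> u (cell c (2 * r)) (Q z - P z) +
         cell_energy \<alpha> \<beta> u (cell c (2 * r)) (P z - Q z) + cell_energy \<alpha> \<beta> u (cell c (2 * r)) (- z))"
      using min_increment_integral_le[OF \<alpha> \<beta>] by (elim exE conjE)
    then show thesis using u by (intro that[of C]) (simp_all add: q_def)
  qed
  obtain c0 d where c0: "0 < c0" and d: "0 < d" and lower: "\<And>k. norm (k - h) < d \<Longrightarrow>
       ennreal c0 \<le> (\<integral>\<^sup>+x\<in>cell c r. ennreal (min \<bar>u (x + P k) - u x\<bar> \<bar>u (x + Q k) - u x\<bar> powr (\<alpha> + \<beta>)) \<partial>lborel)"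
    by (rule min_increment_integral_lower_bound[OF u add_pos_pos[OF \<alpha> \<beta>] neg]) (rule that)
  define \<delta> where "\<delta> = d / (2 * norm h)"
  define B where "B = C * norm h powr q"
  show thesis
  proof (rule that[of c0 B \<delta> "d / 2"])
    show "0 < c0" "0 \<le> B" "0 < \<delta>" "0 < d / 2"
      using c0 C d h by (auto simp: B_def \<delta>_def)
    fix z \<epsilon> assume z: "z \<in> direction_cone h \<delta>" and z\<epsilon>: "norm z \<le> \<epsilon>" and \<epsilon>: "\<epsilon> < d / 2"
    define W where "W = weighted_energy \<alpha> \<beta> p u (cell c (2 * r)) z + weighted_energy \<alpha> \<beta> p u (cell c (2 * r)) (Q z - P z) +
         weighted_energy \<alpha> \<beta> p u (cell c (2 * r)) (P z - Q z) + weighted_energy \<alpha> \<beta> p u (cell c (2 * r)) (- z)"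
    have z0: "z \<noteq> 0" and dir: "norm (z /\<^sub>R norm z - h /\<^sub>R norm h) < \<delta>"
      using z by (auto simp: direction_cone_def)
    have norms: "norm (Q z - P z) = norm z" "norm (P z - Q z) = norm z"
      using orthogonal_transformation_norm[OF orthogonal_reflection]
        orthogonal_transformation_norm[OF orthogonal_reflection'] by auto
    then have ne: "Q z - P z \<noteq> 0" "P z - Q z \<noteq> 0" "- z \<noteq> 0" using z0 by auto
    \<comment> \<open>the number of steps of length \<open>norm z\<close> that fit into \<open>norm h\<close>\<close>
    define m where "m = nat \<lfloor>norm h / norm z\<rfloor>"
    have m: "real m \<le> norm h / norm z" "norm h / norm z - real m \<le> 1"
    proof -
      have "0 \<le> norm h / norm z" by simp
      then show "real m \<le> norm h / norm z" "norm h / norm z - real m \<le> 1"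
        unfolding m_def by linarith+
    qed
    have "real m * norm z \<le> norm h" using m(1) z0 by (simp add: field_simps)
    then have mz: "real m * norm z \<le> r" using h(2) by simp
    have "norm (real m *\<^sub>R z - h) < d"
    proof -
      have "real m *\<^sub>R z - h = (real m - norm h / norm z) *\<^sub>R z + norm h *\<^sub>R (z /\<^sub>R norm z - h /\<^sub>R norm h)"
        using z0 h by (simp add: algebra_simps divide_inverse)
      then have "norm (real m *\<^sub>R z - h) \<le> \<bar>real m - norm h / norm z\<bar> * norm z + norm h * norm (z /\<^sub>R norm z - h /\<^sub>R norm h)"
        by (metis norm_scaleR norm_triangle_ineq abs_norm_cancel)
      also have "\<dots> \<le> 1 * norm z + norm h * \<delta>"
        using m dir by (intro add_mono mult_mono) auto
      also have "norm h * \<delta> = d / 2" using h by (simp add: \<delta>_def)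
      finally show ?thesis using z\<epsilon> \<epsilon> by simp
    qed
    from lower[OF this]
    have "ennreal c0 \<le> (\<integral>\<^sup>+x\<in>cell c r. ennreal (min \<bar>u (x + real m *\<^sub>R P z) - u x\<bar> \<bar>u (x + real m *\<^sub>R Q z) - u x\<bar> powr (\<alpha> + \<beta>)) \<partial>lborel)"
      by (simp only: P_simps Q_simps)
    also have "\<dots> \<le> ennreal (C * real m powr q) *
        (cell_energy \<alpha> \<beta> u (cell c (2 * r)) z + cell_energy \<alpha> \<beta> u (cell c (2 * r)) (Q z - P z) +
         cell_energy \<alpha> \<beta> u (cell c (2 * r)) (P z - Q z) + cell_energy \<alpha> \<beta> u (cell c (2 * r)) (- z))"
      by (rule upper[OF mz])
    also have "\<dots> = ennreal (C * real m powr q) * (ennreal (norm z powr p) * W)"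
      unfolding W_def distrib_left
      by (simp only: cell_energy_eq_weighted[OF u cell_borel z0, of \<alpha> \<beta> c "2 * r" p]
          cell_energy_eq_weighted[OF u cell_borel ne(1), of \<alpha> \<beta> c "2 * r" p]
          cell_energy_eq_weighted[OF u cell_borel ne(2), of \<alpha> \<beta> c "2 * r" p]
          cell_energy_eq_weighted[OF u cell_borel ne(3), of \<alpha> \<beta> c "2 * r" p] norms norm_minus_cancel)
    also have "\<dots> = ennreal (C * real m powr q * norm z powr p) * W"
      using C by (simp add: ennreal_mult mult.assoc)
    also have "\<dots> \<le> ennreal (B * \<epsilon> powr (p - q)) * W"
    proof (intro mult_right_mono ennreal_leI)
      have "C * real m powr q * norm z powr p \<le> C * (norm h / norm z) powr q * norm z powr p"
        using C m q by (intro mult_right_mono mult_left_mono powr_mono2) auto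
      also have "\<dots> = B * norm z powr (p - q)"
        using z0 h by (simp add: B_def powr_divide powr_diff)
      also have "\<dots> \<le> B * \<epsilon> powr (p - q)"
        using \<open>0 \<le> B\<close> z\<epsilon> q by (intro mult_left_mono powr_mono2) auto
      finally show "C * real m powr q * norm z powr p \<le> B * \<epsilon> powr (p - q)" .
    qed simp
    finally show "ennreal c0 \<le> ennreal (B * \<epsilon> powr (p - critical_exponent \<alpha> \<beta>)) *
        (weighted_energy \<alpha> \<beta> p u (cell c (2 * r)) z + weighted_energy \<alpha> \<beta> p u (cell c (2 * r)) (Q z - P z) +
         weighted_energy \<alpha> \<beta> p u (cell c (2 * r)) (P z - Q z) + weighted_energy \<alpha> \<beta> p u (cell c (2 * r)) (- z))"
      unfolding W_def q_def .
  qed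
qed

text \<open>
  Integrating the lower bound over a cone against the rescaled kernel gives a fixed positive mass on
  one side and a multiple of \<open>\<epsilon> powr (p - critical_exponent \<alpha> \<beta>)\<close> on the other.
\<close>

proposition simultaneous_increments_vanish:
  assumes \<alpha>: "0 < \<alpha>" and \<beta>: "0 < \<beta>" and p: "p > critical_exponent \<alpha> \<beta>"
    and u[measurable]: "u \<in> borel_measurable borel"
    and \<rho>[measurable]: "\<rho> \<in> borel_measurable borel" and \<rho>0: "\<And>z. 0 \<le> \<rho> z"
    and supp: "AE z in lborel. 1 < norm z \<longrightarrow> \<rho> z = 0"
    and inv: "\<And>\<sigma>. orthogonal_transformation \<sigma> \<Longrightarrow> AE z in lborel. \<rho> (\<sigma> z) = \<rho> z"
    and cone: "\<And>h \<delta>. h \<noteq> 0 \<Longrightarrow> 0 < \<delta> \<Longrightarrow> \<not> (AE z in lborel. z \<in> direction_cone h \<delta> \<longrightarrow> \<rho> z = 0)"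
    and K: "K < \<infinity>" and energy: "\<exists>\<^sub>F \<epsilon> in at_right 0.
      (\<integral>\<^sup>+z. ennreal (rescaled_kernel \<rho> \<epsilon> z) * weighted_energy \<alpha> \<beta> p u (cell c (2 * r)) z \<partial>lborel) \<le> K"
    and h: "norm h < r"
  shows "AE x in lborel. x \<in> cell c r \<longrightarrow> u (x + P h) = u x \<or> u (x + Q h) = u x"
proof (cases "h = 0")
  case True
  then show ?thesis by simp
next
  case False
  define q where "q = critical_exponent \<alpha> \<beta>"
  define J where "J = weighted_energy \<alpha> \<beta> p u (cell c (2 * r))"
  have [measurable]: "J \<in> borel_measurable borel" unfolding J_def by measurable
  show ?thesis
  proof (rule ccontr)
    assume neg: "\<not> ?thesis"
    obtain c0 B \<delta> \<epsilon>0 where c0: "0 < c0" and B: "0 \<le> B" and \<delta>: "0 < \<delta>" and \<epsilon>0: "0 < \<epsilon>0"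
      and low: "\<And>z \<epsilon>. z \<in> direction_cone h \<delta> \<Longrightarrow> norm z \<le> \<epsilon> \<Longrightarrow> \<epsilon> < \<epsilon>0 \<Longrightarrow>
        ennreal c0 \<le> ennreal (B * \<epsilon> powr (p - q)) * (J z + J (Q z - P z) + J (P z - Q z) + J (- z))"
    proof (rule weighted_energy_lower_bound[OF \<alpha> \<beta> p u False h neg])
      fix c0 B \<delta> \<epsilon>0 :: real
      assume "0 < c0" "0 \<le> B" "0 < \<delta>" "0 < \<epsilon>0"
        "\<And>z \<epsilon>. z \<in> direction_cone h \<delta> \<Longrightarrow> norm z \<le> \<epsilon> \<Longrightarrow> \<epsilon> < \<epsilon>0 \<Longrightarrow>
      ennreal c0 \<le> ennreal (B * \<epsilon> powr (p - critical_exponent \<alpha> \<beta>)) *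
        (weighted_energy \<alpha> \<beta> p u (cell c (2 * r)) z + weighted_energy \<alpha> \<beta> p u (cell c (2 * r)) (Q z - P z) +
         weighted_energy \<alpha> \<beta> p u (cell c (2 * r)) (P z - Q z) + weighted_energy \<alpha> \<beta> p u (cell c (2 * r)) (- z))"
      then show thesis by (rule that[unfolded q_def J_def])
    qed
    define V where "V = direction_cone h \<delta>"
    have [measurable]: "V \<in> sets borel" by (simp add: V_def)
    define M where "M = (\<integral>\<^sup>+z\<in>V. ennreal (\<rho> z) \<partial>lborel)"
    have "M \<noteq> 0"
    proof
      assume "M = 0"
      then have "AE z in lborel. ennreal (\<rho> z) * indicator V z = 0"
        unfolding M_def by (subst (asm) nn_integral_0_iff_AE) auto
      then have "AE z in lborel. z \<in> direction_cone h \<delta> \<longrightarrow> \<rho> z = 0"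
      proof eventually_elim
        case (elim z)
        then show ?case using \<rho>0[of z] by (auto simp: V_def indicator_def split: if_splits)
      qed
      with cone[OF False \<delta>] show False by contradiction
    qed
    obtain k where k: "0 \<le> k" "K = ennreal k" using K by (cases K) auto
    have bound: "ennreal c0 * M \<le> ennreal (4 * B * k * \<epsilon> powr (p - q))"
      if \<epsilon>: "0 < \<epsilon>" "\<epsilon> < \<epsilon>0" and
        E: "(\<integral>\<^sup>+z. ennreal (rescaled_kernel \<rho> \<epsilon> z) * J z \<partial>lborel) \<le> K" for \<epsilon>
    proof -
      define \<rho>\<epsilon> where "\<rho>\<epsilon> z = ennreal (rescaled_kernel \<rho> \<epsilon> z)" for z
      have [measurable]: "\<rho>\<epsilon> \<in> borel_measurable borel"
        unfolding \<rho>\<epsilon>_def[abs_def] rescaled_kernel_def[abs_def] by measurable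
      have "M = (\<integral>\<^sup>+z. ennreal (\<rho> (z /\<^sub>R \<epsilon>)) * indicator V (z /\<^sub>R \<epsilon>) * ennreal (1 / \<epsilon> ^ DIM('a)) \<partial>lborel)"
        unfolding M_def using \<epsilon>(1)
        by (subst nn_integral_lborel_scale[of "\<lambda>z. ennreal (\<rho> z) * indicator V z"]) auto
      also have "\<dots> = (\<integral>\<^sup>+z. \<rho>\<epsilon> z * indicator V z \<partial>lborel)"
      proof (rule nn_integral_cong)
        fix z
        have "indicator V (z /\<^sub>R \<epsilon>) = (indicator V z :: ennreal)"
          unfolding V_def indicator_def by (simp only: direction_cone_scale[OF \<epsilon>(1)])
        then show "ennreal (\<rho> (z /\<^sub>R \<epsilon>)) * indicator V (z /\<^sub>R \<epsilon>) * ennreal (1 / \<epsilon> ^ DIM('a)) = \<rho>\<epsilon> z * indicator V z"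
          using \<epsilon>(1) \<rho>0 by (simp add: \<rho>\<epsilon>_def rescaled_kernel_def ennreal_mult[symmetric] indicator_def)
      qed
      finally have M: "M = (\<integral>\<^sup>+z. \<rho>\<epsilon> z * indicator V z \<partial>lborel)" .
      have "ennreal c0 * M = (\<integral>\<^sup>+z. ennreal c0 * (\<rho>\<epsilon> z * indicator V z) \<partial>lborel)"
        unfolding M by (rule nn_integral_cmult[symmetric]) measurable
      also have "\<dots> \<le> (\<integral>\<^sup>+z. ennreal (B * \<epsilon> powr (p - q)) *
          (\<rho>\<epsilon> z * J z + \<rho>\<epsilon> z * J (Q z - P z) + \<rho>\<epsilon> z * J (P z - Q z) + \<rho>\<epsilon> z * J (- z)) \<partial>lborel)"
      proof (rule nn_integral_mono_AE)
        show "AE z in lborel. ennreal c0 * (\<rho>\<epsilon> z * indicator V z) \<le> ennreal (B * \<epsilon> powr (p - q)) *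
          (\<rho>\<epsilon> z * J z + \<rho>\<epsilon> z * J (Q z - P z) + \<rho>\<epsilon> z * J (P z - Q z) + \<rho>\<epsilon> z * J (- z))"
          using AE_lborel_scale[OF supp \<epsilon>(1)]
        proof eventually_elim
          case (elim z)
          show ?case
          proof (cases "z \<in> V \<and> norm z \<le> \<epsilon>")
            case True
            then have "ennreal c0 * (\<rho>\<epsilon> z * indicator V z) = \<rho>\<epsilon> z * ennreal c0" by (simp add: mult.commute)
            also have "\<dots> \<le> \<rho>\<epsilon> z * (ennreal (B * \<epsilon> powr (p - q)) * (J z + J (Q z - P z) + J (P z - Q z) + J (- z)))"
              using True \<epsilon> by (intro mult_left_mono low) (auto simp: V_def)
            also have "\<dots> = ennreal (B * \<epsilon> powr (p - q)) *
              (\<rho>\<epsilon> z * J z + \<rho>\<epsilon> z * J (Q z - P z) + \<rho>\<epsilon> z * J (P z - Q z) + \<rho>\<epsilon> z * J (- z))"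
              by (simp only: distrib_left mult.left_commute)
            finally show ?thesis .
          next
            case False
            have "1 < norm (z /\<^sub>R \<epsilon>)" if "\<not> norm z \<le> \<epsilon>"
              using that \<epsilon>(1) by (simp add: field_simps)
            with False elim have "\<rho>\<epsilon> z * indicator V z = 0"
              by (auto simp: \<rho>\<epsilon>_def rescaled_kernel_def indicator_def)
            then have "ennreal c0 * (\<rho>\<epsilon> z * indicator V z) = 0" by (simp only: mult_zero_right)
            then show ?thesis by (simp only: zero_le)
          qed
        qed
      qed
      also have "\<dots> = ennreal (B * \<epsilon> powr (p - q)) *
          ((\<integral>\<^sup>+z. \<rho>\<epsilon> z * J z \<partial>lborel) + (\<integral>\<^sup>+z. \<rho>\<epsilon> z * J (Q z - P z) \<partial>lborel) +
           (\<integral>\<^sup>+z. \<rho>\<epsilon> z * J (P z - Q z) \<partial>lborel) + (\<integral>\<^sup>+z. \<rho>\<epsilon> z * J (- z) \<partial>lborel))"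
        by (simp add: nn_integral_cmult nn_integral_add)
      also have "(\<integral>\<^sup>+z. \<rho>\<epsilon> z * J (Q z - P z) \<partial>lborel) = (\<integral>\<^sup>+z. \<rho>\<epsilon> z * J z \<partial>lborel)"
        unfolding \<rho>\<epsilon>_def by (rule kernel_integral_reflect[OF _ _ orthogonal_reflection']) (use inv[OF orthogonal_reflection'] \<epsilon> in auto)
      also have "(\<integral>\<^sup>+z. \<rho>\<epsilon> z * J (P z - Q z) \<partial>lborel) = (\<integral>\<^sup>+z. \<rho>\<epsilon> z * J z \<partial>lborel)"
        unfolding \<rho>\<epsilon>_def by (rule kernel_integral_reflect[OF _ _ orthogonal_reflection]) (use inv[OF orthogonal_reflection] \<epsilon> in auto)
      also have "(\<integral>\<^sup>+z. \<rho>\<epsilon> z * J (- z) \<partial>lborel) = (\<integral>\<^sup>+z. \<rho>\<epsilon> z * J z \<partial>lborel)"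
      proof -
        have "orthogonal_transformation (uminus :: 'a \<Rightarrow> 'a)"
          by (simp add: orthogonal_transformation linear_uminus)
        from kernel_integral_reflect[OF _ _ this inv[OF this] \<epsilon>(1)] show ?thesis
          unfolding \<rho>\<epsilon>_def by simp
      qed
      also have "ennreal (B * \<epsilon> powr (p - q)) *
          ((\<integral>\<^sup>+z. \<rho>\<epsilon> z * J z \<partial>lborel) + (\<integral>\<^sup>+z. \<rho>\<epsilon> z * J z \<partial>lborel) +
           (\<integral>\<^sup>+z. \<rho>\<epsilon> z * J z \<partial>lborel) + (\<integral>\<^sup>+z. \<rho>\<epsilon> z * J z \<partial>lborel))
          \<le> ennreal (B * \<epsilon> powr (p - q)) * (K + K + K + K)"
        using E unfolding \<rho>\<epsilon>_def by (intro mult_left_mono add_mono) auto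
      also have "\<dots> = ennreal (4 * B * k * \<epsilon> powr (p - q))"
        using k B by (simp add: ennreal_mult[symmetric] ennreal_plus[symmetric] mult_ac del: ennreal_plus)
      finally show ?thesis .
    qed
    have "((\<lambda>\<epsilon>. ennreal (4 * B * k * \<epsilon> powr (p - q))) \<longlongrightarrow> ennreal (4 * B * k * 0)) (at_right 0)"
    proof (intro tendsto_ennrealI tendsto_mult tendsto_const)
      show "((\<lambda>\<epsilon>. \<epsilon> powr (p - q)) \<longlongrightarrow> 0) (at_right 0)"
      proof (rule tendsto_zero_powrI)
        show "((\<lambda>\<epsilon>::real. \<epsilon>) \<longlongrightarrow> 0) (at_right 0)" by (rule tendsto_ident_at)
        show "((\<lambda>\<epsilon>::real. p - q) \<longlongrightarrow> p - q) (at_right 0)" by simp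
        show "\<forall>\<^sub>F \<epsilon>::real in at_right 0. 0 \<le> \<epsilon>"
          by (auto simp: eventually_at_right_field intro: exI[of _ 1])
      qed (use p in \<open>simp add: q_def\<close>)
    qed
    moreover have "ennreal (4 * B * k * 0) < ennreal c0 * M"
      using c0 \<open>M \<noteq> 0\<close> by (simp add: ennreal_zero_less_mult_iff zero_less_iff_neq_zero)
    ultimately have "\<forall>\<^sub>F \<epsilon> in at_right 0. ennreal (4 * B * k * \<epsilon> powr (p - q)) < ennreal c0 * M"
      by (rule order_tendstoD)
    moreover have "\<forall>\<^sub>F \<epsilon> in at_right 0. 0 < \<epsilon> \<and> \<epsilon> < \<epsilon>0"
      using \<epsilon>0 by (auto simp: eventually_at_right_field intro: exI[of _ \<epsilon>0])
    ultimately have "\<exists>\<^sub>F \<epsilon> in at_right (0::real). False"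
    proof (intro frequently_rev_mp[OF energy], eventually_elim)
      case (elim \<epsilon>)
      then show ?case using bound[of \<epsilon>] unfolding J_def by (auto dest: leD)
    qed
    then show False by simp
  qed
qed

end

context orthogonal_projections
begin

section \<open>From simultaneous increments to functions of one variable\<close>

text \<open>
  With \<open>R = P\<close>, the function \<open>u\<close> does not depend on the first variable in the cell; with \<open>R = Q\<close>, it
  does not depend on the second one.
\<close>

definition shift_invariant :: "('a \<Rightarrow> 'a) \<Rightarrow> ('a \<Rightarrow> real) \<Rightarrow> 'a \<Rightarrow> real \<Rightarrow> bool" where
  "shift_invariant R u c s \<longleftrightarrow>
     (\<forall>h. norm (R h) < s \<longrightarrow> (AE x in lborel. x \<in> cell c s \<longrightarrow> u (x + R h) = u x))"

lemma shift_invariant_swap: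
  "orthogonal_projections.shift_invariant Q P R u c s \<longleftrightarrow> shift_invariant R u c s"
  unfolding orthogonal_projections.shift_invariant_def[OF swap] shift_invariant_def cell_swap ..

lemma shift_invariantD:
  assumes "shift_invariant R u c s" "norm (R h) < s"
  shows "AE x in lborel. t + x \<in> cell c s \<longrightarrow> u (t + x + R h) = u (t + x)"
  using assms AE_lborel_translate[of "\<lambda>x. x \<in> cell c s \<longrightarrow> u (x + R h) = u x" t]
  unfolding shift_invariant_def by blast

lemma range_P_simps: "y \<in> range P \<Longrightarrow> P y = y" "y \<in> range P \<Longrightarrow> Q y = 0"
  and range_Q_simps: "y \<in> range Q \<Longrightarrow> Q y = y" "y \<in> range Q \<Longrightarrow> P y = 0"
  by auto

text \<open>
  Suppose that some increment along \<open>P h\<close> is nonzero on a set \<open>A\<close> of positive measure, and some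
  increment along \<open>Q k\<close> on a set \<open>B\<close>. Comparing the corners of squares shows that the first
  property is invariant under shifts in \<open>range Q\<close> and the second under shifts in \<open>range P\<close>. As some
  translate of \<open>A\<close> meets \<open>B\<close>, both hold simultaneously on a set of positive measure.
\<close>

lemma local_dichotomy:
  assumes u[measurable]: "u \<in> borel_measurable borel" and R: "0 < R"
    and pair: "\<And>h. norm h < R \<Longrightarrow> AE x in lborel. x \<in> cell c R \<longrightarrow> u (x + P h) = u x \<or> u (x + Q h) = u x"
  shows "\<exists>s>0. shift_invariant P u c s \<or> shift_invariant Q u c s"
proof (rule ccontr)
  assume neg: "\<not> ?thesis"
  \<comment> \<open>small enough that all points compared below stay in the cell of radius \<open>R\<close>\<close>
  define s where "s = R / 8"
  have s: "0 < s" "8 * s = R" using R by (auto simp: s_def)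
  with neg have "\<not> shift_invariant P u c s" "\<not> shift_invariant Q u c s" by auto
  then obtain h k where h: "norm (P h) < s" "\<not> (AE x in lborel. x \<in> cell c s \<longrightarrow> u (x + P h) = u x)"
    and k: "norm (Q k) < s" "\<not> (AE x in lborel. x \<in> cell c s \<longrightarrow> u (x + Q k) = u x)"
    unfolding shift_invariant_def by blast
  have pair': "AE x in lborel. t + x \<in> cell c R \<longrightarrow> u (t + x + P a) = u (t + x) \<or> u (t + x + Q b) = u (t + x)"
    if "norm (P a) + norm (Q b) < R" for t a b
  proof -
    have "norm (P a + Q b) < R" using that norm_triangle_ineq[of "P a" "Q b"] by linarith
    from AE_lborel_translate[OF pair[OF this], of t] show ?thesis by simp
  qed
  define A where "A = {x \<in> cell c s. u (x + P h) \<noteq> u x}"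
  define B where "B = {x \<in> cell c s. u (x + Q k) \<noteq> u x}"
  have AB[measurable]: "A \<in> sets borel" "B \<in> sets borel" unfolding A_def B_def by measurable
  have nA: "\<not> (AE x in lborel. x \<notin> A)" using h(2) by (simp add: A_def)
  have nB: "\<not> (AE x in lborel. x \<notin> B)" using k(2) by (simp add: B_def)
  obtain d where d: "\<not> (AE x in lborel. \<not> (x \<in> A \<and> x + d \<in> B))"
    by (rule ex_translate_meets[OF AB nA nB])
  have "\<exists>x. x \<in> A \<and> x + d \<in> B"
    using d by (rule contrapos_np) simp
  then obtain x0 where "x0 \<in> A" "x0 + d \<in> B" by blast
  then have x0: "x0 \<in> cell c s" "x0 + d \<in> cell c s" by (auto simp: A_def B_def)
  have dP: "norm (P d) < 2 * s"
    using x0 norm_triangle_ineq4[of "P (x0 + d - c)" "P (x0 - c)"] by (auto simp: cell_def)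
  have dQ: "norm (Q d) < 2 * s"
    using x0 norm_triangle_ineq4[of "Q (x0 + d - c)" "Q (x0 - c)"] by (auto simp: cell_def)
  have n: "norm (P h) + norm (Q d) < R" "norm (P (- h)) + norm (Q d) < R"
    "norm (P (- d)) + norm (Q k) < R" "norm (P (- d)) + norm (Q (- k)) < R"
    "norm (P h) + norm (Q k) < R"
    using h(1) k(1) dP dQ s by auto
  have "AE x in lborel. \<not> (x \<in> A \<and> x + d \<in> B)"
    using pair'[OF n(1), of 0] pair'[OF n(2), of "P h"] pair'[OF n(3), of d]
      pair'[OF n(4), of "d + Q k"] pair'[OF n(5), of "Q d"]
  proof eventually_elim
    case (elim x)
    show ?case
    proof
      assume x: "x \<in> A \<and> x + d \<in> B"
      then have xc: "x \<in> cell c s" "x + d \<in> cell c s" by (auto simp: A_def B_def)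
      have in_R: "w \<in> cell c R" if "x \<in> cell c s" "w = x + a" "norm (P a) \<le> 7 * s" "norm (Q a) \<le> 7 * s" for w a
        using cell_translate[OF that(1,3,4)] that(2) s by simp
      have nQ: "norm (Q d + Q k) \<le> 3 * s" using dQ k(1) norm_triangle_ineq[of "Q d" "Q k"] by linarith
      have "0 + x \<in> cell c R"
        by (rule in_R[OF xc(1), of _ "0"]) (use s h(1) k(1) dP dQ nQ in \<open>auto simp: add.commute\<close>)
      moreover have "P h + x \<in> cell c R"
        by (rule in_R[OF xc(1), of _ "P h"]) (use s h(1) k(1) dP dQ nQ in \<open>auto simp: add.commute\<close>)
      moreover have "d + x \<in> cell c R"
        by (rule in_R[OF xc(1), of _ "d"]) (use s h(1) k(1) dP dQ nQ in \<open>auto simp: add.commute\<close>)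
      moreover have "d + Q k + x \<in> cell c R"
        by (rule in_R[OF xc(1), of _ "d + Q k"]) (use s h(1) k(1) dP dQ nQ in \<open>auto simp: add.commute\<close>)
      moreover have "Q d + x \<in> cell c R"
        by (rule in_R[OF xc(1), of _ "Q d"]) (use s h(1) k(1) dP dQ nQ in \<open>auto simp: add.commute\<close>)
      ultimately have cells: "0 + x \<in> cell c R" "P h + x \<in> cell c R" "d + x \<in> cell c R"
        "d + Q k + x \<in> cell c R" "Q d + x \<in> cell c R" by blast+
      have eqs: "u (x + Q d) = u x" "u (x + P h + Q d) = u (x + P h)"
        using elim(1,2) cells(1,2) x by (auto simp: A_def add_ac)
      have "d - P d = Q d" using P_plus_Q[of d] by (metis add_diff_cancel_left')
      then have shift: "d + x + P (- d) = x + Q d" "d + Q k + x + P (- d) = x + Q d + Q k"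
        by (simp_all add: algebra_simps)
      have "u (x + Q d) = u (x + d)"
        using elim(3)[unfolded shift(1)] cells(3) x by (auto simp: B_def add_ac)
      moreover have "u (x + Q d + Q k) = u (x + d + Q k)"
        using elim(4)[unfolded shift(2)] cells(4) x by (auto simp: B_def add_ac)
      moreover have "u (x + d + Q k) \<noteq> u (x + d)" using x by (simp add: B_def)
      ultimately have "u (x + Q d + Q k) \<noteq> u (x + Q d)" by simp
      moreover have "u (x + Q d + P h) \<noteq> u (x + Q d)"
        using eqs x by (auto simp: A_def add_ac)
      ultimately show False using elim(5) cells(5) by (auto simp: add_ac)
    qed
  qed
  with d show False by contradiction
qed

text \<open>
  If \<open>u\<close> depends on the first variable near \<open>a + b\<close>, then near each such point it does not depend on
  the second one; hence the dependence on the first variable is passed on from \<open>b\<close> to all nearby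
  points, and by connectedness to all of \<open>\<Omega>2\<close>.
\<close>

lemma not_P_invariant_along_Q:
  assumes conn: "connected \<Omega>2" and sub: "\<Omega>2 \<subseteq> range Q" and a: "a \<in> range P"
    and loc: "\<And>b. b \<in> \<Omega>2 \<Longrightarrow> \<exists>s>0. shift_invariant P u (a + b) s \<or> shift_invariant Q u (a + b) s"
    and b: "b \<in> \<Omega>2" "b' \<in> \<Omega>2"
    and neg: "\<not> (\<exists>s>0. shift_invariant P u (a + b) s)"
  shows "\<not> (\<exists>s>0. shift_invariant P u (a + b') s)"
proof (rule connected_induction_simple[OF conn b, where P = "\<lambda>b. \<not> (\<exists>s>0. shift_invariant P u (a + b) s)"])
  show "\<not> (\<exists>s>0. shift_invariant P u (a + b) s)" by (fact neg)
  fix b0 assume b0: "b0 \<in> \<Omega>2"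
  then obtain r where r: "0 < r" "shift_invariant P u (a + b0) r \<or> shift_invariant Q u (a + b0) r"
    using loc by blast
  define T where "T = \<Omega>2 \<inter> ball b0 (r / 4)"
  have fixQ: "Q y = y" "P y = 0" if "y \<in> \<Omega>2" for y
    using range_Q_simps that sub by blast+
  have near: "norm (y - b0) < r / 4" if "y \<in> T" for y
    using that by (auto simp: T_def dist_norm norm_minus_commute)
  have incl: "cell (a + y) (r / 2) \<subseteq> cell (a + b0) r" if y: "y \<in> T" for y
  proof
    fix x assume "x \<in> cell (a + y) (r / 2)"
    moreover have "y \<in> \<Omega>2" using y by (simp add: T_def)
    moreover have "x - (a + b0) = (x - (a + y)) + (y - b0)" by simp
    ultimately show "x \<in> cell (a + b0) r"
      using near[OF y] r(1) norm_triangle_ineq[of "Q (x - (a + y))" "y - b0"] fixQ[of y] fixQ[OF b0]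
      by (auto simp: cell_def algebra_simps)
  qed
  have trans: "\<not> (\<exists>s>0. shift_invariant P u (a + y) s)"
    if y: "y \<in> T" "y' \<in> T" and ny: "\<not> (\<exists>s>0. shift_invariant P u (a + y') s)" for y y'
  proof
    assume "\<exists>s>0. shift_invariant P u (a + y) s"
    then obtain s where s: "0 < s" "shift_invariant P u (a + y) s" by blast
    consider "shift_invariant P u (a + b0) r" | "shift_invariant Q u (a + b0) r" using r by blast
    then show False
    proof cases
      case 1
      have "shift_invariant P u (a + y') (r / 2)"
        unfolding shift_invariant_def
      proof (intro allI impI)
        fix h assume "norm (P h) < r / 2"
        then have "norm (P h) < r" using r by simp
        from shift_invariantD[OF 1 this, of 0] show "AE x in lborel. x \<in> cell (a + y') (r / 2) \<longrightarrow> u (x + P h) = u x"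
          by eventually_elim (use incl[OF y(2)] in auto)
      qed
      with ny r(1) show False by (meson half_gt_zero)
    next
      case 2
      define s' where "s' = min s (r / 4)"
      define k where "k = y - y'"
      have k: "Q k = k" "P k = 0" using y fixQ by (auto simp: k_def T_def)
      have "norm k < r" using near[OF y(1)] near[OF y(2)] norm_triangle_ineq4[of "y - b0" "y' - b0"] r
        by (auto simp: k_def)
      then have nk: "norm (Q k) < r" by (simp add: k)
      have "shift_invariant P u (a + y') s'"
        unfolding shift_invariant_def
      proof (intro allI impI)
        fix h assume h: "norm (P h) < s'"
        then have "norm (P h) < s" by (simp add: s'_def)
        from shift_invariantD[OF s(2) this, of k] shift_invariantD[OF 2 nk, of 0] shift_invariantD[OF 2 nk, of "P h"]
        show "AE x in lborel. x \<in> cell (a + y') s' \<longrightarrow> u (x + P h) = u x"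
        proof eventually_elim
          case (elim x)
          show ?case
          proof
            assume x: "x \<in> cell (a + y') s'"
            have "s' \<le> r / 4" by (simp add: s'_def)
            from cell_mono[OF this] x have "x \<in> cell (a + y') (r / 4)" by blast
            from cell_translate[OF this, of "P h" "r / 4"] h r
            have "x + P h \<in> cell (a + y') (r / 2)" by (auto simp: s'_def)
            then have 1: "P h + x \<in> cell (a + b0) r" using incl[OF y(2)] by (auto simp: add.commute)
            have 2: "0 + x \<in> cell (a + b0) r"
              using incl[OF y(2)] \<open>x \<in> cell (a + y') (r / 4)\<close> cell_mono[of "r / 4" "r / 2"] r by auto
            have eq: "k + x - (a + y) = x - (a + y')" by (simp add: k_def)
            have "s' \<le> s" by (simp add: s'_def)
            from cell_mono[OF this] x have "x \<in> cell (a + y') s" by blast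
            then have 3: "k + x \<in> cell (a + y) s"
              unfolding cell_def mem_Collect_eq eq .
            show "u (x + P h) = u x"
              using elim 1 2 3 by (simp add: k add_ac)
          qed
        qed
      qed
      moreover have "0 < s'" using s r by (simp add: s'_def)
      ultimately show False using ny by blast
    qed
  qed
  show "\<exists>T. openin (top_of_set \<Omega>2) T \<and> b0 \<in> T \<and> (\<forall>x\<in>T. \<forall>y\<in>T.
      \<not> (\<exists>s>0. shift_invariant P u (a + x) s) \<longrightarrow> \<not> (\<exists>s>0. shift_invariant P u (a + y) s))"
  proof (intro exI[of _ T] conjI ballI impI)
    show "openin (top_of_set \<Omega>2) T" by (simp add: T_def openin_open_Int)
    show "b0 \<in> T" using b0 r by (simp add: T_def)
  qed (use trans in blast)
qed

lemma global_dichotomy: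
  assumes "connected \<Omega>1" "\<Omega>1 \<subseteq> range P" "connected \<Omega>2" "\<Omega>2 \<subseteq> range Q"
    and loc: "\<And>a b. a \<in> \<Omega>1 \<Longrightarrow> b \<in> \<Omega>2 \<Longrightarrow> \<exists>s>0. shift_invariant P u (a + b) s \<or> shift_invariant Q u (a + b) s"
  shows "(\<forall>a\<in>\<Omega>1. \<forall>b\<in>\<Omega>2. \<exists>s>0. shift_invariant P u (a + b) s) \<or>
         (\<forall>a\<in>\<Omega>1. \<forall>b\<in>\<Omega>2. \<exists>s>0. shift_invariant Q u (a + b) s)"
proof (rule ccontr)
  assume "\<not> ?thesis"
  then obtain a b a' b' where ab: "a \<in> \<Omega>1" "b \<in> \<Omega>2" "a' \<in> \<Omega>1" "b' \<in> \<Omega>2"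
    and n1: "\<not> (\<exists>s>0. shift_invariant P u (a + b) s)"
    and n2: "\<not> (\<exists>s>0. shift_invariant Q u (a' + b') s)" by blast
  have 1: "\<not> (\<exists>s>0. shift_invariant P u (a + b') s)"
    using not_P_invariant_along_Q[OF assms(3,4) _ loc ab(2,4) n1] ab assms(2) by blast
  have 2: "\<not> (\<exists>s>0. shift_invariant Q u (a + b') s)"
    using orthogonal_projections.not_P_invariant_along_Q[OF swap assms(1,2), of b' u a' a,
        unfolded shift_invariant_swap] loc ab n2 assms(4)
    by (simp add: add.commute disj_commute subset_iff)
  from loc[OF ab(1,4)] 1 2 show False by blast
qed

text \<open>
  Independence of the second variable is continued from \<open>b\<close> to \<open>b0\<close> with a loss of the radius only:
  the relation between two points that \<open>u\<close> is invariant under the translation from a neighbourhood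
  of one to a neighbourhood of the other is an equivalence relation with open classes.
\<close>

lemma translate_along_Q:
  assumes conn: "connected \<Omega>2" and sub: "\<Omega>2 \<subseteq> range Q"
    and inv: "\<And>b. b \<in> \<Omega>2 \<Longrightarrow> \<exists>s>0. shift_invariant Q u (a + b) s"
    and b: "b \<in> \<Omega>2" "b0 \<in> \<Omega>2"
  shows "\<exists>s>0. AE x in lborel. x \<in> cell (a + b) s \<longrightarrow> u (x + (b0 - b)) = u x"
proof (rule connected_equivalence_relation[OF conn b, where
      R = "\<lambda>b b'. \<exists>s>0. AE x in lborel. x \<in> cell (a + b) s \<longrightarrow> u (x + (b' - b)) = u x"])
  have cell_shift: "(y - x) + w \<in> cell (a + y) s \<longleftrightarrow> w \<in> cell (a + x) s" for x y w s
    by (simp add: cell_def algebra_simps)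
  show "\<exists>s>0. AE w in lborel. w \<in> cell (a + y) s \<longrightarrow> u (w + (x - y)) = u w"
    if "\<exists>s>0. AE w in lborel. w \<in> cell (a + x) s \<longrightarrow> u (w + (y - x)) = u w" for x y
  proof -
    from that obtain s where "0 < s" and ae: "AE w in lborel. w \<in> cell (a + x) s \<longrightarrow> u (w + (y - x)) = u w"
      by blast
    moreover from AE_lborel_translate[OF ae, of "x - y"]
    have "AE w in lborel. w \<in> cell (a + y) s \<longrightarrow> u (w + (x - y)) = u w"
      unfolding cell_shift by eventually_elim (simp add: algebra_simps)
    ultimately show ?thesis by blast
  qed
  show "\<exists>s>0. AE w in lborel. w \<in> cell (a + x) s \<longrightarrow> u (w + (z - x)) = u w"
    if xy: "\<exists>s>0. AE w in lborel. w \<in> cell (a + x) s \<longrightarrow> u (w + (y - x)) = u w"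
      and yz: "\<exists>s>0. AE w in lborel. w \<in> cell (a + y) s \<longrightarrow> u (w + (z - y)) = u w" for x y z
  proof -
    from xy obtain s where s: "0 < s" "AE w in lborel. w \<in> cell (a + x) s \<longrightarrow> u (w + (y - x)) = u w"
      by blast
    from yz obtain t where t: "0 < t" "AE w in lborel. w \<in> cell (a + y) t \<longrightarrow> u (w + (z - y)) = u w"
      by blast
    have "AE w in lborel. w \<in> cell (a + x) t \<longrightarrow> u ((y - x) + w + (z - y)) = u ((y - x) + w)"
      using AE_lborel_translate[OF t(2), of "y - x"] unfolding cell_shift .
    with s(2) have "AE w in lborel. w \<in> cell (a + x) (min s t) \<longrightarrow> u (w + (z - x)) = u w"
    proof eventually_elim
      case (elim w)
      then show ?case using cell_mono[of "min s t" s "a + x"] cell_mono[of "min s t" t "a + x"]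
        by (auto simp: algebra_simps)
    qed
    then show ?thesis using s(1) t(1) by (intro exI[of _ "min s t"]) simp
  qed
  fix x assume x: "x \<in> \<Omega>2"
  then obtain s where s: "0 < s" "shift_invariant Q u (a + x) s" using inv by blast
  show "\<exists>T. openin (top_of_set \<Omega>2) T \<and> x \<in> T \<and>
     (\<forall>y\<in>T. \<exists>s>0. AE w in lborel. w \<in> cell (a + x) s \<longrightarrow> u (w + (y - x)) = u w)"
  proof (intro exI[of _ "\<Omega>2 \<inter> ball x s"] conjI ballI)
    show "openin (top_of_set \<Omega>2) (\<Omega>2 \<inter> ball x s)" by (simp add: openin_open_Int)
    show "x \<in> \<Omega>2 \<inter> ball x s" using x s by simp
    fix y assume y: "y \<in> \<Omega>2 \<inter> ball x s"
    have "Q x = x" "Q y = y" using sub x y range_Q_simps(1) by blast+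
    then have Qyx: "Q (y - x) = y - x" by simp
    moreover have "norm (Q (y - x)) < s"
      using y unfolding Qyx by (simp add: dist_norm norm_minus_commute)
    ultimately have "AE w in lborel. w \<in> cell (a + x) s \<longrightarrow> u (w + (y - x)) = u w"
      using shift_invariantD[OF s(2), of "y - x" 0] by simp
    with s(1) show "\<exists>s>0. AE w in lborel. w \<in> cell (a + x) s \<longrightarrow> u (w + (y - x)) = u w" by blast
  qed
qed

text \<open>
  A Borel function of the first variable only: the limit of the averages of \<open>u (P x + Q y)\<close> over
  \<open>y\<close> in smaller and smaller balls around \<open>b\<close>. The arc tangent makes the integrand bounded; where
  the limit does not exist, the value is arbitrary.
\<close>

definition fibre_average :: "('a \<Rightarrow> real) \<Rightarrow> 'a \<Rightarrow> nat \<Rightarrow> 'a \<Rightarrow> real" where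
  "fibre_average u b n x =
     (LINT y|lborel. indicator (ball b (1 / real (Suc n))) y * arctan (u (P x + Q y))) /
       measure lborel (ball b (1 / real (Suc n)))"

definition fibre_value :: "('a \<Rightarrow> real) \<Rightarrow> 'a \<Rightarrow> 'a \<Rightarrow> real" where
  "fibre_value u b x = tan (lim (\<lambda>n. fibre_average u b n x))"

lemma fibre_value_P: "fibre_value u b (P x) = fibre_value u b x"
  by (simp add: fibre_value_def fibre_average_def)

lemma fibre_value_measurable:
  assumes [measurable]: "u \<in> borel_measurable borel"
  shows "fibre_value u b \<in> borel_measurable borel"
proof -
  have [measurable]: "ball b r \<in> sets borel" for r by simp
  have "fibre_average u b n \<in> borel_measurable borel" for n
    unfolding fibre_average_def[abs_def]
  proof (intro borel_measurable_divide borel_measurable_const lborel.borel_measurable_lebesgue_integral)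
    show "(\<lambda>(x, y). indicator (ball b (1 / real (Suc n))) y * arctan (u (P x + Q y)))
        \<in> borel_measurable (borel \<Otimes>\<^sub>M lborel)"
      unfolding measurable_cong_sets[OF sets_pair_measure_cong[OF refl sets_lborel] refl] by measurable
  qed
  then have "(\<lambda>x. lim (\<lambda>n. fibre_average u b n x)) \<in> borel_measurable borel"
    by (rule borel_measurable_lim_metric)
  moreover have "(tan :: real \<Rightarrow> real) \<in> borel_measurable borel"
    unfolding tan_def[abs_def] by measurable
  ultimately show ?thesis
    unfolding fibre_value_def[abs_def] by (rule measurable_compose)
qed

lemma fibre_value_eq:
  assumes u[measurable]: "u \<in> borel_measurable borel" and s: "0 < s"
    and inv: "shift_invariant Q u (a + b) s" and a: "a \<in> range P" and b: "b \<in> range Q"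
  shows "AE x in lborel. x \<in> cell (a + b) (s / 2) \<longrightarrow> u x = fibre_value u b x"
proof -
  have ab: "P a = a" "Q a = 0" "P b = 0" "Q b = b" using a b by auto
  have "AE x in lborel. AE y in lborel.
      x \<in> cell (a + b) (s / 2) \<and> norm (Q y - b) < s / 2 \<longrightarrow> u (P x + Q y) = u x"
  proof (rule AE_lborel_shear)
    fix k
    show "AE x in lborel. x \<in> cell (a + b) (s / 2) \<and> norm (Q (x + k) - b) < s / 2 \<longrightarrow> u (P x + Q (x + k)) = u x"
    proof (cases "norm (Q k) < s")
      case True
      from shift_invariantD[OF inv this, of 0] show ?thesis
      proof eventually_elim
        case (elim x)
        have "P x + Q (x + k) = x + Q k" using P_plus_Q[of x] by (simp add: add.assoc[symmetric])
        then show ?case using elim cell_mono[of "s / 2" s] s by (auto simp del: Q_simps)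
      qed
    next
      case False
      have "\<not> (x \<in> cell (a + b) (s / 2) \<and> norm (Q (x + k) - b) < s / 2)" for x
      proof
        assume x: "x \<in> cell (a + b) (s / 2) \<and> norm (Q (x + k) - b) < s / 2"
        have "Q k = (Q (x + k) - b) - Q (x - (a + b))" by (simp add: ab)
        then have "norm (Q k) \<le> norm (Q (x + k) - b) + norm (Q (x - (a + b)))"
          by (metis norm_triangle_ineq4)
        with x False show False by (auto simp: cell_def)
      qed
      then show ?thesis by blast
    qed
  qed measurable
  then show ?thesis
  proof eventually_elim
    case (elim x)
    show ?case
    proof
      assume x: "x \<in> cell (a + b) (s / 2)"
      have avg: "fibre_average u b n x = arctan (u x)" if n: "1 / real (Suc n) < s / 2" for n
      proof -
        have [measurable]: "ball b (1 / real (Suc n)) \<in> sets borel" by simp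
        have meas: "(\<lambda>y. indicator (ball b (1 / real (Suc n))) y * arctan (u (P x + Q y))) \<in> borel_measurable borel"
          "(\<lambda>y. indicator (ball b (1 / real (Suc n))) y * arctan (u x)) \<in> borel_measurable borel"
          by measurable
        have "(LINT y|lborel. indicator (ball b (1 / real (Suc n))) y * arctan (u (P x + Q y)))
           = (LINT y|lborel. indicator (ball b (1 / real (Suc n))) y * arctan (u x))"
        proof (rule integral_cong_AE)
          show "AE y in lborel. indicator (ball b (1 / real (Suc n))) y * arctan (u (P x + Q y))
             = indicator (ball b (1 / real (Suc n))) y * arctan (u x)"
            using elim
          proof eventually_elim
            case (elim y)
            have "norm (Q y - b) < s / 2" if "y \<in> ball b (1 / real (Suc n))"
            proof -
              have "norm (Q y - b) = norm (Q (y - b))" by (simp add: ab)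
              also have "\<dots> \<le> norm (y - b)" by (rule norm_Q_le)
              also have "\<dots> < 1 / real (Suc n)" using that by (simp add: dist_norm norm_minus_commute)
              finally show ?thesis using n by simp
            qed
            then show ?case using elim x by (auto simp: indicator_def)
          qed
        qed (use meas in simp_all)
        also have "\<dots> = measure lborel (ball b (1 / real (Suc n))) * arctan (u x)" by simp
        finally have "fibre_average u b n x * measure lborel (ball b (1 / real (Suc n)))
           = arctan (u x) * measure lborel (ball b (1 / real (Suc n)))"
          unfolding fibre_average_def by simp
        moreover have "measure lborel (ball b (1 / real (Suc n))) \<noteq> 0"
          using content_ball_pos[of "1 / real (Suc n)" b] by simp
        ultimately show ?thesis by simp
      qed
      obtain N where N: "1 / real (Suc N) < s / 2"
        using reals_Archimedean[of "s / 2"] s by (auto simp: inverse_eq_divide)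
      have "fibre_average u b n x = arctan (u x)" if "N \<le> n" for n
      proof (rule avg)
        have "1 / real (Suc n) \<le> 1 / real (Suc N)" using that by (simp add: field_simps)
        with N show "1 / real (Suc n) < s / 2" by linarith
      qed
      then have "(\<lambda>n. fibre_average u b n x) \<longlonglongrightarrow> arctan (u x)"
        by (intro tendsto_eventually) (auto simp: eventually_sequentially)
      then show "u x = fibre_value u b x"
        by (simp add: fibre_value_def limI tan_arctan)
    qed
  qed
qed

proposition function_of_P_component:
  assumes u: "u \<in> borel_measurable borel"
    and \<Omega>1: "\<Omega>1 \<subseteq> range P" and \<Omega>2: "connected \<Omega>2" "\<Omega>2 \<subseteq> range Q"
    and inv: "\<And>a b. a \<in> \<Omega>1 \<Longrightarrow> b \<in> \<Omega>2 \<Longrightarrow> \<exists>s>0. shift_invariant Q u (a + b) s"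
  shows "\<exists>f\<in>borel_measurable borel. AE x in lborel. P x \<in> \<Omega>1 \<and> Q x \<in> \<Omega>2 \<longrightarrow> u x = f (P x)"
proof (cases "\<Omega>2 = {}")
  case True
  then show ?thesis by (intro bexI[of _ "\<lambda>_. 0"]) auto
next
  case False
  then obtain b0 where b0: "b0 \<in> \<Omega>2" by blast
  have "AE x in lborel. x \<in> {x. P x \<in> \<Omega>1 \<and> Q x \<in> \<Omega>2} \<longrightarrow> u x = fibre_value u b0 x"
  proof (rule AE_lborel_local)
    fix c assume "c \<in> {x. P x \<in> \<Omega>1 \<and> Q x \<in> \<Omega>2}"
    then have c: "P c \<in> \<Omega>1" "Q c \<in> \<Omega>2" by auto
    obtain s where s: "0 < s" "AE x in lborel. x \<in> cell (P c + Q c) s \<longrightarrow> u (x + (b0 - Q c)) = u x"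
      using translate_along_Q[OF \<Omega>2 inv[OF c(1)] c(2) b0] by blast
    obtain t where t: "0 < t" "shift_invariant Q u (P c + b0) t" using inv[OF c(1) b0] by blast
    have "AE x in lborel. x \<in> cell (P c + b0) (t / 2) \<longrightarrow> u x = fibre_value u b0 x"
      by (rule fibre_value_eq[OF u t]) (use b0 \<Omega>2 in auto)
    from AE_lborel_translate[OF this, of "b0 - Q c"] s(2)
    have "AE x in lborel. x \<in> cell c (min s (t / 2)) \<longrightarrow> u x = fibre_value u b0 x"
    proof eventually_elim
      case (elim x)
      show ?case
      proof
        assume x: "x \<in> cell c (min s (t / 2))"
        have "(b0 - Q c) + x - (P c + b0) = x - c" using P_plus_Q[of c] by (simp add: algebra_simps)
        then have 1: "(b0 - Q c) + x \<in> cell (P c + b0) (t / 2)" using x unfolding cell_def by auto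
        have 2: "x \<in> cell (P c + Q c) s" using x P_plus_Q[of c] unfolding cell_def by auto
        have "P b0 = 0" using b0 \<Omega>2 by auto
        then have "P (b0 - Q c + x) = P x" by simp
        then have "fibre_value u b0 (b0 - Q c + x) = fibre_value u b0 x"
          using fibre_value_P[of u b0] by metis
        then show "u x = fibre_value u b0 x" using elim 1 2 by (simp add: add.commute)
      qed
    qed
    then show "\<exists>T. open T \<and> c \<in> T \<and> (AE x in lborel. x \<in> T \<longrightarrow> u x = fibre_value u b0 x)"
      using s(1) t(1) by (intro exI[of _ "cell c (min s (t / 2))"]) (simp add: open_cell centre_in_cell)
  qed
  then show ?thesis
    using fibre_value_measurable[OF u, of b0] by (intro bexI[of _ "fibre_value u b0"]) (simp_all add: fibre_value_P)
qed

end

section \<open>The energy on an orthogonal decomposition\<close>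

lemma orthogonal_decomposition_sym:
  "orthogonal_decomposition X1 X2 \<Longrightarrow> orthogonal_decomposition X2 X1"
  unfolding orthogonal_decomposition_def by (metis add.commute orthogonal_commute)

lemma component_along_sum:
  assumes dec: "orthogonal_decomposition X1 X2" and a: "a \<in> X1" and b: "b \<in> X2"
  shows "component_along X1 X2 (a + b) = a"
proof -
  let ?a = "component_along X1 X2 (a + b)" and ?b = "component_along X2 X1 (a + b)"
  have s: "subspace X1" "subspace X2" and orth: "\<And>x y. x \<in> X1 \<Longrightarrow> y \<in> X2 \<Longrightarrow> x \<bullet> y = 0"
    using dec by (auto simp: orthogonal_decomposition_def orthogonal_def)
  have "?a - a \<in> X1" using s(1) a component_along_props(1)[OF dec] by (simp add: subspace_diff)
  moreover have "?a - a = b - ?b"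
    using component_along_props(3)[OF dec, of "a + b"] by (simp add: algebra_simps)
  moreover have "b - ?b \<in> X2" using s(2) b component_along_props(2)[OF dec] by (simp add: subspace_diff)
  ultimately have "(?a - a) \<bullet> (?a - a) = 0" using orth by metis
  then show ?thesis by simp
qed

lemma orthogonal_projections_component_along:
  assumes dec: "orthogonal_decomposition X1 X2"
  shows "orthogonal_projections (component_along X1 X2) (component_along X2 X1)"
    and "range (component_along X1 X2) = X1"
proof -
  note sym = orthogonal_decomposition_sym
  have lin: "linear (component_along X1 X2)" if dec: "orthogonal_decomposition X1 X2" for X1 X2 :: "'a set"
  proof (rule linearI)
    have s: "subspace X1" "subspace X2" using dec by (auto simp: orthogonal_decomposition_def)
    note mem = component_along_props(1,2)[OF dec]
    fix x y :: 'a and c :: real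
    have "x + y = (component_along X1 X2 x + component_along X1 X2 y) +
        (component_along X2 X1 x + component_along X2 X1 y)"
      using component_along_props(3)[OF dec, of x] component_along_props(3)[OF dec, of y]
      by (metis add.assoc add.left_commute)
    then show "component_along X1 X2 (x + y) = component_along X1 X2 x + component_along X1 X2 y"
      using component_along_sum[OF dec subspace_add[OF s(1) mem(1) mem(1)] subspace_add[OF s(2) mem(2) mem(2)]]
      by metis
    have "c *\<^sub>R x = c *\<^sub>R component_along X1 X2 x + c *\<^sub>R component_along X2 X1 x"
      using component_along_props(3)[OF dec, of x] by (metis scaleR_add_right)
    then show "component_along X1 X2 (c *\<^sub>R x) = c *\<^sub>R component_along X1 X2 x"
      using component_along_sum[OF dec subspace_scale[OF s(1) mem(1)] subspace_scale[OF s(2) mem(2)]]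
      by metis
  qed
  have fix1: "component_along X1 X2 a = a" if "a \<in> X1" for a
    using component_along_sum[OF dec that, of 0] dec
    by (simp add: orthogonal_decomposition_def subspace_0)
  show "range (component_along X1 X2) = X1"
    using fix1 component_along_props(1)[OF dec] by (metis image_subset_iff rangeI subsetI subset_antisym)
  show "orthogonal_projections (component_along X1 X2) (component_along X2 X1)"
  proof (rule orthogonal_projections.intro)
    show "component_along X1 X2 (component_along X1 X2 x) = component_along X1 X2 x" for x
      using fix1 component_along_props(1)[OF dec] by blast
    show "component_along X1 X2 x \<bullet> component_along X2 X1 y = 0" for x y
      using dec component_along_props(1,2)[OF dec]
      by (auto simp: orthogonal_decomposition_def orthogonal_def)
    show "component_along X1 X2 x + component_along X2 X1 x = x" for x
      using component_along_props(3)[OF dec, of x] by simp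
  qed (use dec sym lin in blast)+
qed

text \<open>
  A Borel function of the ambient space restricts to a measurable function on every subspace; no
  null sets of the subspace are involved.
\<close>

lemma measurable_subspace_lebesgue:
  fixes f :: "'a::euclidean_space \<Rightarrow> real"
  assumes "f \<in> borel_measurable borel"
  shows "f \<in> borel_measurable (restrict_space (subspace_lebesgue X) \<Omega>)"
proof (rule measurable_restrict_space1)
  have "f \<in> borel_measurable (restrict_space borel X)"
    using assms by (rule measurable_restrict_space1)
  then show "f \<in> borel_measurable (subspace_lebesgue X)"
    unfolding subspace_lebesgue_def Let_def
    by (intro measurable_completion) (simp cong: measurable_cong_sets)
qed

text \<open>
  A Borel representative of the kernel keeps the symmetry only almost everywhere, but for every
  single isometry.
\<close>

lemma radial_kernel_borel_version:
  fixes \<rho> :: "'a::euclidean_space \<Rightarrow> real"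
  assumes "radial_kernel \<rho>"
  obtains \<rho>' where "\<rho>' \<in> borel_measurable borel" "\<And>z. 0 \<le> \<rho>' z" "AE z in lborel. \<rho> z = \<rho>' z"
    "AE z in lborel. 1 < norm z \<longrightarrow> \<rho>' z = 0"
    "\<And>\<sigma>. orthogonal_transformation \<sigma> \<Longrightarrow> AE z in lborel. \<rho>' (\<sigma> z) = \<rho>' z"
    "\<not> (AE z in lborel. \<rho>' z = 0)"
proof -
  have int: "integrable lebesgue \<rho>" and nn: "\<And>z. 0 \<le> \<rho> z" and rad: "\<And>y z. norm y = norm z \<Longrightarrow> \<rho> y = \<rho> z"
    and one: "(LINT z|lebesgue. \<rho> z) = 1" and supp: "closure {z. \<rho> z \<noteq> 0} \<subseteq> cball 0 1"
    using assms unfolding radial_kernel_def by blast+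
  obtain g where g: "g \<in> borel_measurable lborel" "AE z in lborel. \<rho> z = g z"
    using completion_ex_borel_measurable_real[of \<rho> lborel] int by auto
  define \<rho>' where "\<rho>' z = max 0 (g z)" for z
  have ae: "AE z in lborel. \<rho> z = \<rho>' z"
    using g(2) by eventually_elim (metis \<rho>'_def max_absorb2 nn)
  show thesis
  proof (rule that[of \<rho>'])
    show "\<rho>' \<in> borel_measurable borel" using g(1) unfolding \<rho>'_def[abs_def] by simp
    show "0 \<le> \<rho>' z" for z by (simp add: \<rho>'_def)
    show "AE z in lborel. \<rho> z = \<rho>' z" by (fact ae)
    show "AE z in lborel. 1 < norm z \<longrightarrow> \<rho>' z = 0"
      using ae
    proof eventually_elim
      case (elim z)
      show ?case
      proof (rule impI, rule ccontr)
        assume "1 < norm z" "\<rho>' z \<noteq> 0"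
        then have "z \<in> closure {z. \<rho> z \<noteq> 0}" using elim closure_subset[of "{z. \<rho> z \<noteq> 0}"] by auto
        with supp \<open>1 < norm z\<close> show False by auto
      qed
    qed
    show "AE z in lborel. \<rho>' (\<sigma> z) = \<rho>' z" if \<sigma>: "orthogonal_transformation \<sigma>" for \<sigma>
      using ae AE_lborel_orthogonal[OF \<sigma> ae]
      by eventually_elim (metis orthogonal_transformation_norm[OF \<sigma>] rad)
    show "\<not> (AE z in lborel. \<rho>' z = 0)"
    proof
      assume "AE z in lborel. \<rho>' z = 0"
      with ae have "AE z in lborel. \<rho> z = 0" by eventually_elim simp
      then have "AE z in lebesgue. \<rho> z = 0" by (rule AE_completion)
      then have "(LINT z|lebesgue. \<rho> z) = 0" by (rule integral_eq_zero_AE)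
      with one show False by simp
    qed
  qed
qed

lemma energy_finite_frequently:
  assumes "energy X1 X2 \<Omega>1 \<Omega>2 \<rho> \<theta>1 \<theta>2 p u < \<infinity>"
  obtains K where "K < \<infinity>" "\<exists>\<^sub>F \<epsilon> in at_right 0. energy_eps X1 X2 \<Omega>1 \<Omega>2 \<rho> \<theta>1 \<theta>2 p \<epsilon> u \<le> K"
proof -
  obtain K where K: "energy X1 X2 \<Omega>1 \<Omega>2 \<rho> \<theta>1 \<theta>2 p u < K" "K < \<infinity>"
    using assms dense by blast
  have "\<not> (\<forall>\<^sub>F \<epsilon> in at_right 0. K \<le> energy_eps X1 X2 \<Omega>1 \<Omega>2 \<rho> \<theta>1 \<theta>2 p \<epsilon> u)"
    using Liminf_bounded[of K] K(1) unfolding energy_def by (metis leD)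
  then have "\<exists>\<^sub>F \<epsilon> in at_right 0. energy_eps X1 X2 \<Omega>1 \<Omega>2 \<rho> \<theta>1 \<theta>2 p \<epsilon> u \<le> K"
    unfolding frequently_def by (rule contrapos_nn) (auto elim!: eventually_mono)
  with K(2) show thesis by (rule that)
qed

text \<open>
  Around a point of the domain the energy dominates the weighted energy on a cell, for Borel
  representatives \<open>v\<close> of \<open>u\<close> and \<open>\<rho>'\<close> of \<open>\<rho>\<close>.
\<close>

lemma energy_eps_lower_bound:
  fixes X1 X2 :: "'a::euclidean_space set"
  assumes dec: "orthogonal_decomposition X1 X2"
  defines "P \<equiv> component_along X1 X2" and "Q \<equiv> component_along X2 X1"
  assumes c1: "\<And>y. y \<in> X1 \<Longrightarrow> norm (y - P c) < R \<Longrightarrow> y \<in> \<Omega>1"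
    and c2: "\<And>y. y \<in> X2 \<Longrightarrow> norm (y - Q c) < R \<Longrightarrow> y \<in> \<Omega>2"
    and v: "AE x in lborel. x \<in> \<Omega>1 + \<Omega>2 \<longrightarrow> u x = v x"
    and \<rho>: "AE z in lborel. \<rho> z = \<rho>' z" and supp: "AE z in lborel. 1 < norm z \<longrightarrow> \<rho>' z = 0"
    and \<epsilon>: "0 < \<epsilon>" "\<epsilon> < R / 2"
  shows "(\<integral>\<^sup>+z. ennreal (rescaled_kernel \<rho>' \<epsilon> z) *
      orthogonal_projections.weighted_energy P Q \<alpha> \<beta> p v (orthogonal_projections.cell P Q c (2 * (R / 4))) z \<partial>lborel)
    \<le> energy_eps X1 X2 \<Omega>1 \<Omega>2 \<rho> \<alpha> \<beta> p \<epsilon> u"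
proof -
  interpret orthogonal_projections P Q
    unfolding P_def Q_def by (rule orthogonal_projections_component_along(1)[OF dec])
  have mem: "P x \<in> X1" "Q x \<in> X2" for x
    unfolding P_def Q_def using component_along_props(1,2)[OF dec] by auto
  have sub: "subspace X1" "subspace X2" using dec by (auto simp: orthogonal_decomposition_def)
  define D where "D = cell c (2 * (R / 4))"
  have cell_sum: "x \<in> \<Omega>1 + \<Omega>2" if "x \<in> cell c R" for x
  proof -
    have "P x \<in> \<Omega>1" "Q x \<in> \<Omega>2" using that mem by (auto simp: cell_def intro: c1 c2)
    then show ?thesis using P_plus_Q[of x] by (metis set_plus_intro)
  qed
  have near: "x + w \<in> cell c R" if "x \<in> D" "norm (P w) \<le> \<epsilon>" "norm (Q w) \<le> \<epsilon>" for x w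
    using cell_translate[of x c "R / 2" w \<epsilon>] cell_mono[of "R / 2 + \<epsilon>" R c] that \<epsilon> by (auto simp: D_def)
  have D_inner: "x \<in> inner_domain X1 \<Omega>1 \<epsilon> + inner_domain X2 \<Omega>2 \<epsilon>" if x: "x \<in> D" for x
  proof -
    have nx: "norm (P x - P c) < R / 2" "norm (Q x - Q c) < R / 2" using x by (auto simp: D_def cell_def)
    have "P x \<in> inner_domain X1 \<Omega>1 \<epsilon>"
      unfolding inner_domain_def
    proof (rule INT_I)
      fix z assume "z \<in> {z \<in> X1. norm z < \<epsilon>}"
      then have z: "z \<in> X1" "norm z < \<epsilon>" by auto
      have "norm (P x + z - P c) < R" using nx z(2) \<epsilon> norm_triangle_ineq[of "P x - P c" z]
        by (simp add: algebra_simps)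
      then have "P x + z \<in> \<Omega>1" using c1 mem z sub by (simp add: subspace_add)
      then show "P x \<in> (\<lambda>x. x - z) ` \<Omega>1" by (rule rev_image_eqI) simp
    qed
    moreover have "Q x \<in> inner_domain X2 \<Omega>2 \<epsilon>"
      unfolding inner_domain_def
    proof (rule INT_I)
      fix z assume "z \<in> {z \<in> X2. norm z < \<epsilon>}"
      then have z: "z \<in> X2" "norm z < \<epsilon>" by auto
      have "norm (Q x + z - Q c) < R" using nx z(2) \<epsilon> norm_triangle_ineq[of "Q x - Q c" z]
        by (simp add: algebra_simps)
      then have "Q x + z \<in> \<Omega>2" using c2 mem z sub by (simp add: subspace_add)
      then show "Q x \<in> (\<lambda>x. x - z) ` \<Omega>2" by (rule rev_image_eqI) simp
    qed
    ultimately show ?thesis using P_plus_Q[of x] by (metis set_plus_intro)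
  qed
  have inner: "weighted_energy \<alpha> \<beta> p v D z \<le>
      (\<integral>\<^sup>+ x \<in> inner_domain X1 \<Omega>1 \<epsilon> + inner_domain X2 \<Omega>2 \<epsilon>.
           ennreal (\<bar>u (x + P z) - u x\<bar> powr \<alpha> * \<bar>u (x + Q z) - u x\<bar> powr \<beta> / norm z powr p) \<partial>lebesgue)"
    if z: "norm z \<le> \<epsilon>" for z
    unfolding weighted_energy_def nn_integral_completion
  proof (rule nn_integral_mono_AE)
    show "AE x in lborel. ennreal (corner_product \<alpha> \<beta> v z x / norm z powr p) * indicator D x
       \<le> ennreal (\<bar>u (x + P z) - u x\<bar> powr \<alpha> * \<bar>u (x + Q z) - u x\<bar> powr \<beta> / norm z powr p) *
          indicator (inner_domain X1 \<Omega>1 \<epsilon> + inner_domain X2 \<Omega>2 \<epsilon>) x"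
      using v AE_lborel_translate[OF v, of "P z"] AE_lborel_translate[OF v, of "Q z"]
    proof eventually_elim
      case (elim x)
      show ?case
      proof (cases "x \<in> D")
        case True
        have "x \<in> cell c R" using near[of x 0] True \<epsilon> by simp
        moreover have "x + P z \<in> cell c R" "x + Q z \<in> cell c R"
          using True z \<epsilon> norm_P_le[of z] norm_Q_le[of z] by (auto intro!: near)
        ultimately have "u x = v x" "u (x + P z) = v (x + P z)" "u (x + Q z) = v (x + Q z)"
          using elim cell_sum by (auto simp: add.commute)
        then show ?thesis using True D_inner[OF True] by (simp add: corner_product_def)
      qed simp
    qed
  qed
  have "(\<integral>\<^sup>+z. ennreal (rescaled_kernel \<rho>' \<epsilon> z) * weighted_energy \<alpha> \<beta> p v D z \<partial>lborel)
      \<le> energy_eps X1 X2 \<Omega>1 \<Omega>2 \<rho> \<alpha> \<beta> p \<epsilon> u"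
    unfolding energy_eps_def P_def[symmetric] Q_def[symmetric]
    unfolding nn_integral_completion[of lborel "\<lambda>z. ennreal (rescaled_kernel \<rho> \<epsilon> z) * _ z"]
  proof (rule nn_integral_mono_AE)
    show "AE z in lborel. ennreal (rescaled_kernel \<rho>' \<epsilon> z) * weighted_energy \<alpha> \<beta> p v D z
      \<le> ennreal (rescaled_kernel \<rho> \<epsilon> z) * (\<integral>\<^sup>+ x \<in> inner_domain X1 \<Omega>1 \<epsilon> + inner_domain X2 \<Omega>2 \<epsilon>.
           ennreal (\<bar>u (x + P z) - u x\<bar> powr \<alpha> * \<bar>u (x + Q z) - u x\<bar> powr \<beta> / norm z powr p) \<partial>lebesgue)"
      using AE_lborel_scale[OF \<rho> \<epsilon>(1)] AE_lborel_scale[OF supp \<epsilon>(1)]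
    proof eventually_elim
      case (elim z)
      show ?case
      proof (cases "norm z \<le> \<epsilon>")
        case True
        have "rescaled_kernel \<rho> \<epsilon> z = rescaled_kernel \<rho>' \<epsilon> z" using elim by (simp add: rescaled_kernel_def)
        then show ?thesis using inner[OF True] by (simp add: mult_left_mono)
      next
        case False
        then have "1 < norm (z /\<^sub>R \<epsilon>)" using \<epsilon>(1) by (simp add: field_simps)
        then have "rescaled_kernel \<rho>' \<epsilon> z = 0" using elim by (simp add: rescaled_kernel_def)
        then have "ennreal (rescaled_kernel \<rho>' \<epsilon> z) * weighted_energy \<alpha> \<beta> p v D z = 0" by simp
        then show ?thesis by (simp only: zero_le)
      qed
    qed
  qed
  then show ?thesis unfolding D_def .
qed

lemma openin_subspace_near:
  assumes "openin (top_of_set X) \<Omega>" "a \<in> \<Omega>"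
  obtains r where "0 < r" "\<And>y. y \<in> X \<Longrightarrow> norm (y - a) < r \<Longrightarrow> y \<in> \<Omega>"
  using assms unfolding openin_euclidean_subtopology_iff by (metis dist_norm)

theorem corollary11:
  fixes X1 X2 \<Omega>1 \<Omega>2 :: "(real ^ 'n) set"
    and \<rho> u :: "real ^ 'n \<Rightarrow> real"
    and \<theta>1 \<theta>2 :: real
  assumes "orthogonal_decomposition X1 X2"
    and "openin (top_of_set X1) \<Omega>1" "\<Omega>1 \<noteq> {}" "bounded \<Omega>1" "connected \<Omega>1"
    and "openin (top_of_set X2) \<Omega>2" "\<Omega>2 \<noteq> {}" "bounded \<Omega>2" "connected \<Omega>2"
    and "radial_kernel \<rho>"
    and "\<theta>1 > 0" "\<theta>2 > 0"
    and "u \<in> borel_measurable (lebesgue_on (\<Omega>1 + \<Omega>2))"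
    and "\<exists>p > critical_exponent \<theta>1 \<theta>2. energy X1 X2 \<Omega>1 \<Omega>2 \<rho> \<theta>1 \<theta>2 p u < \<infinity>"
  shows "u \<in> one_variable_functions X1 X2 \<Omega>1 \<Omega>2"
proof -
  note dec = assms(1) and op1 = assms(2) and op2 = assms(6) and u = assms(13)
  define P where "P = component_along X1 X2"
  define Q where "Q = component_along X2 X1"
  interpret orthogonal_projections P Q
    unfolding P_def Q_def by (rule orthogonal_projections_component_along(1)[OF dec])
  have rP: "range P = X1" and rQ: "range Q = X2"
    unfolding P_def Q_def
    using orthogonal_projections_component_along(2) dec orthogonal_decomposition_sym by blast+
  have sub: "\<Omega>1 \<subseteq> range P" "\<Omega>2 \<subseteq> range Q"
    using op1 op2 by (auto simp: rP rQ dest: openin_imp_subset)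
  have S: "\<Omega>1 + \<Omega>2 = {x. P x \<in> \<Omega>1 \<and> Q x \<in> \<Omega>2}"
  proof (intro set_eqI iffI)
    fix x assume "x \<in> \<Omega>1 + \<Omega>2"
    then obtain a b where "a \<in> \<Omega>1" "b \<in> \<Omega>2" "x = a + b" by (rule set_plus_elim)
    moreover from this have "P a = a" "Q a = 0" "P b = 0" "Q b = b"
      using sub range_P_simps range_Q_simps by blast+
    ultimately show "x \<in> {x. P x \<in> \<Omega>1 \<and> Q x \<in> \<Omega>2}" by simp
  next
    fix x assume "x \<in> {x. P x \<in> \<Omega>1 \<and> Q x \<in> \<Omega>2}"
    then show "x \<in> \<Omega>1 + \<Omega>2" using P_plus_Q[of x] by (metis mem_Collect_eq set_plus_intro)
  qed
  have near: "\<exists>R>0. (\<forall>y\<in>X1. norm (y - P c) < R \<longrightarrow> y \<in> \<Omega>1) \<and> (\<forall>y\<in>X2. norm (y - Q c) < R \<longrightarrow> y \<in> \<Omega>2)"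
    if c: "P c \<in> \<Omega>1" "Q c \<in> \<Omega>2" for c
  proof -
    obtain r1 where "0 < r1" "\<And>y. y \<in> X1 \<Longrightarrow> norm (y - P c) < r1 \<Longrightarrow> y \<in> \<Omega>1"
      by (rule openin_subspace_near[OF op1 c(1)]) (rule that)
    moreover obtain r2 where "0 < r2" "\<And>y. y \<in> X2 \<Longrightarrow> norm (y - Q c) < r2 \<Longrightarrow> y \<in> \<Omega>2"
      by (rule openin_subspace_near[OF op2 c(2)]) (rule that)
    ultimately show ?thesis by (intro exI[of _ "min r1 r2"]) auto
  qed
  have "open (\<Omega>1 + \<Omega>2)"
    unfolding open_contains_ball
  proof
    fix c assume "c \<in> \<Omega>1 + \<Omega>2"
    then have "P c \<in> \<Omega>1" "Q c \<in> \<Omega>2" by (auto simp: S)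
    from near[OF this] obtain R where R: "0 < R" "\<forall>y\<in>X1. norm (y - P c) < R \<longrightarrow> y \<in> \<Omega>1"
      "\<forall>y\<in>X2. norm (y - Q c) < R \<longrightarrow> y \<in> \<Omega>2" by blast
    have "cell c R \<subseteq> \<Omega>1 + \<Omega>2"
    proof
      fix x assume "x \<in> cell c R"
      then have "norm (P x - P c) < R" "norm (Q x - Q c) < R" by (auto simp: cell_def)
      moreover have "P x \<in> X1" "Q x \<in> X2" using rP rQ by blast+
      ultimately show "x \<in> \<Omega>1 + \<Omega>2" using R by (simp add: S)
    qed
    then show "\<exists>e>0. ball c e \<subseteq> \<Omega>1 + \<Omega>2" using R(1) ball_subset_cell by blast
  qed
  then have S_borel: "\<Omega>1 + \<Omega>2 \<in> sets borel" by (rule borel_open)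
  then have S_leb: "\<Omega>1 + \<Omega>2 \<in> sets lebesgue" by simp
  obtain p where p: "p > critical_exponent \<theta>1 \<theta>2" "energy X1 X2 \<Omega>1 \<Omega>2 \<rho> \<theta>1 \<theta>2 p u < \<infinity>"
    using assms(14) by blast
  obtain K where K: "K < \<infinity>" "\<exists>\<^sub>F \<epsilon> in at_right 0. energy_eps X1 X2 \<Omega>1 \<Omega>2 \<rho> \<theta>1 \<theta>2 p \<epsilon> u \<le> K"
    by (rule energy_finite_frequently[OF p(2)])
  have "(\<lambda>x. if x \<in> \<Omega>1 + \<Omega>2 then u x else 0) \<in> borel_measurable lebesgue"
    using borel_measurable_if[OF S_leb] u by blast
  then obtain v where v: "v \<in> borel_measurable lborel"
    and "AE x in lborel. (if x \<in> \<Omega>1 + \<Omega>2 then u x else 0) = v x"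
    using completion_ex_borel_measurable_real by blast
  then have uv: "AE x in lborel. x \<in> \<Omega>1 + \<Omega>2 \<longrightarrow> u x = v x"
    by (auto elim!: eventually_mono)
  have v_borel: "v \<in> borel_measurable borel" using v by simp
  obtain \<rho>' where \<rho>': "\<rho>' \<in> borel_measurable borel" "\<And>z. 0 \<le> \<rho>' z"
    and \<rho>_eq: "AE z in lborel. \<rho> z = \<rho>' z" and supp: "AE z in lborel. 1 < norm z \<longrightarrow> \<rho>' z = 0"
    and inv: "\<And>\<sigma>. orthogonal_transformation \<sigma> \<Longrightarrow> AE z in lborel. \<rho>' (\<sigma> z) = \<rho>' z"
    and nonnull: "\<not> (AE z in lborel. \<rho>' z = 0)"
    by (rule radial_kernel_borel_version[OF assms(10)]) (rule that)
  have loc: "\<exists>s>0. shift_invariant P v (a + b) s \<or> shift_invariant Q v (a + b) s"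
    if ab: "a \<in> \<Omega>1" "b \<in> \<Omega>2" for a b
  proof -
    define c where "c = a + b"
    have "a \<in> range P" "b \<in> range Q" using sub ab by blast+
    then have "P c = a" "Q c = b" using range_P_simps[of a] range_Q_simps[of b] by (simp_all add: c_def)
    with near[of c] ab obtain R where R: "0 < R" "\<And>y. y \<in> X1 \<Longrightarrow> norm (y - P c) < R \<Longrightarrow> y \<in> \<Omega>1"
      "\<And>y. y \<in> X2 \<Longrightarrow> norm (y - Q c) < R \<Longrightarrow> y \<in> \<Omega>2" by auto
    \<comment> \<open>shifts by less than \<open>R / 2\<close> keep the cell of radius \<open>R / 2\<close> inside the domain\<close>
    have freq: "\<exists>\<^sub>F \<epsilon> in at_right 0. (\<integral>\<^sup>+z. ennreal (rescaled_kernel \<rho>' \<epsilon> z) *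
        weighted_energy \<theta>1 \<theta>2 p v (cell c (2 * (R / 4))) z \<partial>lborel) \<le> K"
    proof (rule frequently_rev_mp[OF K(2)])
      have "\<forall>\<^sub>F \<epsilon> in at_right 0. 0 < \<epsilon> \<and> \<epsilon> < R / 2"
        using R(1) by (auto simp: eventually_at_right_field intro: exI[of _ "R / 2"])
      then show "\<forall>\<^sub>F \<epsilon> in at_right 0. energy_eps X1 X2 \<Omega>1 \<Omega>2 \<rho> \<theta>1 \<theta>2 p \<epsilon> u \<le> K \<longrightarrow>
        (\<integral>\<^sup>+z. ennreal (rescaled_kernel \<rho>' \<epsilon> z) *
          weighted_energy \<theta>1 \<theta>2 p v (cell c (2 * (R / 4))) z \<partial>lborel) \<le> K"
      proof eventually_elim
        case (elim \<epsilon>)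
        have "(\<integral>\<^sup>+z. ennreal (rescaled_kernel \<rho>' \<epsilon> z) *
          weighted_energy \<theta>1 \<theta>2 p v (cell c (2 * (R / 4))) z \<partial>lborel)
          \<le> energy_eps X1 X2 \<Omega>1 \<Omega>2 \<rho> \<theta>1 \<theta>2 p \<epsilon> u"
          unfolding P_def Q_def
          by (rule energy_eps_lower_bound[OF dec R(2,3)[unfolded P_def Q_def] uv \<rho>_eq supp])
            (use elim in simp_all)
        then show ?case by (blast intro: order.trans)
      qed
    qed
    have cone: "\<not> (AE z in lborel. z \<in> direction_cone h \<delta> \<longrightarrow> \<rho>' z = 0)"
      if "h \<noteq> 0" "0 < \<delta>" for h \<delta> by (rule direction_cone_not_null[OF inv nonnull that])
    have "AE x in lborel. x \<in> cell c (R / 4) \<longrightarrow> v (x + P h) = v x \<or> v (x + Q h) = v x"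
      if "norm h < R / 4" for h
      by (rule simultaneous_increments_vanish[OF assms(11,12) p(1) v_borel \<rho>' supp])
        (fact inv cone K(1) freq that)+
    then show ?thesis
      using local_dichotomy[OF v_borel, of "R / 4" c] R(1) by (simp add: c_def)
  qed
  have transfer: "AE x in lebesgue_on (\<Omega>1 + \<Omega>2). u x = g x"
    if "AE x in lborel. P x \<in> \<Omega>1 \<and> Q x \<in> \<Omega>2 \<longrightarrow> v x = g x" for g
  proof -
    have "AE x in lborel. x \<in> \<Omega>1 + \<Omega>2 \<longrightarrow> u x = g x"
      using that uv by eventually_elim (auto simp: S)
    then show ?thesis
      using S_leb by (subst AE_restrict_space_iff) (auto intro: AE_completion)
  qed
  from global_dichotomy[OF assms(5) sub(1) assms(9) sub(2) loc]
  show ?thesis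
  proof
    assume "\<forall>a\<in>\<Omega>1. \<forall>b\<in>\<Omega>2. \<exists>s>0. shift_invariant Q v (a + b) s"
    then obtain f where f: "f \<in> borel_measurable borel"
      "AE x in lborel. P x \<in> \<Omega>1 \<and> Q x \<in> \<Omega>2 \<longrightarrow> v x = f (P x)"
      using function_of_P_component[OF v_borel sub(1) assms(9) sub(2)] by blast
    then show ?thesis
      using u transfer[OF f(2)] measurable_subspace_lebesgue[OF f(1), of X1 \<Omega>1]
      unfolding one_variable_functions_def P_def by blast
  next
    assume inv: "\<forall>a\<in>\<Omega>1. \<forall>b\<in>\<Omega>2. \<exists>s>0. shift_invariant P v (a + b) s"
    have "\<exists>f\<in>borel_measurable borel. AE x in lborel. Q x \<in> \<Omega>2 \<and> P x \<in> \<Omega>1 \<longrightarrow> v x = f (Q x)"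
    proof (rule orthogonal_projections.function_of_P_component[OF swap v_borel sub(2) assms(5) sub(1)])
      show "\<exists>s>0. orthogonal_projections.shift_invariant Q P P v (b + a) s"
        if "b \<in> \<Omega>2" "a \<in> \<Omega>1" for a b
        unfolding shift_invariant_swap using inv that by (metis add.commute)
    qed
    then obtain f where f: "f \<in> borel_measurable borel"
      "AE x in lborel. P x \<in> \<Omega>1 \<and> Q x \<in> \<Omega>2 \<longrightarrow> v x = f (Q x)"
      by (auto simp: conj_commute)
    then show ?thesis
      using u transfer[OF f(2)] measurable_subspace_lebesgue[OF f(1), of X2 \<Omega>2]
      unfolding one_variable_functions_def Q_def by blast
  qed
qed

end
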